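(* Let $G=\mathbb{Z}_p\times\mathbb{Z}_2\times\mathbb{Z}_2\times\mathbb{Z}_2$ for an odd prime $p$, let $S$ be a proper subset of $G\setminus\{0\}$ that generates $G$, and let $S_0=S\cup\{0\}$. Let $0\in C\subseteq G$. Put $\mathbf{e}_1=(1,0,0,0)$. Then $C$ is a perfect code in $\mathrm{Cay}(G,S)$ if and only if there exist three elements $\mathbf{e}_2,\mathbf{e}_3,\mathbf{e}_4$ generating $\{0\}\times\mathbb{Z}_2\times\mathbb{Z}_2\times\mathbb{Z}_2$ and integer parameters such that $(S_0,C)$ is one of the following pairs: (1) $S_0=\{i\mathbf{e}_1+\alpha_i\mathbf{e}_2+\beta_i\mathbf{e}_3+\gamma_i\mathbf{e}_4\mid i\in[p]\}$, $C=\{i\mathbf{e}_2+j\mathbf{e}_3+k\mathbf{e}_4\mid i,j,k\in[2]\}$; (2) $S_0=\{i\mathbf{e}_1+j\mathbf{e}_2+\alpha_i\mathbf{e}_3+\beta_i\mathbf{e}_4\mid i\in[p],j\in[2]\}$, $C=\{\lambda_{ij}\mathbf{e}_2+i\mathbf{e}_3+j\mathbf{e}_4\mid i,j\in[2]\}$; (3) $S_0=\{i\mathbf{e}_1+\alpha_{ij}\mathbf{e}_2+j\mathbf{e}_3+\alpha_i\mathbf{e}_4\mid i\in[p],j\in[2]\}$, $C=\{j\mathbf{e}_2+\lambda_i\mathbf{e}_3+i\mathbf{e}_4\mid i,j\in[2]\}$; (4) $S_0=\{i\mathbf{e}_1+\alpha_{ij}\mathbf{e}_2+\beta_{ij}\mathbf{e}_3+j\mathbf{e}_4\mid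 i\in[p],j\in[2]\}$, $C=\{i\mathbf{e}_2+j\mathbf{e}_3\mid i,j\in[2]\}$; (5) $S_0=\{\alpha_i\mathbf{e}_1+\alpha_{ij}\mathbf{e}_2+j\mathbf{e}_3+i\mathbf{e}_4\mid i,j\in[2]\}$, $C=\{i\mathbf{e}_1+j\mathbf{e}_2+\lambda_i\mathbf{e}_3\mid i\in[p],j\in[2]\}$; (6) $S_0=\{\alpha_{ij}\mathbf{e}_1+\alpha_{ij}\mathbf{e}_2+i\mathbf{e}_3+j\mathbf{e}_4\mid i,j\in[2]\}$, $C=\{i\mathbf{e}_1+j\mathbf{e}_2\mid i\in[p],j\in[2]\}$; (7) $S_0=\{i\mathbf{e}_1+k\mathbf{e}_2+\alpha_{ij}\mathbf{e}_3+j\mathbf{e}_4\mid i\in[p],j,k\in[2]\}$, $C=\{\lambda_i\mathbf{e}_2+i\mathbf{e}_3\mid i\in[2]\}$; (8) $S_0=\{k\mathbf{e}_1+\alpha_{ij}\mathbf{e}_2+i\mathbf{e}_3+j\mathbf{e}_4\mid i,j\in[2],k\in[p]\}$, $C=\{\lambda_i\mathbf{e}_1+i\mathbf{e}_2\mid i\in[2]\}$; (9) $S_0=\{i\mathbf{e}_1+j\mathbf{e}_2+k\mathbf{e}_3+\alpha_i\mathbf{e}_4\mid i\in[p],j,k\in[2]\}$, $C=\{\lambda_i\mathbf{e}_2+\mu_i\mathbf{e}_3+i\mathbf{e}_4\mid i\in[2]\}$; (10) $S_0=\{i\mathbf{e}_1+\alpha_{ijk}\mathbf{e}_2+j\mathbf{e}_3+k\mathbf{e}_4\mid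 i\in[p],j,k\in[2]\}$, $C=\{i\mathbf{e}_2\mid i\in[2]\}$; (11) $S_0=\{\alpha_{ij}\mathbf{e}_1+k\mathbf{e}_2+i\mathbf{e}_3+j\mathbf{e}_4\mid i,j,k\in[2]\}$, $C=\{i\mathbf{e}_1+\lambda_i\mathbf{e}_2\mid i\in[p]\}$; (12) $S_0=\{\alpha_i\mathbf{e}_1+j\mathbf{e}_2+k\mathbf{e}_3+i\mathbf{e}_4\mid i,j,k\in[2]\}$, $C=\{i\mathbf{e}_1+\lambda_i\mathbf{e}_2+\mu_i\mathbf{e}_3\mid i\in[p]\}$; (13) $S_0=\{\alpha_{ijk}\mathbf{e}_1+i\mathbf{e}_2+j\mathbf{e}_3+k\mathbf{e}_4\mid i,j,k\in[2]\}$, $C=\{i\mathbf{e}_1\mid i\in[p]\}$.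
   Context: Groups are finite abelian, written additively; $\mathbb{Z}_n$ is the group of integers modulo $n$ and $[n]=\{0,1,\dots,n-1\}$. For $S\subseteq G\setminus\{0\}$, $\mathrm{Cay}(G,S)$ is the directed graph with vertex set $G$ and an arc from $x$ to $y$ if and only if $y-x\in S$ ($S$ is not assumed to be inverse-closed). A subset $C\subseteq G$ is a perfect code in $\mathrm{Cay}(G,S)$ if the sets $\{c\}\cup\{v:\text{there is an arc from } c \text{ to } v\}$, $c\in C$, form a partition of $G$. Greek letters with subscripts denote arbitrary integers, one for each value of the displayed indices, subject only to being $0$ when all subscripts are $0$; different letters (or index patterns) denote independent families, and an integer occurring several times in one element is the same integer each time. *)

theory Defs
  imports
    "HOL-Algebra.Elementary_Groups"
    "HOL-Algebra.Generated_Groups"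
    "HOL-Library.Disjoint_Sets"
    "HOL-Computational_Algebra.Primes"
    "Graph_Theory.Pair_Digraph"
begin

(* HOL-Algebra groups are multiplicative: y - x, i * e and 0 in additive notation
   are y \<otimes> inv x, e [^] i and \<one>. *)

definition cayley_digraph :: "('a, 'b) monoid_scheme \<Rightarrow> 'a set \<Rightarrow> 'a pair_pre_digraph" where
  "cayley_digraph G S =
     \<lparr>pverts = carrier G,
      parcs = {(x, y). x \<in> carrier G \<and> y \<in> carrier G \<and> y \<otimes>\<^bsub>G\<^esub> inv\<^bsub>G\<^esub> x \<in> S}\<rparr>"

definition closed_out_nbhd :: "('a, 'b) pre_digraph \<Rightarrow> 'a \<Rightarrow> 'a set" where
  "closed_out_nbhd D c = insert c {v. c \<rightarrow>\<^bsub>D\<^esub> v}"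

(* The partition is a family indexed by C: distinct codewords must have disjoint closed
   out-neighbourhoods, so equal neighbourhoods of distinct codewords are excluded, which
   partition_on applied to the set of neighbourhoods would not do. The parts are
   nonempty since c lies in its own part. *)
definition perfect_code :: "('a, 'b) pre_digraph \<Rightarrow> 'a set \<Rightarrow> bool" where
  "perfect_code D C \<longleftrightarrow>
     C \<subseteq> verts D \<and>
     disjoint_family_on (closed_out_nbhd D) C \<and>
     (\<Union>c\<in>C. closed_out_nbhd D c) = verts D"

end

theory Submission
  imports Defs "HOL-Number_Theory.Residues"
begin

text \<open>
  A perfect code \<open>C\<close> is the same thing as a factorization of the group: every element is
  uniquely \<open>s \<otimes> c\<close> with \<open>s \<in> S\<^sub>0\<close> and \<open>c \<in> C\<close> (\<open>perfect_code_cayley_digraph_iff\<close>). That each of the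
  thirteen families is a factorization is seen by solving for the parameters one coordinate at a time,
  in an order in which each equation contains one new unknown. The work lies in the converse.

  The main tool is a count of \<open>q\<close>-tuples for a prime \<open>q\<close>. Let \<open>G = A \<otimes> B\<close> be a factorization. For
  given \<open>x\<close> there are \<open>|A| ^ (q - 1)\<close> tuples \<open>(a\<^sub>1, \<dots>, a\<^sub>q)\<close> in \<open>A\<close> for which \<open>x\<close> divided by their product
  lies in \<open>B\<close>, because the last \<open>q - 1\<close> entries are free and determine the first. Rotation permutes
  these tuples and fixes the constant ones, so the number of \<open>a \<in> A\<close> with \<open>x \<otimes> inv (a ^ q) \<in> B\<close> is
  congruent to \<open>|A| ^ (q - 1)\<close> modulo \<open>q\<close> (\<open>cong_card_power_translates\<close>). This has two consequences.
  If \<open>|A| = q\<close>, the number is \<open>0\<close> or \<open>q\<close>, and so all translates of \<open>B\<close> by the powers \<open>a ^ q\<close> coincide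
  (\<open>factorization_prime_factor_translate\<close>). If \<open>q\<close> is prime to \<open>|A|\<close>, the number is never \<open>0\<close>, and so
  \<open>A\<close> may be replaced by the set of its \<open>q\<close>-th powers (\<open>factorization_power\<close>).

  In the group at hand, the \<open>p\<close>-th power is the projection onto the elementary abelian part \<open>V\<close> of order
  \<open>8\<close>. Exactly one factor has order prime to \<open>p\<close>, namely \<open>1\<close>, \<open>2\<close>, \<open>4\<close> or \<open>8\<close>. Call it \<open>B\<close> and the other
  one \<open>A\<close>. The second consequence allows \<open>B\<close> to be replaced by its projection, which makes \<open>A\<close> meet
  every coset of \<open>V\<close>. If \<open>|B| = 8\<close>, then \<open>|A| = p\<close>, and the first consequence says that the projection
  of \<open>A\<close> lies in the stabilizer of \<open>B\<close> in \<open>V\<close>. The size of this stabilizer decides the family, and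
  generation by \<open>S\<close> excludes or forces the whole of \<open>V\<close>. If \<open>|B| = 4\<close> and the projection of \<open>B\<close> is
  \<open>{\<one>, u, v, w}\<close> with independent \<open>u, v, w\<close>, then \<open>A\<close> is stable under \<open>u \<otimes> v \<otimes> w\<close>, and moving this
  element of order \<open>2\<close> from \<open>A\<close> to \<open>B\<close> leads back to the factor sizes \<open>p\<close> and \<open>8\<close>
  (\<open>independent_projection_split\<close>). If the projection is a subgroup \<open>W\<close>, then \<open>B\<close> does not generate the
  group, so it is the code. Now \<open>A\<close> splits over the two
  cosets of \<open>W\<close> into halves of size \<open>p\<close>, and the first consequence together with generation gives \<open>B = W\<close>
  (\<open>standard_form_code_4_subgroup\<close>). If \<open>|B| = 2\<close>, then \<open>B = {\<one>, c}\<close> and \<open>A\<close> is stable under \<open>c \<otimes> c\<close>,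
  which is trivial or generates the subgroup of order \<open>p\<close>.
\<close>

section \<open>Maps of prime order\<close>

text \<open>
  A point that is not fixed has exactly \<open>q\<close> distinct images under the powers of \<open>f\<close>, because \<open>q\<close> is prime.
  Such orbits can be removed one at a time without changing the count modulo \<open>q\<close>.
\<close>

lemma cong_card_fixed_points:
  assumes "prime q" "finite T" "\<And>x. x \<in> T \<Longrightarrow> f x \<in> T" "\<And>x. x \<in> T \<Longrightarrow> (f ^^ q) x = x"
  shows "[card T = card {x \<in> T. f x = x}] (mod q)"
  using assms(2-4)
proof (induction "card T" arbitrary: T rule: less_induct)
  case less
  show ?case
  proof (cases "\<forall>x\<in>T. f x = x")
    case True
    then have "{x \<in> T. f x = x} = T" by auto
    then show ?thesis by simp
  next
    case False
    then obtain x where x: "x \<in> T" "f x \<noteq> x" by auto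
    define R where "R = (\<lambda>i. (f ^^ i) x) ` {..<q}"
    have q: "q > 1" using assms(1) by (rule prime_gt_1_nat)
    have fT: "(f ^^ i) y \<in> T" if "y \<in> T" for i y
      using that less.prems(2) by (induction i) auto
    have ff: "(f ^^ m) ((f ^^ n) y) = (f ^^ (m + n)) y" for m n y
      by (simp add: funpow_add)
    have per: "(f ^^ (i * q)) y = y" if "y \<in> T" for i y
      using that less.prems(3) by (induction i) (auto simp: funpow_add)
    have inj: "inj_on (\<lambda>i. (f ^^ i) x) {..<q}"
    proof (rule linorder_inj_onI')
      fix i j assume ij: "i \<in> {..<q}" "j \<in> {..<q}" "i < j"
      show "(f ^^ i) x \<noteq> (f ^^ j) x"
      proof
        assume eq: "(f ^^ i) x = (f ^^ j) x"
        have "(f ^^ (q - i)) ((f ^^ i) x) = x"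
          using ij less.prems(3)[OF x(1)] by (simp add: ff)
        moreover have "(f ^^ (q - i)) ((f ^^ j) x) = (f ^^ (j - i)) x"
        proof -
          have "(f ^^ (q - i)) ((f ^^ j) x) = (f ^^ ((j - i) + q)) x"
            using ij by (simp add: ff add.commute)
          also have "\<dots> = (f ^^ (j - i)) x"
            using less.prems(3)[OF x(1)] by (simp add: funpow_add)
          finally show ?thesis .
        qed
        ultimately have fp: "(f ^^ (j - i)) x = x" using eq by simp
        have "\<not> q dvd j - i" using ij by (auto dest: dvd_imp_le)
        then have "coprime (j - i) q" using assms(1) by (simp add: coprime_commute prime_imp_coprime)
        then obtain m where "[(j - i) * m = 1] (mod q)"
          using cong_solve_coprime_nat by fastforce
        then obtain n where n: "(j - i) * m = n * q + 1"
          using q div_mult_mod_eq[of "(j - i) * m" q] that[of "(j - i) * m div q"]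
          by (simp add: cong_def)
        have "(f ^^ (m * (j - i))) x = x"
          using fp by (induction m) (auto simp: funpow_add)
        then have "(f ^^ (n * q + 1)) x = x" using n by (metis mult.commute)
        then have "f x = x" using per[OF x(1), of n] by (simp add: funpow_add)
        then show False using x by simp
      qed
    qed
    have cO: "card R = q" unfolding R_def by (simp add: card_image inj)
    have OT: "R \<subseteq> T" unfolding R_def using fT x by auto
    have Onf: "f y \<noteq> y" if "y \<in> R" for y
    proof
      assume fy: "f y = y"
      from that obtain i where i: "i < q" "y = (f ^^ i) x" unfolding R_def by auto
      have "(f ^^ k) y = y" for k using fy by (induction k) auto
      then have "(f ^^ (q - i)) y = y" .
      then have "y = x" using i less.prems(3)[OF x(1)] by (simp add: ff)
      then show False using fy x by simp
    qed
    have closed: "f y \<in> T - R" if y: "y \<in> T - R" for y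
    proof -
      have "f y \<notin> R"
      proof
        assume "f y \<in> R"
        then obtain i where i: "i < q" "f y = (f ^^ i) x" unfolding R_def by auto
        have "y = (f ^^ (q - 1)) (f y)"
        proof -
          have "(f ^^ (q - 1)) (f y) = (f ^^ q) y"
            using q ff[of "q - 1" 1 y] by simp
          then show ?thesis using less.prems(3) y by simp
        qed
        also have "\<dots> = (f ^^ (q - 1 + i)) x" unfolding i(2) by (rule ff)
        also have "\<dots> = (f ^^ ((q - 1 + i) mod q)) x"
          using per[OF fT[OF x(1)], of "(q - 1 + i) div q"]
            ff[of "(q - 1 + i) div q * q" "(q - 1 + i) mod q" x] by simp
        also have "\<dots> \<in> R" unfolding R_def using q by auto
        finally show False using y by simp
      qed
      then show ?thesis using y less.prems(2) by auto
    qed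
    have fin: "finite R" using OT less.prems(1) finite_subset by auto
    have "R \<noteq> {}" using cO q by auto
    then have lt: "card (T - R) < card T"
      using OT less.prems(1) by (intro psubset_card_mono) auto
    have "[card (T - R) = card {x \<in> T - R. f x = x}] (mod q)"
      by (rule less.hyps[OF lt]) (use less.prems closed in auto)
    moreover have "{y \<in> T - R. f y = y} = {y \<in> T. f y = y}" using Onf by auto
    moreover have "card T mod q = card (T - R) mod q"
      using cO card_Diff_subset[OF fin OT] card_mono[OF less.prems(1) OT] by (simp add: le_mod_geq)
    ultimately show ?thesis by (simp only: cong_def)
  qed
qed

section \<open>Factorizations of abelian groups\<close>

text \<open>
  The sets \<open>A\<close> and \<open>B\<close> tile the group: in additive notation \<open>G = A + B\<close> as a direct sum of subsets.
\<close>

definition factorization :: "('a, 'b) monoid_scheme \<Rightarrow> 'a set \<Rightarrow> 'a set \<Rightarrow> bool" where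
  "factorization G A B \<longleftrightarrow> A \<subseteq> carrier G \<and> B \<subseteq> carrier G \<and>
     bij_betw (\<lambda>(a, b). a \<otimes>\<^bsub>G\<^esub> b) (A \<times> B) (carrier G)"

context comm_group
begin

lemma factorization_commute:
  assumes "factorization G A B" shows "factorization G B A"
proof -
  have AB: "A \<subseteq> carrier G" "B \<subseteq> carrier G"
    and bij: "bij_betw (\<lambda>(a, b). a \<otimes> b) (A \<times> B) (carrier G)"
    using assms by (auto simp: factorization_def)
  have "bij_betw ((\<lambda>(a, b). a \<otimes> b) \<circ> prod.swap) (B \<times> A) (carrier G)"
    by (rule bij_betw_trans[OF _ bij]) (simp add: bij_betw_def product_swap)
  moreover have "((\<lambda>(a, b). a \<otimes> b) \<circ> prod.swap) z = (\<lambda>(a, b). a \<otimes> b) z" if "z \<in> B \<times> A" for z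
    using that AB m_comm by auto
  ultimately have "bij_betw (\<lambda>(a, b). a \<otimes> b) (B \<times> A) (carrier G)"
    using bij_betw_cong by (metis (no_types, lifting))
  then show ?thesis using AB by (simp add: factorization_def)
qed

lemma factorizationE:
  assumes "factorization G A B" "g \<in> carrier G"
  obtains a b where "a \<in> A" "b \<in> B" "g = a \<otimes> b"
proof -
  have "g \<in> (\<lambda>(a, b). a \<otimes> b) ` (A \<times> B)"
    using assms by (simp add: factorization_def bij_betw_def)
  then show ?thesis using that by auto
qed

lemma factorization_unique:
  assumes "factorization G A B" "a \<in> A" "b \<in> B" "a' \<in> A" "b' \<in> B" "a \<otimes> b = a' \<otimes> b'"
  shows "a = a' \<and> b = b'"
proof -
  have "inj_on (\<lambda>(a, b). a \<otimes> b) (A \<times> B)"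
    using assms(1) by (simp add: factorization_def bij_betw_def)
  from inj_onD[OF this, of "(a, b)" "(a', b')"] show ?thesis using assms by simp
qed

lemma factorization_card: "factorization G A B \<Longrightarrow> card A * card B = order G"
  unfolding factorization_def order_def card_cartesian_product[symmetric]
  by (elim conjE) (rule bij_betw_same_card)

text \<open>
  In a finite group a surjection from a product set of at most \<open>|G|\<close> pairs is automatically injective.
\<close>

lemma factorizationI:
  assumes "finite A" "finite B" "A \<subseteq> carrier G" "B \<subseteq> carrier G" "card A * card B \<le> order G"
    and surj: "\<And>g. g \<in> carrier G \<Longrightarrow> \<exists>a\<in>A. \<exists>b\<in>B. g = a \<otimes> b"
  shows "factorization G A B"
proof -
  have im: "(\<lambda>(a, b). a \<otimes> b) ` (A \<times> B) = carrier G"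
  proof
    show "carrier G \<subseteq> (\<lambda>(a, b). a \<otimes> b) ` (A \<times> B)" using surj by blast
  qed (use assms(3,4) in auto)
  have fin: "finite (A \<times> B)" using assms(1,2) by simp
  have "card (A \<times> B) \<le> card ((\<lambda>(a, b). a \<otimes> b) ` (A \<times> B))"
    unfolding im using assms(5) by (simp add: card_cartesian_product order_def)
  then have "inj_on (\<lambda>(a, b). a \<otimes> b) (A \<times> B)"
    by (intro eq_card_imp_inj_on fin le_antisym card_image_le)
  then show ?thesis using im assms(3,4) by (simp add: factorization_def bij_betw_def)
qed

text \<open>
  A factorization is maximal, so no factor can be enlarged. Hence, to identify \<open>A\<close> and \<open>B\<close> with members of
  a known family of factorizations, two inclusions are enough.
\<close>

lemma factorization_subset_eq:
  assumes "factorization G A B" "factorization G A' B'" "A' \<subseteq> A" "B' \<subseteq> B"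
  shows "A' = A \<and> B' = B"
proof -
  have *: "X' = X" if f: "factorization G X Y" "factorization G X' Y'" and s: "X' \<subseteq> X" "Y' \<subseteq> Y"
    for X Y X' Y'
  proof
    obtain y where y: "y \<in> Y'" using factorizationE[OF f(2) one_closed] by blast
    show "X \<subseteq> X'"
    proof
      fix x assume x: "x \<in> X"
      then have "x \<otimes> y \<in> carrier G" using f s y by (auto simp: factorization_def)
      then obtain a b where ab: "a \<in> X'" "b \<in> Y'" "x \<otimes> y = a \<otimes> b"
        by (rule factorizationE[OF f(2)])
      then have "x = a" using factorization_unique[OF f(1), of x y a b] x y s by auto
      then show "x \<in> X'" using ab by simp
    qed
  qed (rule s)
  show ?thesis
    using *[OF assms] *[OF factorization_commute[OF assms(1)] factorization_commute[OF assms(2)] assms(4,3)]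
    by (rule conjI)
qed

section \<open>Tuples under rotation\<close>

definition list_mult :: "'a list \<Rightarrow> 'a" where
  "list_mult xs = foldr (\<otimes>) xs \<one>"

lemma list_mult_closed: "set xs \<subseteq> carrier G \<Longrightarrow> list_mult xs \<in> carrier G"
  by (induction xs) (auto simp: list_mult_def)

lemma list_mult_simps [simp]: "list_mult [] = \<one>" "list_mult (x # xs) = x \<otimes> list_mult xs"
  by (simp_all add: list_mult_def)

lemma list_mult_append:
  "set xs \<subseteq> carrier G \<Longrightarrow> set ys \<subseteq> carrier G \<Longrightarrow> list_mult (xs @ ys) = list_mult xs \<otimes> list_mult ys"
  by (induction xs) (auto simp: m_assoc list_mult_closed)

lemma list_mult_rotate1: "set xs \<subseteq> carrier G \<Longrightarrow> list_mult (rotate1 xs) = list_mult xs"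
  by (cases xs) (simp_all add: list_mult_append list_mult_closed, simp add: list_mult_closed m_comm)

lemma list_mult_replicate: "a \<in> carrier G \<Longrightarrow> list_mult (replicate n a) = a [^] n"
  by (induction n) (simp_all, simp add: m_comm)

text \<open>
  The count of \<open>q\<close>-tuples described at the top. The tail of a tuple is arbitrary and determines its head,
  because \<open>x\<close> divided by the product of the tail has a unique expression \<open>a \<otimes> b\<close>.
\<close>

lemma cong_card_power_translates:
  assumes fac: "factorization G A B" and fin: "finite A" and q: "prime q" and x: "x \<in> carrier G"
  shows "[card {a \<in> A. x \<otimes> inv (a [^] q) \<in> B} = card A ^ (q - 1)] (mod q)"
proof -
  have AB: "A \<subseteq> carrier G" "B \<subseteq> carrier G" using fac by (auto simp: factorization_def)
  have q0: "q > 0" using q by (simp add: prime_gt_0_nat)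
  define T where "T = {xs. set xs \<subseteq> A \<and> length xs = q \<and> x \<otimes> inv (list_mult xs) \<in> B}"
  have finT: "finite T"
    using finite_lists_length_eq[OF fin, of q] by (rule rev_finite_subset) (auto simp: T_def)
  have "[card T = card {xs \<in> T. rotate1 xs = xs}] (mod q)"
  proof (rule cong_card_fixed_points[OF q finT])
    fix xs assume xs: "xs \<in> T"
    then have "set xs \<subseteq> carrier G" using AB by (auto simp: T_def)
    with xs show "rotate1 xs \<in> T" by (simp add: T_def list_mult_rotate1)
    show "(rotate1 ^^ q) xs = xs"
      using xs by (auto simp: T_def simp flip: rotate_def)
  qed
  moreover have "card {xs \<in> T. rotate1 xs = xs} = card {a \<in> A. x \<otimes> inv (a [^] q) \<in> B}"
  proof -
    have "{xs \<in> T. rotate1 xs = xs} = replicate q ` {a \<in> A. x \<otimes> inv (a [^] q) \<in> B}" (is "?L = ?R")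
    proof
      show "?L \<subseteq> ?R"
      proof
        fix xs assume xs: "xs \<in> ?L"
        then have l: "length xs = q" by (simp add: T_def)
        from xs l q0 have "card (set xs) = 1" using rotate1_fixpoint_card[of xs] by auto
        then obtain a where a: "set xs = {a}" by (auto simp: card_1_singleton_iff)
        then have rep: "xs = replicate q a" using l by (intro replicate_eqI) auto
        have "a \<in> A" using xs a by (auto simp: T_def)
        then have "x \<otimes> inv (a [^] q) \<in> B" using xs AB unfolding T_def rep
          by (auto simp: list_mult_replicate)
        then show "xs \<in> ?R" using rep \<open>a \<in> A\<close> by auto
      qed
      show "?R \<subseteq> ?L" using AB by (auto simp: T_def list_mult_replicate subset_iff)
    qed
    moreover have "inj_on (replicate q) X" for X :: "'a set"
      using q0 by (auto simp: inj_on_def)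
    ultimately show ?thesis by (simp add: card_image)
  qed
  moreover have "card T = card A ^ (q - 1)"
  proof -
    have "bij_betw tl T {ys. set ys \<subseteq> A \<and> length ys = q - 1}"
    proof (intro bij_betw_imageI inj_onI equalityI subsetI)
      fix xs ys assume xy: "xs \<in> T" "ys \<in> T" "tl xs = tl ys"
      from xy q0 obtain a as where as: "xs = a # as" by (cases xs) (auto simp: T_def)
      from xy q0 as obtain b where bs: "ys = b # as" by (cases ys) (auto simp: T_def)
      have c: "a \<in> A" "b \<in> A" "set as \<subseteq> carrier G" "a \<in> carrier G" "b \<in> carrier G"
        using xy as bs AB by (auto simp: T_def)
      let ?m = "list_mult as"
      have m: "?m \<in> carrier G" using c by (simp add: list_mult_closed)
      have "c \<otimes> (x \<otimes> inv (c \<otimes> ?m)) = x \<otimes> inv ?m" if "c \<in> carrier G" for c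
      proof -
        have "c \<otimes> (x \<otimes> inv (c \<otimes> ?m)) = (c \<otimes> inv c) \<otimes> (x \<otimes> inv ?m)"
          unfolding inv_mult[OF that m] using that m x by (simp only: m_ac m_closed inv_closed)
        then show ?thesis using that m x by simp
      qed
      then have "a \<otimes> (x \<otimes> inv (a \<otimes> ?m)) = b \<otimes> (x \<otimes> inv (b \<otimes> ?m))" using c by simp
      then have "a = b"
        using factorization_unique[OF fac, of a _ b] xy as bs c by (auto simp: T_def)
      then show "xs = ys" using as bs by simp
    next
      fix ys assume "ys \<in> tl ` T"
      then obtain xs where "xs \<in> T" "ys = tl xs" by blast
      then show "ys \<in> {ys. set ys \<subseteq> A \<and> length ys = q - 1}"
        by (cases xs) (auto simp: T_def)
    next
      fix ys assume ys: "ys \<in> {ys. set ys \<subseteq> A \<and> length ys = q - 1}"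
      then have m: "list_mult ys \<in> carrier G" using AB by (auto intro: list_mult_closed)
      obtain a b where ab: "a \<in> A" "b \<in> B" "x \<otimes> inv (list_mult ys) = a \<otimes> b"
        using factorizationE[OF fac] m x by (metis inv_closed m_closed)
      have c: "a \<in> carrier G" "b \<in> carrier G" using ab AB by auto
      have "x \<otimes> inv (a \<otimes> list_mult ys) = (x \<otimes> inv (list_mult ys)) \<otimes> inv a"
        using c m x by (simp add: inv_mult m_ac)
      also have "\<dots> = b \<otimes> (a \<otimes> inv a)"
        unfolding ab using c by (simp only: m_ac m_closed inv_closed)
      also have "\<dots> = b" using c by simp
      finally have "a # ys \<in> T" using ab ys q0 by (auto simp: T_def)
      then show "ys \<in> tl ` T" by force
    qed
    from bij_betw_same_card[OF this] show ?thesis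
      by (simp add: card_lists_length_eq[OF fin])
  qed
  ultimately show ?thesis by (simp add: cong_sym)
qed

text \<open>
  With \<open>q = |A|\<close> the number of \<open>a \<in> A\<close> with \<open>x \<otimes> inv (a ^ q) \<in> B\<close> is divisible by \<open>q\<close> and at most \<open>q\<close>.
  For \<open>x = b \<otimes> a ^ q\<close> it is positive, so it is all of \<open>A\<close>.
\<close>

lemma factorization_prime_factor_translate:
  assumes fac: "factorization G A B" and q: "prime (card A)"
    and a: "a \<in> A" "a' \<in> A" and b: "b \<in> B"
  shows "b \<otimes> a [^] card A \<otimes> inv (a' [^] card A) \<in> B"
proof -
  let ?q = "card A"
  have AB: "A \<subseteq> carrier G" "B \<subseteq> carrier G" using fac by (auto simp: factorization_def)
  have fin: "finite A" using prime_gt_0_nat[OF q] by (rule card_ge_0_finite)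
  have q1: "?q > 1" using q by (rule prime_gt_1_nat)
  let ?x = "b \<otimes> a [^] ?q"
  let ?N = "{a \<in> A. ?x \<otimes> inv (a [^] ?q) \<in> B}"
  have c: "a \<in> carrier G" "b \<in> carrier G" using a b AB by auto
  then have "[card ?N = ?q ^ (?q - 1)] (mod ?q)"
    by (intro cong_card_power_translates fac fin q) auto
  moreover have "?q dvd ?q ^ (?q - 1)" using q1 by (intro dvd_power) simp
  ultimately have "?q dvd card ?N" by (simp only: cong_dvd_iff)
  moreover have "a \<in> ?N" using a b c by (simp add: m_assoc)
  then have "card ?N > 0" using fin by (auto simp: card_gt_0_iff)
  moreover have "card ?N \<le> ?q" using fin by (intro card_mono) auto
  ultimately have "card ?N = ?q" by (simp add: dvd_imp_le le_antisym)
  then have "?N = A" using fin by (intro card_subset_eq) auto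
  then show ?thesis using a by blast
qed

text \<open>
  For \<open>q\<close> prime to \<open>|A|\<close> the count is congruent to \<open>1\<close> modulo \<open>q\<close> by Fermat's theorem, so every \<open>x\<close>
  is a product of some \<open>a ^ q\<close> and an element of \<open>B\<close>. Equality of sizes does the rest.
\<close>

lemma factorization_power:
  assumes fac: "factorization G A B" and fin: "finite (carrier G)" and q: "prime q" "coprime (card A) q"
  shows "factorization G ((\<lambda>a. a [^] q) ` A) B" and "inj_on (\<lambda>a. a [^] q) A"
proof -
  let ?P = "(\<lambda>a. a [^] q) ` A"
  have AB: "A \<subseteq> carrier G" "B \<subseteq> carrier G" using fac by (auto simp: factorization_def)
  have finA: "finite A" "finite B" using AB fin finite_subset by auto
  have le: "card ?P \<le> card A" using finA(1) by (rule card_image_le)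
  show fac': "factorization G ?P B"
  proof (rule factorizationI)
    show "card ?P * card B \<le> order G" using le factorization_card[OF fac] mult_le_mono1[OF le, of "card B"] by simp
    fix x assume x: "x \<in> carrier G"
    let ?N = "{a \<in> A. x \<otimes> inv (a [^] q) \<in> B}"
    have "[card ?N = card A ^ (q - 1)] (mod q)"
      by (intro cong_card_power_translates fac finA q x)
    moreover have "[card A ^ (q - 1) = 1] (mod q)"
      using q by (intro fermat_theorem) (auto simp: coprime_commute dest: coprime_absorb_left)
    ultimately have "[card ?N = 1] (mod q)" by (rule cong_trans)
    moreover have "n \<noteq> 0" if "[n = 1] (mod q)" for n
      using that prime_gt_1_nat[OF q(1)] by (intro notI) (simp add: cong_def)
    ultimately have "card ?N \<noteq> 0" by blast
    then obtain a where "a \<in> A" "x \<otimes> inv (a [^] q) \<in> B" by (auto simp: card_eq_0_iff)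
    moreover from this have "x = a [^] q \<otimes> (x \<otimes> inv (a [^] q))"
      using AB x by (auto simp: m_lcomm[of _ x])
    ultimately show "\<exists>a\<in>?P. \<exists>b\<in>B. x = a \<otimes> b" by blast
  qed (use AB finA in auto)
  have "card A * card B > 0"
    using fin factorization_card[OF fac] by (simp add: order_gt_0_iff_finite)
  moreover have "card A * card B = card ?P * card B"
    using factorization_card[OF fac] factorization_card[OF fac'] by simp
  ultimately have "card ?P = card A" by simp
  then show "inj_on (\<lambda>a. a [^] q) A" using finA eq_card_imp_inj_on by blast
qed

end

section \<open>Perfect codes in Cayley digraphs\<close>

lemma (in comm_group) closed_out_nbhd_cayley_digraph:
  assumes "S \<subseteq> carrier G" "c \<in> carrier G"
  shows "closed_out_nbhd (with_proj (cayley_digraph G S)) c = (\<lambda>s. s \<otimes> c) ` insert \<one> S"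
proof -
  have "{v. (c, v) \<in> parcs (cayley_digraph G S)} = (\<lambda>s. s \<otimes> c) ` S"
  proof (intro equalityI subsetI)
    fix v assume "v \<in> {v. (c, v) \<in> parcs (cayley_digraph G S)}"
    then have "v \<in> carrier G" "v \<otimes> inv c \<in> S" by (auto simp: cayley_digraph_def)
    moreover from this have "v = v \<otimes> inv c \<otimes> c" using assms by (simp add: m_assoc)
    ultimately show "v \<in> (\<lambda>s. s \<otimes> c) ` S" by blast
  next
    fix v assume "v \<in> (\<lambda>s. s \<otimes> c) ` S"
    then obtain s where s: "s \<in> S" "v = s \<otimes> c" by blast
    then have "v \<otimes> inv c = s" "s \<in> carrier G" using assms by (auto simp: m_assoc)
    then show "v \<in> {v. (c, v) \<in> parcs (cayley_digraph G S)}"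
      using s assms by (auto simp: cayley_digraph_def)
  qed
  then show ?thesis using assms by (simp add: closed_out_nbhd_def)
qed

text \<open>
  The closed out-neighbourhood of \<open>c\<close> is the translate of \<open>insert \<one> S\<close> by \<open>c\<close>. Disjointness of these
  translates is injectivity of the product map, and covering is surjectivity.
\<close>

theorem (in comm_group) perfect_code_cayley_digraph_iff:
  assumes S: "S \<subseteq> carrier G" and C: "C \<subseteq> carrier G"
  shows "perfect_code (with_proj (cayley_digraph G S)) C \<longleftrightarrow> factorization G (insert \<one> S) C"
proof -
  define T where "T = insert \<one> S"
  let ?N = "closed_out_nbhd (with_proj (cayley_digraph G S))"
  have Tc: "T \<subseteq> carrier G" using S by (simp add: T_def)
  have N: "?N c = (\<lambda>s. s \<otimes> c) ` T" if "c \<in> C" for c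
    using closed_out_nbhd_cayley_digraph[OF S] C that unfolding T_def by blast
  have "(\<Union>c\<in>C. ?N c) = (\<lambda>(s, c). s \<otimes> c) ` (T \<times> C)"
  proof -
    have "(\<Union>c\<in>C. ?N c) = (\<Union>c\<in>C. (\<lambda>s. s \<otimes> c) ` T)" using N by simp
    also have "\<dots> = (\<lambda>(s, c). s \<otimes> c) ` (T \<times> C)"
      by auto
    finally show ?thesis .
  qed
  moreover have "disjoint_family_on ?N C \<longleftrightarrow> inj_on (\<lambda>(s, c). s \<otimes> c) (T \<times> C)"
  proof
    assume dis: "disjoint_family_on ?N C"
    show "inj_on (\<lambda>(s, c). s \<otimes> c) (T \<times> C)"
    proof (rule inj_onI, elim SigmaE, hypsubst, unfold prod.case prod.inject)
      fix s c s' c' assume a: "s \<in> T" "c \<in> C" "s' \<in> T" "c' \<in> C" and eq: "s \<otimes> c = s' \<otimes> c'"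
      have "s \<otimes> c \<in> ?N c" unfolding N[OF a(2)] using a(1) by (rule imageI)
      moreover have "s \<otimes> c \<in> ?N c'" unfolding eq N[OF a(4)] using a(3) by (rule imageI)
      ultimately have c: "c = c'" using dis a unfolding disjoint_family_on_def by blast
      have "s \<in> carrier G" "s' \<in> carrier G" "c' \<in> carrier G" using a Tc C by blast+
      then show "s = s' \<and> c = c'" using c eq by simp
    qed
  next
    assume inj: "inj_on (\<lambda>(s, c). s \<otimes> c) (T \<times> C)"
    show "disjoint_family_on ?N C"
      unfolding disjoint_family_on_def
    proof (intro ballI impI)
      fix c c' assume a: "c \<in> C" "c' \<in> C" "c \<noteq> c'"
      have "s \<otimes> c \<noteq> s' \<otimes> c'" if "s \<in> T" "s' \<in> T" for s s'
        using inj_onD[OF inj, of "(s, c)" "(s', c')"] a that by auto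
      then show "?N c \<inter> ?N c' = {}" unfolding N[OF a(1)] N[OF a(2)] by auto
    qed
  qed
  ultimately show ?thesis
    unfolding perfect_code_def factorization_def bij_betw_def T_def[symmetric]
    using C Tc by (simp add: cayley_digraph_def)
qed

section \<open>Coordinates in a cyclic group times an elementary group of order eight\<close>

lemma (in group) int_pow_mod:
  assumes "x \<in> carrier G" "x [^] n = \<one>"
  shows "x [^] (z mod int n) = x [^] z"
proof -
  have "x [^] (int n * (z div int n)) = \<one>"
    using assms int_pow_pow[of x "int n" "z div int n"] by (simp add: int_pow_int)
  then show ?thesis
    using assms int_pow_mult[of x "int n * (z div int n)" "z mod int n"] by simp
qed

lemma card_family1: "finite I \<Longrightarrow> finite {f i | i. i \<in> I} \<and> card {f i | i. i \<in> I} \<le> card I"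
  using card_image_le[of I f] by (simp add: setcompr_eq_image)

lemma card_family2:
  assumes "finite I" "finite J"
  shows "finite {f i j | i j. i \<in> I \<and> j \<in> J} \<and> card {f i j | i j. i \<in> I \<and> j \<in> J} \<le> card I * card J"
proof -
  have "{f i j | i j. i \<in> I \<and> j \<in> J} = (\<lambda>(i, j). f i j) ` (I \<times> J)" by auto
  then show ?thesis using assms card_image_le[of "I \<times> J" "\<lambda>(i, j). f i j"]
    by (simp add: card_cartesian_product)
qed

lemma card_family3:
  assumes "finite I" "finite J" "finite K"
  shows "finite {f i j k | i j k. i \<in> I \<and> j \<in> J \<and> k \<in> K} \<and>
    card {f i j k | i j k. i \<in> I \<and> j \<in> J \<and> k \<in> K} \<le> card I * card J * card K"
proof -
  have "{f i j k | i j k. i \<in> I \<and> j \<in> J \<and> k \<in> K} = (\<lambda>(i, j, k). f i j k) ` (I \<times> J \<times> K)"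
    by force
  then show ?thesis using assms card_image_le[of "I \<times> J \<times> K" "\<lambda>(i, j, k). f i j k"]
    by (simp add: card_cartesian_product mult.assoc)
qed

text \<open>
  An internal description of \<open>\<int>\<^sub>p \<times> \<int>\<^sub>2 \<times> \<int>\<^sub>2 \<times> \<int>\<^sub>2\<close>: \<open>e1\<close> generates the first factor, and
  \<open>V\<close> is the product of the other three.
\<close>

locale zp_times_z2_cubed = comm_group G for G (structure) +
  fixes p :: nat and e1 :: 'a and V :: "'a set"
  assumes p_prime: "prime p" and p_odd: "odd p"
    and e1_closed [simp]: "e1 \<in> carrier G" and e1_pow: "e1 [^] p = \<one>"
    and V_subgroup: "subgroup V G" and V_card: "card V = 8"
    and V_square: "v \<in> V \<Longrightarrow> v \<otimes> v = \<one>"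
    and decomposition: "bij_betw (\<lambda>(i, v). e1 [^] i \<otimes> v) ({0..<int p} \<times> V) (carrier G)"
begin

lemma p_gt_1: "p > 1"
  using p_prime by (rule prime_gt_1_nat)

lemma V_closed: "v \<in> V \<Longrightarrow> v \<in> carrier G"
  using V_subgroup by (rule subgroup.mem_carrier)

lemma V_mult: "v \<in> V \<Longrightarrow> v' \<in> V \<Longrightarrow> v \<otimes> v' \<in> V"
  using V_subgroup by (rule subgroup.m_closed)

lemma V_one: "\<one> \<in> V"
  using V_subgroup by (rule subgroup.one_closed)

lemma V_finite: "finite V"
  using V_card by (intro card_ge_0_finite) simp

lemma order_G: "order G = 8 * p"
  using bij_betw_same_card[OF decomposition]
  by (simp add: order_def card_cartesian_product V_card)

lemma finite_G: "finite (carrier G)"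
proof -
  have "finite ({0..<int p} \<times> V)" using V_finite by simp
  then show ?thesis using bij_betw_finite[OF decomposition] by simp
qed

lemma decompose:
  assumes "g \<in> carrier G"
  obtains i v where "i \<in> {0..<int p}" "v \<in> V" "g = e1 [^] i \<otimes> v"
proof -
  have "g \<in> (\<lambda>(i, v). e1 [^] i \<otimes> v) ` ({0..<int p} \<times> V)"
    using assms decomposition by (simp add: bij_betw_def)
  then show ?thesis using that by auto
qed

end

locale zp_times_z2_cubed_basis = zp_times_z2_cubed +
  fixes e2 e3 e4
  assumes basis: "generate G {e2, e3, e4} = V"
begin

text \<open>
  In additive notation this is \<open>a e\<^sub>1 + b e\<^sub>2 + c e\<^sub>3 + d e\<^sub>4\<close>. The four coordinates count modulo \<open>p\<close>, \<open>2\<close>, \<open>2\<close>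
  and \<open>2\<close>.
\<close>

definition comb :: "int \<Rightarrow> int \<Rightarrow> int \<Rightarrow> int \<Rightarrow> 'a" where
  "comb a b c d = e1 [^] a \<otimes> e2 [^] b \<otimes> e3 [^] c \<otimes> e4 [^] d"

lemma basis_in_V: "e2 \<in> V" "e3 \<in> V" "e4 \<in> V"
  using basis generate.incl[of _ "{e2, e3, e4}" G] by auto

lemma basis_closed [simp]: "e2 \<in> carrier G" "e3 \<in> carrier G" "e4 \<in> carrier G"
  using basis_in_V by (auto intro: V_closed)

lemma comb_closed [simp]: "comb a b c d \<in> carrier G"
  by (simp add: comb_def)

lemma comb_0: "comb 0 0 0 0 = \<one>"
  by (simp add: comb_def)

lemma comb_mult:
  "comb a b c d \<otimes> comb a' b' c' d' = comb (a + a') (b + b') (c + c') (d + d')"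
  by (simp add: comb_def int_pow_mult m_ac)

lemma comb_cong:
  assumes "[a = a'] (mod int p)" "[b = b'] (mod 2)" "[c = c'] (mod 2)" "[d = d'] (mod 2)"
  shows "comb a b c d = comb a' b' c' d'"
proof -
  have *: "x [^] z = x [^] z'" if "x \<in> carrier G" "x [^] n = \<one>" "[z = z'] (mod int n)" for x z z' n
    using int_pow_mod[OF that(1,2)] that(3) unfolding cong_def by metis
  have sq: "x [^] (2::nat) = \<one>" if "x \<in> V" for x
    using V_square[OF that] V_closed[OF that] by (simp add: numeral_2_eq_2)
  show ?thesis
    unfolding comb_def using assms basis_in_V
    by (simp add: *[of e1 p a a'] *[of e2 2 b b'] *[of e3 2 c c'] *[of e4 2 d d'] e1_pow sq)
qed

lemma comb_mult_eq:
  assumes "[a + a' = x] (mod int p)" "[b + b' = y] (mod 2)" "[c + c' = z] (mod 2)" "[d + d' = u] (mod 2)"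
  shows "comb a b c d \<otimes> comb a' b' c' d' = comb x y z u"
  unfolding comb_mult using assms by (rule comb_cong)

lemma V_comb:
  assumes "v \<in> V" obtains b c d where "v = comb 0 b c d"
proof -
  have "v \<in> generate G {e2, e3, e4}" using assms basis by simp
  then have "\<exists>b c d. v = comb 0 b c d"
  proof induction
    case one
    show ?case using comb_0 by metis
  next
    case (incl h)
    have "e2 = comb 0 1 0 0" "e3 = comb 0 0 1 0" "e4 = comb 0 0 0 1" by (simp_all add: comb_def)
    then show ?case using incl by blast
  next
    case (inv h)
    have "inv e2 = comb 0 (-1) 0 0" "inv e3 = comb 0 0 (-1) 0" "inv e4 = comb 0 0 0 (-1)"
      by (simp_all add: comb_def int_pow_neg)
    then show ?case using inv by blast
  next
    case (eng h1 h2)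
    then show ?case by (metis comb_mult add_0)
  qed
  then show ?thesis using that by blast
qed

lemma carrier_comb:
  assumes "g \<in> carrier G" obtains a b c d where "g = comb a b c d"
proof -
  obtain i v where "i \<in> {0..<int p}" and g: "v \<in> V" "g = e1 [^] i \<otimes> v"
    using assms by (rule decompose)
  obtain b c d where "v = comb 0 b c d" using V_comb[OF g(1)] .
  then have "g = comb i b c d" using g by (simp add: comb_def m_assoc)
  then show ?thesis by (rule that)
qed

text \<open>
  Families are parametrized by products of index ranges, which bounds their sizes. Only the solvability of
  \<open>s \<otimes> t = comb a b c d\<close> remains.
\<close>

lemma factorization_combI:
  assumes S: "finite S \<and> card S \<le> m" and C: "finite C \<and> card C \<le> n" and mn: "m * n = 8 * p"
    and cl: "S \<subseteq> carrier G" "C \<subseteq> carrier G"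
    and surj: "\<And>a b c d. \<exists>s\<in>S. \<exists>t\<in>C. s \<otimes> t = comb a b c d"
  shows "factorization G S C"
proof (rule factorizationI)
  show "card S * card C \<le> order G"
    unfolding order_G mn[symmetric] using S C by (intro mult_le_mono) auto
  fix g assume "g \<in> carrier G"
  then obtain a b c d where "g = comb a b c d" by (rule carrier_comb)
  then show "\<exists>a\<in>S. \<exists>b\<in>C. g = a \<otimes> b" using surj by metis
qed (use S C cl in auto)

text \<open>
  The thirteen families, numbered as the disjuncts of \<open>standard_pair\<close>. The local definitions in each proof solve the
  four coordinate equations of \<open>s \<otimes> t = comb x y z u\<close> in triangular order; primed indices belong to the
  code, and each equation determines one index from those found before it.
\<close>

lemma factorization_1:
  fixes \<alpha> :: "int \<Rightarrow> int" and \<beta> :: "int \<Rightarrow> int" and \<gamma> :: "int \<Rightarrow> int"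
  shows "factorization G {comb i (\<alpha> i) (\<beta> i) (\<gamma> i) | i. i \<in> {0..<int p}}
    {comb 0 i j k | i j k. i \<in> {0..<2::int} \<and> j \<in> {0..<2::int} \<and> k \<in> {0..<2::int}}" (is "factorization G ?S ?C")
proof (rule factorization_combI[OF card_family1 card_family3])
  fix x y z u :: int
  define i where "i = x mod int p"
  define i' where "i' = (y - \<alpha> i) mod 2"
  define j' where "j' = (z - \<beta> i) mod 2"
  define k' where "k' = (u - \<gamma> i) mod 2"
  have eq: "comb i (\<alpha> i) (\<beta> i) (\<gamma> i) \<otimes> comb 0 i' j' k' = comb x y z u"
    by (rule comb_mult_eq) (simp_all add: i_def i'_def j'_def k'_def cong_def mod_simps)
  have idx: "i \<in> {0..<int p}" "i' \<in> {0..<2}" "j' \<in> {0..<2}" "k' \<in> {0..<2}"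
    using p_gt_1 by (simp_all add: i_def i'_def j'_def k'_def)
  have "comb i (\<alpha> i) (\<beta> i) (\<gamma> i) \<in> ?S" "comb 0 i' j' k' \<in> ?C"
    using idx by blast+
  with eq show "\<exists>s\<in>?S. \<exists>t\<in>?C. s \<otimes> t = comb x y z u" by blast
qed auto

lemma factorization_2:
  fixes \<alpha> :: "int \<Rightarrow> int" and \<beta> :: "int \<Rightarrow> int" and \<kappa> :: "int \<Rightarrow> int \<Rightarrow> int"
  shows "factorization G {comb i j (\<alpha> i) (\<beta> i) | i j. i \<in> {0..<int p} \<and> j \<in> {0..<2::int}}
    {comb 0 (\<kappa> i j) i j | i j. i \<in> {0..<2::int} \<and> j \<in> {0..<2::int}}" (is "factorization G ?S ?C")
proof (rule factorization_combI[OF card_family2 card_family2])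
  fix x y z u :: int
  define i where "i = x mod int p"
  define i' where "i' = (z - \<alpha> i) mod 2"
  define j' where "j' = (u - \<beta> i) mod 2"
  define j where "j = (y - \<kappa> i' j') mod 2"
  have eq: "comb i j (\<alpha> i) (\<beta> i) \<otimes> comb 0 (\<kappa> i' j') i' j' = comb x y z u"
    by (rule comb_mult_eq) (simp_all add: i_def i'_def j'_def j_def cong_def mod_simps)
  have idx: "i \<in> {0..<int p}" "i' \<in> {0..<2}" "j' \<in> {0..<2}" "j \<in> {0..<2}"
    using p_gt_1 by (simp_all add: i_def i'_def j'_def j_def)
  have "comb i j (\<alpha> i) (\<beta> i) \<in> ?S" "comb 0 (\<kappa> i' j') i' j' \<in> ?C"
    using idx by blast+
  with eq show "\<exists>s\<in>?S. \<exists>t\<in>?C. s \<otimes> t = comb x y z u" by blast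
qed auto

lemma factorization_3:
  fixes \<alpha> :: "int \<Rightarrow> int \<Rightarrow> int" and \<alpha>' :: "int \<Rightarrow> int" and \<kappa> :: "int \<Rightarrow> int"
  shows "factorization G {comb i (\<alpha> i j) j (\<alpha>' i) | i j. i \<in> {0..<int p} \<and> j \<in> {0..<2::int}}
    {comb 0 j (\<kappa> i) i | i j. i \<in> {0..<2::int} \<and> j \<in> {0..<2::int}}" (is "factorization G ?S ?C")
proof (rule factorization_combI[OF card_family2 card_family2])
  fix x y z u :: int
  define i where "i = x mod int p"
  define i' where "i' = (u - \<alpha>' i) mod 2"
  define j where "j = (z - \<kappa> i') mod 2"
  define j' where "j' = (y - \<alpha> i j) mod 2"
  have eq: "comb i (\<alpha> i j) j (\<alpha>' i) \<otimes> comb 0 j' (\<kappa> i') i' = comb x y z u"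
    by (rule comb_mult_eq) (simp_all add: i_def i'_def j_def j'_def cong_def mod_simps)
  have idx: "i \<in> {0..<int p}" "i' \<in> {0..<2}" "j \<in> {0..<2}" "j' \<in> {0..<2}"
    using p_gt_1 by (simp_all add: i_def i'_def j_def j'_def)
  have "comb i (\<alpha> i j) j (\<alpha>' i) \<in> ?S" "comb 0 j' (\<kappa> i') i' \<in> ?C"
    using idx by blast+
  with eq show "\<exists>s\<in>?S. \<exists>t\<in>?C. s \<otimes> t = comb x y z u" by blast
qed auto

lemma factorization_4:
  fixes \<alpha> :: "int \<Rightarrow> int \<Rightarrow> int" and \<beta> :: "int \<Rightarrow> int \<Rightarrow> int"
  shows "factorization G {comb i (\<alpha> i j) (\<beta> i j) j | i j. i \<in> {0..<int p} \<and> j \<in> {0..<2::int}}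
    {comb 0 i j 0 | i j. i \<in> {0..<2::int} \<and> j \<in> {0..<2::int}}" (is "factorization G ?S ?C")
proof (rule factorization_combI[OF card_family2 card_family2])
  fix x y z u :: int
  define i where "i = x mod int p"
  define j where "j = u mod 2"
  define i' where "i' = (y - \<alpha> i j) mod 2"
  define j' where "j' = (z - \<beta> i j) mod 2"
  have eq: "comb i (\<alpha> i j) (\<beta> i j) j \<otimes> comb 0 i' j' 0 = comb x y z u"
    by (rule comb_mult_eq) (simp_all add: i_def j_def i'_def j'_def cong_def mod_simps)
  have idx: "i \<in> {0..<int p}" "j \<in> {0..<2}" "i' \<in> {0..<2}" "j' \<in> {0..<2}"
    using p_gt_1 by (simp_all add: i_def j_def i'_def j'_def)
  have "comb i (\<alpha> i j) (\<beta> i j) j \<in> ?S" "comb 0 i' j' 0 \<in> ?C"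
    using idx by blast+
  with eq show "\<exists>s\<in>?S. \<exists>t\<in>?C. s \<otimes> t = comb x y z u" by blast
qed auto

lemma factorization_5:
  fixes \<alpha>' :: "int \<Rightarrow> int" and \<alpha> :: "int \<Rightarrow> int \<Rightarrow> int" and \<kappa> :: "int \<Rightarrow> int"
  shows "factorization G {comb (\<alpha>' i) (\<alpha> i j) j i | i j. i \<in> {0..<2::int} \<and> j \<in> {0..<2::int}}
    {comb i j (\<kappa> i) 0 | i j. i \<in> {0..<int p} \<and> j \<in> {0..<2::int}}" (is "factorization G ?S ?C")
proof (rule factorization_combI[OF card_family2 card_family2])
  fix x y z u :: int
  define i where "i = u mod 2"
  define i' where "i' = (x - \<alpha>' i) mod int p"
  define j where "j = (z - \<kappa> i') mod 2"
  define j' where "j' = (y - \<alpha> i j) mod 2"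
  have eq: "comb (\<alpha>' i) (\<alpha> i j) j i \<otimes> comb i' j' (\<kappa> i') 0 = comb x y z u"
    by (rule comb_mult_eq) (simp_all add: i_def i'_def j_def j'_def cong_def mod_simps)
  have idx: "i \<in> {0..<2}" "i' \<in> {0..<int p}" "j \<in> {0..<2}" "j' \<in> {0..<2}"
    using p_gt_1 by (simp_all add: i_def i'_def j_def j'_def)
  have "comb (\<alpha>' i) (\<alpha> i j) j i \<in> ?S" "comb i' j' (\<kappa> i') 0 \<in> ?C"
    using idx by blast+
  with eq show "\<exists>s\<in>?S. \<exists>t\<in>?C. s \<otimes> t = comb x y z u" by blast
qed auto

lemma factorization_6:
  fixes \<alpha> :: "int \<Rightarrow> int \<Rightarrow> int"
  shows "factorization G {comb (\<alpha> i j) (\<alpha> i j) i j | i j. i \<in> {0..<2::int} \<and> j \<in> {0..<2::int}}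
    {comb i j 0 0 | i j. i \<in> {0..<int p} \<and> j \<in> {0..<2::int}}" (is "factorization G ?S ?C")
proof (rule factorization_combI[OF card_family2 card_family2])
  fix x y z u :: int
  define i where "i = z mod 2"
  define j where "j = u mod 2"
  define i' where "i' = (x - \<alpha> i j) mod int p"
  define j' where "j' = (y - \<alpha> i j) mod 2"
  have eq: "comb (\<alpha> i j) (\<alpha> i j) i j \<otimes> comb i' j' 0 0 = comb x y z u"
    by (rule comb_mult_eq) (simp_all add: i_def j_def i'_def j'_def cong_def mod_simps)
  have idx: "i \<in> {0..<2}" "j \<in> {0..<2}" "i' \<in> {0..<int p}" "j' \<in> {0..<2}"
    using p_gt_1 by (simp_all add: i_def j_def i'_def j'_def)
  have "comb (\<alpha> i j) (\<alpha> i j) i j \<in> ?S" "comb i' j' 0 0 \<in> ?C"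
    using idx by blast+
  with eq show "\<exists>s\<in>?S. \<exists>t\<in>?C. s \<otimes> t = comb x y z u" by blast
qed auto

lemma factorization_7:
  fixes \<alpha> :: "int \<Rightarrow> int \<Rightarrow> int" and \<kappa> :: "int \<Rightarrow> int"
  shows "factorization G {comb i k (\<alpha> i j) j | i j k. i \<in> {0..<int p} \<and> j \<in> {0..<2::int} \<and> k \<in> {0..<2::int}}
    {comb 0 (\<kappa> i) i 0 | i. i \<in> {0..<2::int}}" (is "factorization G ?S ?C")
proof (rule factorization_combI[OF card_family3 card_family1])
  fix x y z u :: int
  define i where "i = x mod int p"
  define j where "j = u mod 2"
  define i' where "i' = (z - \<alpha> i j) mod 2"
  define k where "k = (y - \<kappa> i') mod 2"
  have eq: "comb i k (\<alpha> i j) j \<otimes> comb 0 (\<kappa> i') i' 0 = comb x y z u"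
    by (rule comb_mult_eq) (simp_all add: i_def j_def i'_def k_def cong_def mod_simps)
  have idx: "i \<in> {0..<int p}" "j \<in> {0..<2}" "i' \<in> {0..<2}" "k \<in> {0..<2}"
    using p_gt_1 by (simp_all add: i_def j_def i'_def k_def)
  have "comb i k (\<alpha> i j) j \<in> ?S" "comb 0 (\<kappa> i') i' 0 \<in> ?C"
    using idx by blast+
  with eq show "\<exists>s\<in>?S. \<exists>t\<in>?C. s \<otimes> t = comb x y z u" by blast
qed auto

lemma factorization_8:
  fixes \<alpha> :: "int \<Rightarrow> int \<Rightarrow> int" and \<kappa> :: "int \<Rightarrow> int"
  shows "factorization G {comb k (\<alpha> i j) i j | i j k. i \<in> {0..<2::int} \<and> j \<in> {0..<2::int} \<and> k \<in> {0..<int p}}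
    {comb (\<kappa> i) i 0 0 | i. i \<in> {0..<2::int}}" (is "factorization G ?S ?C")
proof (rule factorization_combI[OF card_family3 card_family1])
  fix x y z u :: int
  define i where "i = z mod 2"
  define j where "j = u mod 2"
  define i' where "i' = (y - \<alpha> i j) mod 2"
  define k where "k = (x - \<kappa> i') mod int p"
  have eq: "comb k (\<alpha> i j) i j \<otimes> comb (\<kappa> i') i' 0 0 = comb x y z u"
    by (rule comb_mult_eq) (simp_all add: i_def j_def i'_def k_def cong_def mod_simps)
  have idx: "i \<in> {0..<2}" "j \<in> {0..<2}" "i' \<in> {0..<2}" "k \<in> {0..<int p}"
    using p_gt_1 by (simp_all add: i_def j_def i'_def k_def)
  have "comb k (\<alpha> i j) i j \<in> ?S" "comb (\<kappa> i') i' 0 0 \<in> ?C"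
    using idx by blast+
  with eq show "\<exists>s\<in>?S. \<exists>t\<in>?C. s \<otimes> t = comb x y z u" by blast
qed auto

lemma factorization_9:
  fixes \<alpha> :: "int \<Rightarrow> int" and \<kappa> :: "int \<Rightarrow> int" and \<mu> :: "int \<Rightarrow> int"
  shows "factorization G {comb i j k (\<alpha> i) | i j k. i \<in> {0..<int p} \<and> j \<in> {0..<2::int} \<and> k \<in> {0..<2::int}}
    {comb 0 (\<kappa> i) (\<mu> i) i | i. i \<in> {0..<2::int}}" (is "factorization G ?S ?C")
proof (rule factorization_combI[OF card_family3 card_family1])
  fix x y z u :: int
  define i where "i = x mod int p"
  define i' where "i' = (u - \<alpha> i) mod 2"
  define j where "j = (y - \<kappa> i') mod 2"
  define k where "k = (z - \<mu> i') mod 2"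
  have eq: "comb i j k (\<alpha> i) \<otimes> comb 0 (\<kappa> i') (\<mu> i') i' = comb x y z u"
    by (rule comb_mult_eq) (simp_all add: i_def i'_def j_def k_def cong_def mod_simps)
  have idx: "i \<in> {0..<int p}" "i' \<in> {0..<2}" "j \<in> {0..<2}" "k \<in> {0..<2}"
    using p_gt_1 by (simp_all add: i_def i'_def j_def k_def)
  have "comb i j k (\<alpha> i) \<in> ?S" "comb 0 (\<kappa> i') (\<mu> i') i' \<in> ?C"
    using idx by blast+
  with eq show "\<exists>s\<in>?S. \<exists>t\<in>?C. s \<otimes> t = comb x y z u" by blast
qed auto

lemma factorization_10:
  fixes \<alpha> :: "int \<Rightarrow> int \<Rightarrow> int \<Rightarrow> int"
  shows "factorization G {comb i (\<alpha> i j k) j k | i j k. i \<in> {0..<int p} \<and> j \<in> {0..<2::int} \<and> k \<in> {0..<2::int}}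
    {comb 0 i 0 0 | i. i \<in> {0..<2::int}}" (is "factorization G ?S ?C")
proof (rule factorization_combI[OF card_family3 card_family1])
  fix x y z u :: int
  define i where "i = x mod int p"
  define j where "j = z mod 2"
  define k where "k = u mod 2"
  define i' where "i' = (y - \<alpha> i j k) mod 2"
  have eq: "comb i (\<alpha> i j k) j k \<otimes> comb 0 i' 0 0 = comb x y z u"
    by (rule comb_mult_eq) (simp_all add: i_def j_def k_def i'_def cong_def mod_simps)
  have idx: "i \<in> {0..<int p}" "j \<in> {0..<2}" "k \<in> {0..<2}" "i' \<in> {0..<2}"
    using p_gt_1 by (simp_all add: i_def j_def k_def i'_def)
  have "comb i (\<alpha> i j k) j k \<in> ?S" "comb 0 i' 0 0 \<in> ?C"
    using idx by blast+
  with eq show "\<exists>s\<in>?S. \<exists>t\<in>?C. s \<otimes> t = comb x y z u" by blast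
qed auto

lemma factorization_11:
  fixes \<alpha> :: "int \<Rightarrow> int \<Rightarrow> int" and \<kappa> :: "int \<Rightarrow> int"
  shows "factorization G {comb (\<alpha> i j) k i j | i j k. i \<in> {0..<2::int} \<and> j \<in> {0..<2::int} \<and> k \<in> {0..<2::int}}
    {comb i (\<kappa> i) 0 0 | i. i \<in> {0..<int p}}" (is "factorization G ?S ?C")
proof (rule factorization_combI[OF card_family3 card_family1])
  fix x y z u :: int
  define i where "i = z mod 2"
  define j where "j = u mod 2"
  define i' where "i' = (x - \<alpha> i j) mod int p"
  define k where "k = (y - \<kappa> i') mod 2"
  have eq: "comb (\<alpha> i j) k i j \<otimes> comb i' (\<kappa> i') 0 0 = comb x y z u"
    by (rule comb_mult_eq) (simp_all add: i_def j_def i'_def k_def cong_def mod_simps)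
  have idx: "i \<in> {0..<2}" "j \<in> {0..<2}" "i' \<in> {0..<int p}" "k \<in> {0..<2}"
    using p_gt_1 by (simp_all add: i_def j_def i'_def k_def)
  have "comb (\<alpha> i j) k i j \<in> ?S" "comb i' (\<kappa> i') 0 0 \<in> ?C"
    using idx by blast+
  with eq show "\<exists>s\<in>?S. \<exists>t\<in>?C. s \<otimes> t = comb x y z u" by blast
qed auto

lemma factorization_12:
  fixes \<alpha> :: "int \<Rightarrow> int" and \<kappa> :: "int \<Rightarrow> int" and \<mu> :: "int \<Rightarrow> int"
  shows "factorization G {comb (\<alpha> i) j k i | i j k. i \<in> {0..<2::int} \<and> j \<in> {0..<2::int} \<and> k \<in> {0..<2::int}}
    {comb i (\<kappa> i) (\<mu> i) 0 | i. i \<in> {0..<int p}}" (is "factorization G ?S ?C")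
proof (rule factorization_combI[OF card_family3 card_family1])
  fix x y z u :: int
  define i where "i = u mod 2"
  define i' where "i' = (x - \<alpha> i) mod int p"
  define j where "j = (y - \<kappa> i') mod 2"
  define k where "k = (z - \<mu> i') mod 2"
  have eq: "comb (\<alpha> i) j k i \<otimes> comb i' (\<kappa> i') (\<mu> i') 0 = comb x y z u"
    by (rule comb_mult_eq) (simp_all add: i_def i'_def j_def k_def cong_def mod_simps)
  have idx: "i \<in> {0..<2}" "i' \<in> {0..<int p}" "j \<in> {0..<2}" "k \<in> {0..<2}"
    using p_gt_1 by (simp_all add: i_def i'_def j_def k_def)
  have "comb (\<alpha> i) j k i \<in> ?S" "comb i' (\<kappa> i') (\<mu> i') 0 \<in> ?C"
    using idx by blast+
  with eq show "\<exists>s\<in>?S. \<exists>t\<in>?C. s \<otimes> t = comb x y z u" by blast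
qed auto

lemma factorization_13:
  fixes \<alpha> :: "int \<Rightarrow> int \<Rightarrow> int \<Rightarrow> int"
  shows "factorization G {comb (\<alpha> i j k) i j k | i j k. i \<in> {0..<2::int} \<and> j \<in> {0..<2::int} \<and> k \<in> {0..<2::int}}
    {comb i 0 0 0 | i. i \<in> {0..<int p}}" (is "factorization G ?S ?C")
proof (rule factorization_combI[OF card_family3 card_family1])
  fix x y z u :: int
  define i where "i = y mod 2"
  define j where "j = z mod 2"
  define k where "k = u mod 2"
  define i' where "i' = (x - \<alpha> i j k) mod int p"
  have eq: "comb (\<alpha> i j k) i j k \<otimes> comb i' 0 0 0 = comb x y z u"
    by (rule comb_mult_eq) (simp_all add: i_def j_def k_def i'_def cong_def mod_simps)
  have idx: "i \<in> {0..<2}" "j \<in> {0..<2}" "k \<in> {0..<2}" "i' \<in> {0..<int p}"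
    using p_gt_1 by (simp_all add: i_def j_def k_def i'_def)
  have "comb (\<alpha> i j k) i j k \<in> ?S" "comb i' 0 0 0 \<in> ?C"
    using idx by blast+
  with eq show "\<exists>s\<in>?S. \<exists>t\<in>?C. s \<otimes> t = comb x y z u" by blast
qed auto

end

section \<open>The thirteen families\<close>

context zp_times_z2_cubed_basis
begin

text \<open>
  The normalization of the parameters at index \<open>0\<close> puts the identity into both sets.
\<close>

definition standard_pair :: "'a set \<Rightarrow> 'a set \<Rightarrow> bool" where
  "standard_pair S C \<longleftrightarrow>
    (\<exists>(\<alpha> :: int \<Rightarrow> int) (\<beta> :: int \<Rightarrow> int) (\<gamma> :: int \<Rightarrow> int). \<alpha> 0 = 0 \<and> \<beta> 0 = 0 \<and> \<gamma> 0 = 0 \<and>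
       S = {comb i (\<alpha> i) (\<beta> i) (\<gamma> i) | i. i \<in> {0..<int p}} \<and>
       C = {comb 0 i j k | i j k. i \<in> {0..<2::int} \<and> j \<in> {0..<2::int} \<and> k \<in> {0..<2::int}}) \<or>
    (\<exists>(\<alpha> :: int \<Rightarrow> int) (\<beta> :: int \<Rightarrow> int) (\<kappa> :: int \<Rightarrow> int \<Rightarrow> int). \<alpha> 0 = 0 \<and> \<beta> 0 = 0 \<and> \<kappa> 0 0 = 0 \<and>
       S = {comb i j (\<alpha> i) (\<beta> i) | i j. i \<in> {0..<int p} \<and> j \<in> {0..<2::int}} \<and>
       C = {comb 0 (\<kappa> i j) i j | i j. i \<in> {0..<2::int} \<and> j \<in> {0..<2::int}}) \<or>
    (\<exists>(\<alpha> :: int \<Rightarrow> int \<Rightarrow> int) (\<alpha>' :: int \<Rightarrow> int) (\<kappa> :: int \<Rightarrow> int). \<alpha> 0 0 = 0 \<and> \<alpha>' 0 = 0 \<and> \<kappa> 0 = 0 \<and>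
       S = {comb i (\<alpha> i j) j (\<alpha>' i) | i j. i \<in> {0..<int p} \<and> j \<in> {0..<2::int}} \<and>
       C = {comb 0 j (\<kappa> i) i | i j. i \<in> {0..<2::int} \<and> j \<in> {0..<2::int}}) \<or>
    (\<exists>(\<alpha> :: int \<Rightarrow> int \<Rightarrow> int) (\<beta> :: int \<Rightarrow> int \<Rightarrow> int). \<alpha> 0 0 = 0 \<and> \<beta> 0 0 = 0 \<and>
       S = {comb i (\<alpha> i j) (\<beta> i j) j | i j. i \<in> {0..<int p} \<and> j \<in> {0..<2::int}} \<and>
       C = {comb 0 i j 0 | i j. i \<in> {0..<2::int} \<and> j \<in> {0..<2::int}}) \<or>
    (\<exists>(\<alpha>' :: int \<Rightarrow> int) (\<alpha> :: int \<Rightarrow> int \<Rightarrow> int) (\<kappa> :: int \<Rightarrow> int). \<alpha>' 0 = 0 \<and> \<alpha> 0 0 = 0 \<and> \<kappa> 0 = 0 \<and>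
       S = {comb (\<alpha>' i) (\<alpha> i j) j i | i j. i \<in> {0..<2::int} \<and> j \<in> {0..<2::int}} \<and>
       C = {comb i j (\<kappa> i) 0 | i j. i \<in> {0..<int p} \<and> j \<in> {0..<2::int}}) \<or>
    (\<exists>(\<alpha> :: int \<Rightarrow> int \<Rightarrow> int). \<alpha> 0 0 = 0 \<and>
       S = {comb (\<alpha> i j) (\<alpha> i j) i j | i j. i \<in> {0..<2::int} \<and> j \<in> {0..<2::int}} \<and>
       C = {comb i j 0 0 | i j. i \<in> {0..<int p} \<and> j \<in> {0..<2::int}}) \<or>
    (\<exists>(\<alpha> :: int \<Rightarrow> int \<Rightarrow> int) (\<kappa> :: int \<Rightarrow> int). \<alpha> 0 0 = 0 \<and> \<kappa> 0 = 0 \<and>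
       S = {comb i k (\<alpha> i j) j | i j k. i \<in> {0..<int p} \<and> j \<in> {0..<2::int} \<and> k \<in> {0..<2::int}} \<and>
       C = {comb 0 (\<kappa> i) i 0 | i. i \<in> {0..<2::int}}) \<or>
    (\<exists>(\<alpha> :: int \<Rightarrow> int \<Rightarrow> int) (\<kappa> :: int \<Rightarrow> int). \<alpha> 0 0 = 0 \<and> \<kappa> 0 = 0 \<and>
       S = {comb k (\<alpha> i j) i j | i j k. i \<in> {0..<2::int} \<and> j \<in> {0..<2::int} \<and> k \<in> {0..<int p}} \<and>
       C = {comb (\<kappa> i) i 0 0 | i. i \<in> {0..<2::int}}) \<or>
    (\<exists>(\<alpha> :: int \<Rightarrow> int) (\<kappa> :: int \<Rightarrow> int) (\<mu> :: int \<Rightarrow> int). \<alpha> 0 = 0 \<and> \<kappa> 0 = 0 \<and> \<mu> 0 = 0 \<and>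
       S = {comb i j k (\<alpha> i) | i j k. i \<in> {0..<int p} \<and> j \<in> {0..<2::int} \<and> k \<in> {0..<2::int}} \<and>
       C = {comb 0 (\<kappa> i) (\<mu> i) i | i. i \<in> {0..<2::int}}) \<or>
    (\<exists>(\<alpha> :: int \<Rightarrow> int \<Rightarrow> int \<Rightarrow> int). \<alpha> 0 0 0 = 0 \<and>
       S = {comb i (\<alpha> i j k) j k | i j k. i \<in> {0..<int p} \<and> j \<in> {0..<2::int} \<and> k \<in> {0..<2::int}} \<and>
       C = {comb 0 i 0 0 | i. i \<in> {0..<2::int}}) \<or>
    (\<exists>(\<alpha> :: int \<Rightarrow> int \<Rightarrow> int) (\<kappa> :: int \<Rightarrow> int). \<alpha> 0 0 = 0 \<and> \<kappa> 0 = 0 \<and>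
       S = {comb (\<alpha> i j) k i j | i j k. i \<in> {0..<2::int} \<and> j \<in> {0..<2::int} \<and> k \<in> {0..<2::int}} \<and>
       C = {comb i (\<kappa> i) 0 0 | i. i \<in> {0..<int p}}) \<or>
    (\<exists>(\<alpha> :: int \<Rightarrow> int) (\<kappa> :: int \<Rightarrow> int) (\<mu> :: int \<Rightarrow> int). \<alpha> 0 = 0 \<and> \<kappa> 0 = 0 \<and> \<mu> 0 = 0 \<and>
       S = {comb (\<alpha> i) j k i | i j k. i \<in> {0..<2::int} \<and> j \<in> {0..<2::int} \<and> k \<in> {0..<2::int}} \<and>
       C = {comb i (\<kappa> i) (\<mu> i) 0 | i. i \<in> {0..<int p}}) \<or>
    (\<exists>(\<alpha> :: int \<Rightarrow> int \<Rightarrow> int \<Rightarrow> int). \<alpha> 0 0 0 = 0 \<and>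
       S = {comb (\<alpha> i j k) i j k | i j k. i \<in> {0..<2::int} \<and> j \<in> {0..<2::int} \<and> k \<in> {0..<2::int}} \<and>
       C = {comb i 0 0 0 | i. i \<in> {0..<int p}})"

lemma standard_pair_factorization: "standard_pair S C \<Longrightarrow> factorization G S C"
  unfolding standard_pair_def
  by (elim disjE exE conjE; simp only: factorization_1 factorization_2 factorization_3 factorization_4
      factorization_5 factorization_6 factorization_7 factorization_8 factorization_9 factorization_10
      factorization_11 factorization_12 factorization_13)

text \<open>
  By maximality of factorizations it is enough to find parameters that put a family inside a given
  factorization.
\<close>

lemma standard_pair_1I:
  fixes \<alpha> :: "int \<Rightarrow> int" and \<beta> :: "int \<Rightarrow> int" and \<gamma> :: "int \<Rightarrow> int"
  assumes "factorization G S C"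
    and "\<alpha> 0 = 0" "\<beta> 0 = 0" "\<gamma> 0 = 0"
    and "{comb i (\<alpha> i) (\<beta> i) (\<gamma> i) | i. i \<in> {0..<int p}} \<subseteq> S"
    and "{comb 0 i j k | i j k. i \<in> {0..<2::int} \<and> j \<in> {0..<2::int} \<and> k \<in> {0..<2::int}} \<subseteq> C"
  shows "standard_pair S C"
proof -
  have "{comb i (\<alpha> i) (\<beta> i) (\<gamma> i) | i. i \<in> {0..<int p}} = S \<and>
    {comb 0 i j k | i j k. i \<in> {0..<2::int} \<and> j \<in> {0..<2::int} \<and> k \<in> {0..<2::int}} = C"
    using assms(1) factorization_1 assms(5,6) by (rule factorization_subset_eq)
  with assms(2-4) show ?thesis
    unfolding standard_pair_def
    by - (rule disjI1, rule exI[of _ \<alpha>], rule exI[of _ \<beta>], rule exI[of _ \<gamma>], simp only: simp_thms)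
qed

lemma standard_pair_2I:
  fixes \<alpha> :: "int \<Rightarrow> int" and \<beta> :: "int \<Rightarrow> int" and \<kappa> :: "int \<Rightarrow> int \<Rightarrow> int"
  assumes "factorization G S C"
    and "\<alpha> 0 = 0" "\<beta> 0 = 0" "\<kappa> 0 0 = 0"
    and "{comb i j (\<alpha> i) (\<beta> i) | i j. i \<in> {0..<int p} \<and> j \<in> {0..<2::int}} \<subseteq> S"
    and "{comb 0 (\<kappa> i j) i j | i j. i \<in> {0..<2::int} \<and> j \<in> {0..<2::int}} \<subseteq> C"
  shows "standard_pair S C"
proof -
  have "{comb i j (\<alpha> i) (\<beta> i) | i j. i \<in> {0..<int p} \<and> j \<in> {0..<2::int}} = S \<and>
    {comb 0 (\<kappa> i j) i j | i j. i \<in> {0..<2::int} \<and> j \<in> {0..<2::int}} = C"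
    using assms(1) factorization_2 assms(5,6) by (rule factorization_subset_eq)
  with assms(2-4) show ?thesis
    unfolding standard_pair_def
    by - (rule disjI2, rule disjI1, rule exI[of _ \<alpha>], rule exI[of _ \<beta>], rule exI[of _ \<kappa>], simp only: simp_thms)
qed

lemma standard_pair_4I:
  fixes \<alpha> :: "int \<Rightarrow> int \<Rightarrow> int" and \<beta> :: "int \<Rightarrow> int \<Rightarrow> int"
  assumes "factorization G S C"
    and "\<alpha> 0 0 = 0" "\<beta> 0 0 = 0"
    and "{comb i (\<alpha> i j) (\<beta> i j) j | i j. i \<in> {0..<int p} \<and> j \<in> {0..<2::int}} \<subseteq> S"
    and "{comb 0 i j 0 | i j. i \<in> {0..<2::int} \<and> j \<in> {0..<2::int}} \<subseteq> C"
  shows "standard_pair S C"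
proof -
  have "{comb i (\<alpha> i j) (\<beta> i j) j | i j. i \<in> {0..<int p} \<and> j \<in> {0..<2::int}} = S \<and>
    {comb 0 i j 0 | i j. i \<in> {0..<2::int} \<and> j \<in> {0..<2::int}} = C"
    using assms(1) factorization_4 assms(4,5) by (rule factorization_subset_eq)
  with assms(2-3) show ?thesis
    unfolding standard_pair_def
    by - (rule disjI2, rule disjI2, rule disjI2, rule disjI1, rule exI[of _ \<alpha>], rule exI[of _ \<beta>], simp only: simp_thms)
qed

lemma standard_pair_5I:
  fixes \<alpha>' :: "int \<Rightarrow> int" and \<alpha> :: "int \<Rightarrow> int \<Rightarrow> int" and \<kappa> :: "int \<Rightarrow> int"
  assumes "factorization G S C"
    and "\<alpha>' 0 = 0" "\<alpha> 0 0 = 0" "\<kappa> 0 = 0"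
    and "{comb (\<alpha>' i) (\<alpha> i j) j i | i j. i \<in> {0..<2::int} \<and> j \<in> {0..<2::int}} \<subseteq> S"
    and "{comb i j (\<kappa> i) 0 | i j. i \<in> {0..<int p} \<and> j \<in> {0..<2::int}} \<subseteq> C"
  shows "standard_pair S C"
proof -
  have "{comb (\<alpha>' i) (\<alpha> i j) j i | i j. i \<in> {0..<2::int} \<and> j \<in> {0..<2::int}} = S \<and>
    {comb i j (\<kappa> i) 0 | i j. i \<in> {0..<int p} \<and> j \<in> {0..<2::int}} = C"
    using assms(1) factorization_5 assms(5,6) by (rule factorization_subset_eq)
  with assms(2-4) show ?thesis
    unfolding standard_pair_def
    by - (rule disjI2, rule disjI2, rule disjI2, rule disjI2, rule disjI1, rule exI[of _ \<alpha>'], rule exI[of _ \<alpha>], rule exI[of _ \<kappa>], simp only: simp_thms)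
qed

lemma standard_pair_6I:
  fixes \<alpha> :: "int \<Rightarrow> int \<Rightarrow> int"
  assumes "factorization G S C"
    and "\<alpha> 0 0 = 0"
    and "{comb (\<alpha> i j) (\<alpha> i j) i j | i j. i \<in> {0..<2::int} \<and> j \<in> {0..<2::int}} \<subseteq> S"
    and "{comb i j 0 0 | i j. i \<in> {0..<int p} \<and> j \<in> {0..<2::int}} \<subseteq> C"
  shows "standard_pair S C"
proof -
  have "{comb (\<alpha> i j) (\<alpha> i j) i j | i j. i \<in> {0..<2::int} \<and> j \<in> {0..<2::int}} = S \<and>
    {comb i j 0 0 | i j. i \<in> {0..<int p} \<and> j \<in> {0..<2::int}} = C"
    using assms(1) factorization_6 assms(3,4) by (rule factorization_subset_eq)
  with assms(2) show ?thesis
    unfolding standard_pair_def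
    by - (rule disjI2, rule disjI2, rule disjI2, rule disjI2, rule disjI2, rule disjI1, rule exI[of _ \<alpha>], simp only: simp_thms)
qed

lemma standard_pair_8I:
  fixes \<alpha> :: "int \<Rightarrow> int \<Rightarrow> int" and \<kappa> :: "int \<Rightarrow> int"
  assumes "factorization G S C"
    and "\<alpha> 0 0 = 0" "\<kappa> 0 = 0"
    and "{comb k (\<alpha> i j) i j | i j k. i \<in> {0..<2::int} \<and> j \<in> {0..<2::int} \<and> k \<in> {0..<int p}} \<subseteq> S"
    and "{comb (\<kappa> i) i 0 0 | i. i \<in> {0..<2::int}} \<subseteq> C"
  shows "standard_pair S C"
proof -
  have "{comb k (\<alpha> i j) i j | i j k. i \<in> {0..<2::int} \<and> j \<in> {0..<2::int} \<and> k \<in> {0..<int p}} = S \<and>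
    {comb (\<kappa> i) i 0 0 | i. i \<in> {0..<2::int}} = C"
    using assms(1) factorization_8 assms(4,5) by (rule factorization_subset_eq)
  with assms(2-3) show ?thesis
    unfolding standard_pair_def
    by - (rule disjI2, rule disjI2, rule disjI2, rule disjI2, rule disjI2, rule disjI2, rule disjI2, rule disjI1, rule exI[of _ \<alpha>], rule exI[of _ \<kappa>], simp only: simp_thms)
qed

lemma standard_pair_10I:
  fixes \<alpha> :: "int \<Rightarrow> int \<Rightarrow> int \<Rightarrow> int"
  assumes "factorization G S C"
    and "\<alpha> 0 0 0 = 0"
    and "{comb i (\<alpha> i j k) j k | i j k. i \<in> {0..<int p} \<and> j \<in> {0..<2::int} \<and> k \<in> {0..<2::int}} \<subseteq> S"
    and "{comb 0 i 0 0 | i. i \<in> {0..<2::int}} \<subseteq> C"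
  shows "standard_pair S C"
proof -
  have "{comb i (\<alpha> i j k) j k | i j k. i \<in> {0..<int p} \<and> j \<in> {0..<2::int} \<and> k \<in> {0..<2::int}} = S \<and>
    {comb 0 i 0 0 | i. i \<in> {0..<2::int}} = C"
    using assms(1) factorization_10 assms(3,4) by (rule factorization_subset_eq)
  with assms(2) show ?thesis
    unfolding standard_pair_def
    by - (rule disjI2, rule disjI2, rule disjI2, rule disjI2, rule disjI2, rule disjI2, rule disjI2, rule disjI2, rule disjI2, rule disjI1, rule exI[of _ \<alpha>], simp only: simp_thms)
qed

lemma standard_pair_11I:
  fixes \<alpha> :: "int \<Rightarrow> int \<Rightarrow> int" and \<kappa> :: "int \<Rightarrow> int"
  assumes "factorization G S C"
    and "\<alpha> 0 0 = 0" "\<kappa> 0 = 0"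
    and "{comb (\<alpha> i j) k i j | i j k. i \<in> {0..<2::int} \<and> j \<in> {0..<2::int} \<and> k \<in> {0..<2::int}} \<subseteq> S"
    and "{comb i (\<kappa> i) 0 0 | i. i \<in> {0..<int p}} \<subseteq> C"
  shows "standard_pair S C"
proof -
  have "{comb (\<alpha> i j) k i j | i j k. i \<in> {0..<2::int} \<and> j \<in> {0..<2::int} \<and> k \<in> {0..<2::int}} = S \<and>
    {comb i (\<kappa> i) 0 0 | i. i \<in> {0..<int p}} = C"
    using assms(1) factorization_11 assms(4,5) by (rule factorization_subset_eq)
  with assms(2-3) show ?thesis
    unfolding standard_pair_def
    by - (rule disjI2, rule disjI2, rule disjI2, rule disjI2, rule disjI2, rule disjI2, rule disjI2, rule disjI2, rule disjI2, rule disjI2, rule disjI1, rule exI[of _ \<alpha>], rule exI[of _ \<kappa>], simp only: simp_thms)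
qed

lemma standard_pair_12I:
  fixes \<alpha> :: "int \<Rightarrow> int" and \<kappa> :: "int \<Rightarrow> int" and \<mu> :: "int \<Rightarrow> int"
  assumes "factorization G S C"
    and "\<alpha> 0 = 0" "\<kappa> 0 = 0" "\<mu> 0 = 0"
    and "{comb (\<alpha> i) j k i | i j k. i \<in> {0..<2::int} \<and> j \<in> {0..<2::int} \<and> k \<in> {0..<2::int}} \<subseteq> S"
    and "{comb i (\<kappa> i) (\<mu> i) 0 | i. i \<in> {0..<int p}} \<subseteq> C"
  shows "standard_pair S C"
proof -
  have "{comb (\<alpha> i) j k i | i j k. i \<in> {0..<2::int} \<and> j \<in> {0..<2::int} \<and> k \<in> {0..<2::int}} = S \<and>
    {comb i (\<kappa> i) (\<mu> i) 0 | i. i \<in> {0..<int p}} = C"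
    using assms(1) factorization_12 assms(5,6) by (rule factorization_subset_eq)
  with assms(2-4) show ?thesis
    unfolding standard_pair_def
    by - (rule disjI2, rule disjI2, rule disjI2, rule disjI2, rule disjI2, rule disjI2, rule disjI2, rule disjI2, rule disjI2, rule disjI2, rule disjI2, rule disjI1, rule exI[of _ \<alpha>], rule exI[of _ \<kappa>], rule exI[of _ \<mu>], simp only: simp_thms)
qed

lemma standard_pair_13I:
  fixes \<alpha> :: "int \<Rightarrow> int \<Rightarrow> int \<Rightarrow> int"
  assumes "factorization G S C"
    and "\<alpha> 0 0 0 = 0"
    and "{comb (\<alpha> i j k) i j k | i j k. i \<in> {0..<2::int} \<and> j \<in> {0..<2::int} \<and> k \<in> {0..<2::int}} \<subseteq> S"
    and "{comb i 0 0 0 | i. i \<in> {0..<int p}} \<subseteq> C"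
  shows "standard_pair S C"
proof -
  have "{comb (\<alpha> i j k) i j k | i j k. i \<in> {0..<2::int} \<and> j \<in> {0..<2::int} \<and> k \<in> {0..<2::int}} = S \<and>
    {comb i 0 0 0 | i. i \<in> {0..<int p}} = C"
    using assms(1) factorization_13 assms(3,4) by (rule factorization_subset_eq)
  with assms(2) show ?thesis
    unfolding standard_pair_def
    by - (rule disjI2, rule disjI2, rule disjI2, rule disjI2, rule disjI2, rule disjI2, rule disjI2, rule disjI2, rule disjI2, rule disjI2, rule disjI2, rule disjI2, rule exI[of _ \<alpha>], simp only: simp_thms)
qed

end

section \<open>Choosing parameters\<close>

text \<open>
  A choice function may be prescribed at one index. This meets the requirement that parameters vanish at \<open>0\<close>.
\<close>

lemma choice_based:
  assumes "P z y" "\<forall>x\<in>X. \<exists>y. P x y"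
  shows "\<exists>f. f z = y \<and> (\<forall>x\<in>X. P x (f x))"
proof -
  obtain g where "\<forall>x\<in>X. P x (g x)" using assms(2) by (rule bchoice[THEN exE])
  then have "(g(z := y)) z = y \<and> (\<forall>x\<in>X. P x ((g(z := y)) x))" using assms(1) by simp
  then show ?thesis by (rule exI[of _ "g(z := y)"])
qed

lemma choice_based2:
  assumes "P z z' y" "\<forall>i\<in>I. \<forall>j\<in>J. \<exists>y. P i j y"
  shows "\<exists>f. f z z' = y \<and> (\<forall>i\<in>I. \<forall>j\<in>J. P i j (f i j))"
proof -
  obtain f where "f (z, z') = y" "\<forall>x\<in>I \<times> J. P (fst x) (snd x) (f x)"
    using choice_based[of "\<lambda>x. P (fst x) (snd x)" "(z, z')" y "I \<times> J"] assms by auto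
  then show ?thesis by (intro exI[of _ "\<lambda>i j. f (i, j)"]) auto
qed

lemma choice_based3:
  assumes "P z z' z'' y" "\<forall>i\<in>I. \<forall>j\<in>J. \<forall>k\<in>K. \<exists>y. P i j k y"
  shows "\<exists>f. f z z' z'' = y \<and> (\<forall>i\<in>I. \<forall>j\<in>J. \<forall>k\<in>K. P i j k (f i j k))"
proof -
  obtain f where "f (z, z') z'' = y" "\<forall>x\<in>I \<times> J. \<forall>k\<in>K. P (fst x) (snd x) k (f x k)"
    using choice_based2[of "\<lambda>x. P (fst x) (snd x)" "(z, z')" z'' y "I \<times> J" K] assms by auto
  then show ?thesis by (intro exI[of _ "\<lambda>i j. f (i, j)"]) auto
qed

section \<open>Subgroups of the elementary part\<close>

context zp_times_z2_cubed
begin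

lemma V_inv: "v \<in> V \<Longrightarrow> inv v = v"
  using V_square V_closed by (intro inv_equality)

lemma V_subgroupI:
  assumes "H \<subseteq> V" "\<one> \<in> H" "\<And>x y. x \<in> H \<Longrightarrow> y \<in> H \<Longrightarrow> x \<otimes> y \<in> H"
  shows "subgroup H G"
proof
  fix x assume "x \<in> H"
  then show "inv x \<in> H" using V_inv[of x] assms(1) by auto
qed (use assms V_closed in auto)

lemma V_cancel: "v \<in> V \<Longrightarrow> x \<in> carrier G \<Longrightarrow> x \<otimes> v \<otimes> v = x"
  using V_square V_closed by (simp add: m_assoc)

text \<open>
  Adjoining an element of order \<open>2\<close> doubles a subgroup. Three steps from the trivial group exhaust \<open>V\<close>,
  which yields both independence criteria and the existence of bases.
\<close>

lemma card_double_subgroup: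
  assumes H: "subgroup H G" "H \<subseteq> V" and z: "z \<in> V" "z \<notin> H"
  shows "subgroup (H \<union> (\<lambda>h. h \<otimes> z) ` H) G" and "H \<union> (\<lambda>h. h \<otimes> z) ` H \<subseteq> V"
    and "card (H \<union> (\<lambda>h. h \<otimes> z) ` H) = 2 * card H"
proof -
  let ?Hz = "(\<lambda>h. h \<otimes> z) ` H"
  have zc: "z \<in> carrier G" using z by (simp add: V_closed)
  have Hc: "h \<in> carrier G" if "h \<in> H" for h using that H by (auto intro: V_closed)
  show sub: "H \<union> ?Hz \<subseteq> V" using H z by (auto intro: V_mult)
  show "subgroup (H \<union> ?Hz) G"
  proof (rule V_subgroupI[OF sub])
    fix x y assume x: "x \<in> H \<union> ?Hz" and y: "y \<in> H \<union> ?Hz"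
    have mul: "h \<otimes> h' \<in> H" if "h \<in> H" "h' \<in> H" for h h' using that H(1) by (simp add: subgroup.m_closed)
    have 1: "h \<otimes> z \<otimes> h' = h \<otimes> h' \<otimes> z" if "h \<in> H" "h' \<in> H" for h h'
      using that Hc zc by (simp add: m_ac)
    have 2: "h \<otimes> z \<otimes> (h' \<otimes> z) = h \<otimes> h'" if "h \<in> H" "h' \<in> H" for h h'
    proof -
      have "h \<otimes> z \<otimes> (h' \<otimes> z) = h \<otimes> h' \<otimes> z \<otimes> z" using that Hc zc by (simp add: m_ac)
      then show ?thesis using that Hc z by (simp add: V_cancel)
    qed
    consider "x \<in> H" "y \<in> H" | "x \<in> H" "y \<in> ?Hz" | "x \<in> ?Hz" "y \<in> H" | "x \<in> ?Hz" "y \<in> ?Hz"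
      using x y by blast
    then show "x \<otimes> y \<in> H \<union> ?Hz"
    proof cases
      case 1
      then show ?thesis by (simp add: mul)
    next
      case 2
      then obtain h where "h \<in> H" "y = h \<otimes> z" by blast
      then have "x \<otimes> y = x \<otimes> h \<otimes> z" using 2 Hc zc by (simp add: m_assoc)
      then show ?thesis using 2 \<open>h \<in> H\<close> mul by blast
    next
      case 3
      then obtain h where "h \<in> H" "x = h \<otimes> z" by blast
      then show ?thesis using 3 mul 1 by auto
    next
      case 4
      then obtain h h' where "h \<in> H" "x = h \<otimes> z" "h' \<in> H" "y = h' \<otimes> z" by blast
      then show ?thesis using mul 2 by auto
    qed
  qed (use H subgroup.one_closed in auto)
  have "H \<inter> ?Hz = {}"
  proof -
    have "h' \<noteq> h \<otimes> z" if "h \<in> H" "h' \<in> H" for h h'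
    proof
      assume "h' = h \<otimes> z"
      then have "h \<otimes> h' = z" using that H Hc zc V_square[of h] by (auto simp flip: m_assoc)
      then show False using z subgroup.m_closed[OF H(1) that] by simp
    qed
    then show ?thesis by blast
  qed
  moreover have "inj_on (\<lambda>h. h \<otimes> z) H" using Hc zc by (intro inj_onI) simp
  moreover have "finite H" using H V_finite finite_subset by auto
  ultimately show "card (H \<union> ?Hz) = 2 * card H"
    by (simp add: card_Un_disjoint card_image)
qed

lemma subgroup_pair:
  assumes "x \<in> V" "x \<noteq> \<one>" shows "subgroup {\<one>, x} G" "card {\<one>, x} = 2"
  using assms V_square V_closed V_one by (auto intro!: V_subgroupI)

lemma subgroup_four:
  assumes "x \<in> V" "x \<noteq> \<one>" "y \<in> V" "y \<notin> {\<one>, x}"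
  shows "subgroup {\<one>, x, y, x \<otimes> y} G" "{\<one>, x, y, x \<otimes> y} \<subseteq> V" "card {\<one>, x, y, x \<otimes> y} = 4"
proof -
  have "{\<one>, x} \<union> (\<lambda>h. h \<otimes> y) ` {\<one>, x} = {\<one>, x, y, x \<otimes> y}"
    using assms V_closed by auto
  moreover have "{\<one>, x} \<subseteq> V" using assms V_one by simp
  ultimately show "subgroup {\<one>, x, y, x \<otimes> y} G" "{\<one>, x, y, x \<otimes> y} \<subseteq> V" "card {\<one>, x, y, x \<otimes> y} = 4"
    using card_double_subgroup[OF subgroup_pair(1)[OF assms(1,2)] _ assms(3,4)]
      subgroup_pair(2)[OF assms(1,2)] by simp_all
qed

lemma subgroup_full:
  assumes "x \<in> V" "x \<noteq> \<one>" "y \<in> V" "y \<notin> {\<one>, x}" "z \<in> V" "z \<notin> {\<one>, x, y, x \<otimes> y}"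
    and H: "subgroup H G" "x \<in> H" "y \<in> H" "z \<in> H"
  shows "V \<subseteq> H"
proof -
  let ?W = "{\<one>, x, y, x \<otimes> y}"
  let ?U = "?W \<union> (\<lambda>h. h \<otimes> z) ` ?W"
  note W = subgroup_four[OF assms(1-4)]
  have "card ?U = 8" using card_double_subgroup(3)[OF W(1,2) assms(5,6)] W(3) by simp
  then have "?U = V"
    using card_double_subgroup(2)[OF W(1,2) assms(5,6)] V_finite V_card card_subset_eq by metis
  moreover have "?U \<subseteq> H" using H subgroup.m_closed[OF H(1)] subgroup.one_closed[OF H(1)] by auto
  ultimately show ?thesis by simp
qed

lemma generate_basis:
  assumes "x \<in> V" "x \<noteq> \<one>" "y \<in> V" "y \<notin> {\<one>, x}" "z \<in> V" "z \<notin> {\<one>, x, y, x \<otimes> y}"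
  shows "generate G {x, y, z} = V"
proof
  have c: "{x, y, z} \<subseteq> V" using assms by simp
  then show "generate G {x, y, z} \<subseteq> V" using V_subgroup by (rule generate_subgroup_incl)
  have "{x, y, z} \<subseteq> carrier G" using c V_closed by auto
  then have "subgroup (generate G {x, y, z}) G" by (rule generate_is_subgroup)
  then show "V \<subseteq> generate G {x, y, z}"
    by (rule subgroup_full[OF assms]) (auto intro: generate.incl)
qed

lemma V_outside: "finite X \<Longrightarrow> card X < 8 \<Longrightarrow> \<exists>v\<in>V. v \<notin> X"
  using V_card card_mono[of X V] by (metis not_le subsetI)

lemma V_outside_four: "\<exists>v\<in>V. v \<notin> {x, y, z, u}"
proof (rule V_outside)
  show "card {x, y, z, u} < 8" using card_length[of "[x, y, z, u]"] by simp
qed simp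

lemma basis_extend:
  assumes "x \<in> V" "x \<noteq> \<one>" obtains y z where "generate G {x, y, z} = V"
proof -
  obtain y where y: "y \<in> V" "y \<notin> {\<one>, x}" using V_outside_four[of \<one> x x x] by auto
  obtain z where z: "z \<in> V" "z \<notin> {\<one>, x, y, x \<otimes> y}" using V_outside_four by blast
  show ?thesis using generate_basis[OF assms y z] by (rule that)
qed

lemma basis_exists: obtains x y z where "generate G {x, y, z} = V"
proof -
  obtain x where "x \<in> V" "x \<noteq> \<one>" using V_outside_four[of \<one> \<one> \<one> \<one>] by auto
  then show ?thesis using that by (rule basis_extend)
qed

text \<open>
  The stabilizers below contain an element that is known beforehand. With this element as first member, a
  basis can be chosen along the stabilizer, as the families require.
\<close>

lemma proper_subgroup_basis:
  assumes K: "subgroup K G" "K \<subseteq> V" "K \<noteq> V" and x: "x \<in> K" "x \<noteq> \<one>"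
  obtains (two) y z where "generate G {x, y, z} = V" "K = {\<one>, x}"
    | (four) y z where "generate G {x, y, z} = V" "K = {\<one>, x, y, x \<otimes> y}"
proof (cases "K = {\<one>, x}")
  case True
  then show ?thesis using basis_extend[of x] x K two by blast
next
  case False
  have K1: "\<one> \<in> K" using K(1) by (rule subgroup.one_closed)
  then obtain y where y: "y \<in> K" "y \<notin> {\<one>, x}" using False x by auto
  let ?W = "{\<one>, x, y, x \<otimes> y}"
  have WK: "?W \<subseteq> K" using K1 x y subgroup.m_closed[OF K(1)] by simp
  have xyV: "x \<in> V" "y \<in> V" using x y K by auto
  have "K \<subseteq> ?W"
  proof
    fix z assume z: "z \<in> K"
    show "z \<in> ?W"
    proof (rule ccontr)
      assume "z \<notin> ?W"
      moreover have "z \<in> V" using z K by auto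
      ultimately have "V \<subseteq> K"
        using subgroup_full[OF xyV(1) x(2) xyV(2) y(2) _ _ K(1) x(1) y(1) z] by simp
      then show False using K by simp
    qed
  qed
  then have KW: "K = ?W" using WK by (rule equalityI)
  obtain z where "z \<in> V" "z \<notin> ?W" using V_outside_four by blast
  then have "generate G {x, y, z} = V" using generate_basis[OF xyV(1) x(2) xyV(2) y(2)] by simp
  then show ?thesis using KW by (rule four)
qed

section \<open>Projection onto the elementary part and stabilizers\<close>

text \<open>
  Since \<open>p\<close> is odd and \<open>e1\<close> has order dividing \<open>p\<close>, the \<open>p\<close>-th power is the identity on \<open>V\<close> and kills
  \<open>e1\<close>: it is the projection onto \<open>V\<close>.
\<close>

lemma pow_p_V: "v \<in> V \<Longrightarrow> v [^] p = v"
proof -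
  assume v: "v \<in> V"
  obtain k where k: "p = 2 * k + 1" using p_odd by (rule oddE)
  have "v [^] (2 * k) = (v [^] (2::nat)) [^] k" using v V_closed by (simp add: nat_pow_pow)
  also have "\<dots> = \<one>" using v V_closed V_square by (simp add: numeral_2_eq_2)
  finally show ?thesis using v V_closed unfolding k by simp
qed

lemma pow_p_mult: "x \<in> carrier G \<Longrightarrow> y \<in> carrier G \<Longrightarrow> (x \<otimes> y) [^] p = x [^] p \<otimes> y [^] p"
  by (rule nat_pow_distrib)

lemma pow_p_e1_V: "v \<in> V \<Longrightarrow> (e1 [^] (i::int) \<otimes> v) [^] p = v"
proof -
  assume v: "v \<in> V"
  have "(e1 [^] i) [^] p = (e1 [^] int p) [^] i"
    by (simp add: int_pow_pow mult.commute flip: int_pow_int)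
  also have "\<dots> = \<one>" by (simp add: int_pow_int e1_pow)
  finally show ?thesis using v V_closed by (simp add: pow_p_mult pow_p_V)
qed

lemma pow_p_in_V: "g \<in> carrier G \<Longrightarrow> g [^] p \<in> V"
  by (elim decompose) (simp add: pow_p_e1_V)

lemma e1_pow_p_split: assumes "g \<in> carrier G" obtains i :: int where "g = e1 [^] i \<otimes> g [^] p"
  using assms by (elim decompose) (metis pow_p_e1_V)

lemma power_projection:
  assumes "factorization G A B" "coprime (card B) p"
  shows "factorization G A ((\<lambda>b. b [^] p) ` B)" "inj_on (\<lambda>b. b [^] p) B"
  using factorization_power[OF factorization_commute[OF assms(1)] finite_G p_prime assms(2)]
    factorization_commute by auto

definition V_stabilizer :: "'a set \<Rightarrow> 'a set" where
  "V_stabilizer B = {v \<in> V. \<forall>b\<in>B. b \<otimes> v \<in> B}"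

lemma V_stabilizer_subgroup:
  assumes "B \<subseteq> carrier G" shows "subgroup (V_stabilizer B) G"
proof (rule V_subgroupI)
  fix x y assume "x \<in> V_stabilizer B" "y \<in> V_stabilizer B"
  then show "x \<otimes> y \<in> V_stabilizer B" using assms
    by (auto simp: V_stabilizer_def V_mult V_closed simp flip: m_assoc)
qed (use assms V_one in \<open>auto simp: V_stabilizer_def\<close>)

lemma V_stabilizerD: "v \<in> V_stabilizer B \<Longrightarrow> b \<in> B \<Longrightarrow> b \<otimes> v \<in> B"
  by (simp add: V_stabilizer_def)

lemma V_stabilizer_subset_V: "V_stabilizer B \<subseteq> V"
  by (auto simp: V_stabilizer_def)

lemma V_stabilizer_subset:
  assumes "\<one> \<in> B" shows "V_stabilizer B \<subseteq> B"
proof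
  fix v assume "v \<in> V_stabilizer B"
  then have "\<one> \<otimes> v \<in> B" "v \<in> V" using assms by (auto simp: V_stabilizer_def)
  then show "v \<in> B" by (simp add: V_closed)
qed

text \<open>
  The translates of \<open>B\<close> by the projections of the elements of \<open>A\<close> all agree, and \<open>V\<close> has exponent \<open>2\<close>, so
  the product of two such projections stabilizes \<open>B\<close>.
\<close>

lemma pow_p_mult_in_V_stabilizer:
  assumes fac: "factorization G A B" and A: "card A = p" and a: "a \<in> A" "a' \<in> A"
  shows "a [^] p \<otimes> a' [^] p \<in> V_stabilizer B"
proof -
  have c: "a \<in> carrier G" "a' \<in> carrier G" "B \<subseteq> carrier G"
    using fac a by (auto simp: factorization_def)
  have "b \<otimes> (a [^] p \<otimes> a' [^] p) \<in> B" if b: "b \<in> B" for b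
  proof -
    have "b \<otimes> a [^] p \<otimes> inv (a' [^] p) \<in> B"
      using factorization_prime_factor_translate[OF fac _ a b] A p_prime by simp
    then show ?thesis using b c V_inv[OF pow_p_in_V[OF c(2)]] by (auto simp: m_assoc)
  qed
  then show ?thesis using c by (simp add: V_stabilizer_def V_mult pow_p_in_V)
qed

lemma pow_p_in_V_stabilizer:
  assumes "factorization G A B" "card A = p" "\<one> \<in> A" "a \<in> A"
  shows "a [^] p \<in> V_stabilizer B"
proof -
  have "a \<in> carrier G" using assms by (auto simp: factorization_def)
  then show ?thesis using pow_p_mult_in_V_stabilizer[OF assms(1,2,4,3)] by simp
qed

text \<open>
  Write \<open>e1 [^] i = a \<otimes> b\<close> with \<open>b \<in> V\<close>: a factor whose partner lies in \<open>V\<close> meets every coset of \<open>V\<close>.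
\<close>

lemma factorization_V_transversal:
  assumes "factorization G A B" "B \<subseteq> V"
  obtains v where "v \<in> V" "e1 [^] (i::int) \<otimes> v \<in> A"
proof -
  have "e1 [^] i \<in> carrier G" by simp
  with assms(1) obtain a b where ab: "a \<in> A" "b \<in> B" "e1 [^] i = a \<otimes> b" by (rule factorizationE)
  have "a \<in> carrier G" "b \<in> V" using assms ab by (auto simp: factorization_def)
  then have "e1 [^] i \<otimes> b = a" unfolding ab(3) by (rule V_cancel[rotated])
  then show ?thesis using ab \<open>b \<in> V\<close> that by simp
qed

text \<open>
  The elements with projection in \<open>H\<close> form a subgroup that contains \<open>S\<close>, so the projection of a generating
  set generates \<open>V\<close>.
\<close>

lemma generating_pow_p:
  assumes gen: "generate G S = carrier G" and H: "subgroup H G" "H \<subseteq> V"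
    and S: "\<And>s. s \<in> S \<Longrightarrow> s [^] p \<in> H" "S \<subseteq> carrier G"
  shows "H = V"
proof
  let ?H = "{g \<in> carrier G. g [^] p \<in> H}"
  have "subgroup ?H G"
  proof
    fix x assume "x \<in> ?H"
    then have "x \<in> carrier G" "inv (x [^] p) \<in> H" using subgroup.m_inv_closed[OF H(1)] by auto
    then show "inv x \<in> ?H" by (simp add: nat_pow_inv)
  qed (use H subgroup.m_closed[OF H(1)] subgroup.one_closed[OF H(1)] in \<open>auto simp: pow_p_mult\<close>)
  then have "generate G S \<subseteq> ?H" using S by (intro generate_subgroup_incl) auto
  then have "V \<subseteq> ?H" using gen V_closed by auto
  then show "V \<subseteq> H" using pow_p_V by auto
qed (rule H(2))

lemma not_generating_in_V:
  assumes "generate G S = carrier G" shows "\<not> S \<subseteq> V"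
proof
  assume "S \<subseteq> V"
  then have "generate G S \<subseteq> V" using V_subgroup by (rule generate_subgroup_incl)
  then have "order G \<le> 8" unfolding order_def assms using V_finite V_card card_mono by metis
  then show False using p_gt_1 by (simp add: order_G)
qed

end

section \<open>Lifting from the elementary part\<close>

context zp_times_z2_cubed_basis
begin

lemma e1_mult_comb: "e1 [^] i \<otimes> comb 0 b c d = comb i b c d"
  by (simp add: comb_def m_assoc)

lemma comb_in_V: "comb 0 b c d \<in> V"
proof -
  have *: "x [^] (i::int) \<in> V" if "x \<in> V" for x i
    using subgroup_int_pow_closed[OF V_subgroup that] .
  show ?thesis using basis_in_V by (simp add: comb_def V_mult *)
qed

lemma pair_eq: "{\<one>, e2} = {comb 0 b 0 0 | b. b \<in> UNIV}"
proof
  have "e2 = comb 0 1 0 0" by (simp add: comb_def)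
  then show "{\<one>, e2} \<subseteq> {comb 0 b 0 0 | b. b \<in> UNIV}" using comb_0[symmetric] by blast
  have "comb 0 b 0 0 = comb 0 (b mod 2) 0 0" for b by (rule comb_cong) simp_all
  moreover have "b mod 2 = 0 \<or> b mod 2 = 1" for b :: int by presburger
  ultimately have "comb 0 b 0 0 = comb 0 0 0 0 \<or> comb 0 b 0 0 = comb 0 1 0 0" for b by metis
  then show "{comb 0 b 0 0 | b. b \<in> UNIV} \<subseteq> {\<one>, e2}" by (auto simp: comb_def)
qed

lemma four_eq: "{\<one>, e2, e3, e2 \<otimes> e3} = {comb 0 b c 0 | b c. True}"
proof
  have "e2 = comb 0 1 0 0" "e3 = comb 0 0 1 0" "e2 \<otimes> e3 = comb 0 1 1 0" by (simp_all add: comb_def)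
  then show "{\<one>, e2, e3, e2 \<otimes> e3} \<subseteq> {comb 0 b c 0 | b c. True}"
    using comb_0[symmetric] by blast
  have "comb 0 b c 0 \<in> {\<one>, e2, e3, e2 \<otimes> e3}" for b c
  proof -
    have "comb 0 b c 0 = comb 0 (b mod 2) (c mod 2) 0" by (rule comb_cong) simp_all
    moreover have "b mod 2 = 0 \<or> b mod 2 = 1" "c mod 2 = 0 \<or> c mod 2 = 1" by presburger+
    ultimately show ?thesis by (auto simp: comb_def)
  qed
  then show "{comb 0 b c 0 | b c. True} \<subseteq> {\<one>, e2, e3, e2 \<otimes> e3}" by auto
qed

end

context zp_times_z2_cubed
begin

definition standard_form :: "'a set \<Rightarrow> 'a set \<Rightarrow> bool" where
  "standard_form S C \<longleftrightarrow> (\<exists>e2 e3 e4. generate G {e2, e3, e4} = V \<and>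
     zp_times_z2_cubed_basis.standard_pair G p e1 e2 e3 e4 S C)"

text \<open>
  The projection is injective on a factor of size \<open>8\<close>, hence onto \<open>V\<close>.
\<close>

lemma pow_p_image_eq_V:
  assumes "factorization G A B" "card B = 8"
  shows "(\<lambda>b. b [^] p) ` B = V"
proof (rule card_subset_eq[OF V_finite])
  have "coprime (card B) p" using assms(2) p_odd coprime_power_left_iff[of 2 3 p] by simp
  then have "inj_on (\<lambda>b. b [^] p) B" by (rule power_projection(2)[OF assms(1)])
  then show "card ((\<lambda>b. b [^] p) ` B) = card V" using assms(2) V_card by (simp add: card_image)
  show "(\<lambda>b. b [^] p) ` B \<subseteq> V" using assms(1) pow_p_in_V by (auto simp: factorization_def)
qed

lemma factorization_V:
  assumes "factorization G A B" "card B = 8" shows "factorization G A V"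
proof -
  have "coprime (card B) p" using assms(2) p_odd coprime_power_left_iff[of 2 3 p] by simp
  then show ?thesis using power_projection(1)[OF assms(1)] pow_p_image_eq_V[OF assms] by simp
qed

lemma lift_V:
  assumes "factorization G A B" "card B = 8" "v \<in> V"
  obtains a :: int where "e1 [^] a \<otimes> v \<in> B"
proof -
  obtain b where b: "b \<in> B" "v = b [^] p" using pow_p_image_eq_V[OF assms(1,2)] assms(3) by blast
  then have "b \<in> carrier G" using assms(1) by (auto simp: factorization_def)
  then obtain a :: int where "b = e1 [^] a \<otimes> b [^] p" by (rule e1_pow_p_split)
  then have "e1 [^] a \<otimes> v \<in> B" using b by simp
  then show ?thesis by (rule that)
qed

section \<open>Factors of size eight\<close>

text \<open>
  The projection of \<open>S\<close> stabilizes \<open>C\<close> and generates \<open>V\<close>. Hence \<open>C\<close> is \<open>V\<close> and \<open>S\<close> is a transversal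
  of \<open>V\<close>: family 1.
\<close>

lemma standard_form_code_8:
  assumes fac: "factorization G S C" and gen: "generate G S = carrier G"
    and one: "\<one> \<in> S" "\<one> \<in> C" and card: "card S = p" "card C = 8"
  shows "standard_form S C"
proof -
  have sub: "S \<subseteq> carrier G" "C \<subseteq> carrier G" using fac by (auto simp: factorization_def)
  have "V_stabilizer C = V"
    using gen V_stabilizer_subgroup[OF sub(2)] V_stabilizer_subset_V
      pow_p_in_V_stabilizer[OF fac card(1) one(1)] sub(1) by (rule generating_pow_p)
  then have "V \<subseteq> C" using V_stabilizer_subset[OF one(2)] by simp
  then have CV: "V = C" using card(2) V_card by (intro card_subset_eq card_ge_0_finite) simp_all
  obtain e2 e3 e4 where b: "generate G {e2, e3, e4} = V" by (rule basis_exists)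
  interpret B: zp_times_z2_cubed_basis G p e1 V e2 e3 e4 by unfold_locales (rule b)
  have S: "\<exists>b c d. B.comb i b c d \<in> S" for i
  proof -
    obtain v where "v \<in> V" "e1 [^] i \<otimes> v \<in> S"
      using factorization_V_transversal[OF fac] CV by auto
    then show ?thesis by (elim B.V_comb) (auto simp: B.e1_mult_comb)
  qed
  have z: "B.comb 0 0 0 0 \<in> S" using one B.comb_0 by simp
  obtain \<alpha> where \<alpha>: "\<alpha> 0 = 0" "\<forall>i\<in>UNIV. \<exists>c d. B.comb i (\<alpha> i) c d \<in> S"
    using choice_based[of "\<lambda>i b. \<exists>c d. B.comb i b c d \<in> S" 0 0 UNIV] S z by blast
  obtain \<beta> where \<beta>: "\<beta> 0 = 0" "\<forall>i\<in>UNIV. \<exists>d. B.comb i (\<alpha> i) (\<beta> i) d \<in> S"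
    using choice_based[of "\<lambda>i c. \<exists>d. B.comb i (\<alpha> i) c d \<in> S" 0 0 UNIV] \<alpha> z by auto
  obtain \<gamma> where \<gamma>: "\<gamma> 0 = 0" "\<forall>i\<in>UNIV. B.comb i (\<alpha> i) (\<beta> i) (\<gamma> i) \<in> S"
    using choice_based[of "\<lambda>i d. B.comb i (\<alpha> i) (\<beta> i) d \<in> S" 0 0 UNIV] \<alpha> \<beta> z by auto
  have "B.standard_pair S C"
    by (rule B.standard_pair_1I[where \<alpha> = \<alpha> and \<beta> = \<beta> and \<gamma> = \<gamma>, OF fac \<alpha>(1) \<beta>(1) \<gamma>(1)])
      (use \<gamma> B.comb_in_V CV in auto)
  then show ?thesis using b unfolding standard_form_def by blast
qed

text \<open>
  The projection of \<open>C\<close> lies in the stabilizer \<open>K\<close> of \<open>S\<close> in \<open>V\<close>. Were \<open>K\<close> all of \<open>V\<close>, then \<open>S\<close> would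
  equal \<open>V\<close> and not generate. The orders \<open>1\<close>, \<open>2\<close>, \<open>4\<close> of \<open>K\<close> give families 13, 11, 12.
\<close>

lemma standard_form_connection_8:
  assumes fac: "factorization G S C" and gen: "generate G S = carrier G"
    and one: "\<one> \<in> S" "\<one> \<in> C" and card: "card S = 8" "card C = p"
  shows "standard_form S C"
proof -
  note fac' = factorization_commute[OF fac]
  have sub: "S \<subseteq> carrier G" "C \<subseteq> carrier G" using fac by (auto simp: factorization_def)
  let ?K = "V_stabilizer S"
  have KV: "?K \<noteq> V"
  proof
    assume "?K = V"
    then have "V \<subseteq> S" using V_stabilizer_subset[OF one(1)] by simp
    then have "V = S" using card(1) V_card by (intro card_subset_eq card_ge_0_finite) simp_all
    then show False using not_generating_in_V[OF gen] by simp
  qed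
  have C: "\<exists>v\<in>?K. e1 [^] i \<otimes> v \<in> C" for i :: int
  proof -
    obtain v where v: "v \<in> V" "e1 [^] i \<otimes> v \<in> C"
      using factorization_V_transversal[OF factorization_V[OF fac' card(1)]] by auto
    then show ?thesis
      using pow_p_in_V_stabilizer[OF fac' card(2) one(2) v(2)] pow_p_e1_V[OF v(1)] by auto
  qed
  have S: "\<exists>a::int. \<forall>k\<in>?K. e1 [^] a \<otimes> (v \<otimes> k) \<in> S" if v: "v \<in> V" for v
  proof -
    obtain a :: int where a: "e1 [^] a \<otimes> v \<in> S" using lift_V[OF fac' card(1) v] .
    have "e1 [^] a \<otimes> (v \<otimes> k) \<in> S" if k: "k \<in> ?K" for k
    proof -
      have "k \<in> carrier G" "v \<in> carrier G" using k v V_stabilizer_subset_V V_closed by auto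
      then show ?thesis using V_stabilizerD[OF k a] by (simp add: m_assoc)
    qed
    then show ?thesis by auto
  qed
  show ?thesis
  proof (cases "?K = {\<one>}")
    case True
    obtain e2 e3 e4 where b: "generate G {e2, e3, e4} = V" by (rule basis_exists)
    interpret B: zp_times_z2_cubed_basis G p e1 V e2 e3 e4 by unfold_locales (rule b)
    have C1: "B.comb i 0 0 0 \<in> C" for i using C[of i] True by (simp add: B.comb_def)
    have S1: "\<exists>a. B.comb a i j k \<in> S" for i j k
      using S[OF B.comb_in_V[of i j k]] True by (auto simp: B.e1_mult_comb)
    obtain \<alpha> where \<alpha>: "\<alpha> 0 0 0 = 0"
        "\<forall>i\<in>UNIV. \<forall>j\<in>UNIV. \<forall>k\<in>UNIV. B.comb (\<alpha> i j k) i j k \<in> S"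
      using choice_based3[of "\<lambda>i j k a. B.comb a i j k \<in> S" 0 0 0 0 UNIV UNIV UNIV] S1 one B.comb_0
      by auto
    have "B.standard_pair S C"
      by (rule B.standard_pair_13I[where \<alpha> = \<alpha>, OF fac \<alpha>(1)]) (use \<alpha> C1 in auto)
    then show ?thesis using b unfolding standard_form_def by blast
  next
    case False
    have K: "subgroup ?K G" using V_stabilizer_subgroup[OF sub(1)] .
    then obtain x where x: "x \<in> ?K" "x \<noteq> \<one>" using False subgroup.one_closed[OF K] by auto
    from K V_stabilizer_subset_V KV x show ?thesis
    proof (cases rule: proper_subgroup_basis)
      case (two y z)
      interpret B: zp_times_z2_cubed_basis G p e1 V x y z by unfold_locales (rule two(1))
      have KB: "?K = {B.comb 0 b 0 0 | b. b \<in> UNIV}" using two(2) B.pair_eq by simp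
      have C1: "\<exists>b. B.comb i b 0 0 \<in> C" for i
        using C[of i] by (auto simp: KB B.e1_mult_comb)
      have S1: "\<exists>a. \<forall>k. B.comb a k i j \<in> S" for i j
      proof -
        obtain a :: int where a: "\<forall>k\<in>?K. e1 [^] a \<otimes> (B.comb 0 0 i j \<otimes> k) \<in> S"
          using S[OF B.comb_in_V[of 0 i j]] by (rule exE)
        have "B.comb a k i j \<in> S" for k
        proof -
          have "B.comb 0 k 0 0 \<in> ?K" unfolding KB by blast
          from bspec[OF a this] show ?thesis by (simp add: B.comb_mult B.e1_mult_comb)
        qed
        then show ?thesis by blast
      qed
      have S2: "\<forall>k. B.comb 0 k 0 0 \<in> S" using V_stabilizer_subset[OF one(1)] KB by auto
      obtain \<alpha> where \<alpha>: "\<alpha> 0 0 = 0" "\<forall>i\<in>UNIV. \<forall>j\<in>UNIV. \<forall>k. B.comb (\<alpha> i j) k i j \<in> S"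
        using choice_based2[of "\<lambda>i j a. \<forall>k. B.comb a k i j \<in> S" 0 0 0 UNIV UNIV] S1 S2 by auto
      obtain \<kappa> where \<kappa>: "\<kappa> 0 = 0" "\<forall>i\<in>UNIV. B.comb i (\<kappa> i) 0 0 \<in> C"
        using choice_based[of "\<lambda>i b. B.comb i b 0 0 \<in> C" 0 0 UNIV] C1 one B.comb_0 by auto
      have "B.standard_pair S C"
        by (rule B.standard_pair_11I[where \<alpha> = \<alpha> and \<kappa> = \<kappa>, OF fac \<alpha>(1) \<kappa>(1)]) (use \<alpha> \<kappa> in auto)
      then show ?thesis using two(1) unfolding standard_form_def by blast
    next
      case (four y z)
      interpret B: zp_times_z2_cubed_basis G p e1 V x y z by unfold_locales (rule four(1))
      have KB: "?K = {B.comb 0 b c 0 | b c. True}" using four(2) B.four_eq by simp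
      have C1: "\<exists>b c. B.comb i b c 0 \<in> C" for i
      proof -
        obtain v where v: "v \<in> ?K" "e1 [^] i \<otimes> v \<in> C" using C[of i] by blast
        then obtain b c where "v = B.comb 0 b c 0" unfolding KB by blast
        then have "B.comb i b c 0 \<in> C" using v(2) by (simp add: B.e1_mult_comb)
        then show ?thesis by blast
      qed
      have S1: "\<exists>a. \<forall>j k. B.comb a j k i \<in> S" for i
      proof -
        obtain a :: int where a: "\<forall>k\<in>?K. e1 [^] a \<otimes> (B.comb 0 0 0 i \<otimes> k) \<in> S"
          using S[OF B.comb_in_V[of 0 0 i]] by (rule exE)
        have "B.comb a j k i \<in> S" for j k
        proof -
          have "B.comb 0 j k 0 \<in> ?K" unfolding KB by blast
          from bspec[OF a this] show ?thesis by (simp add: B.comb_mult B.e1_mult_comb)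
        qed
        then show ?thesis by blast
      qed
      have S2: "\<forall>j k. B.comb 0 j k 0 \<in> S" using V_stabilizer_subset[OF one(1)] KB by auto
      obtain \<alpha> where \<alpha>: "\<alpha> 0 = 0" "\<forall>i\<in>UNIV. \<forall>j k. B.comb (\<alpha> i) j k i \<in> S"
        using choice_based[of "\<lambda>i a. \<forall>j k. B.comb a j k i \<in> S" 0 0 UNIV] S1 S2 by auto
      have z0: "B.comb 0 0 0 0 \<in> C" using one B.comb_0 by simp
      obtain \<kappa> where \<kappa>: "\<kappa> 0 = 0" "\<forall>i\<in>UNIV. \<exists>c. B.comb i (\<kappa> i) c 0 \<in> C"
        using choice_based[of "\<lambda>i b. \<exists>c. B.comb i b c 0 \<in> C" 0 0 UNIV] C1 z0 by blast
      obtain \<mu> where \<mu>: "\<mu> 0 = 0" "\<forall>i\<in>UNIV. B.comb i (\<kappa> i) (\<mu> i) 0 \<in> C"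
        using choice_based[of "\<lambda>i c. B.comb i (\<kappa> i) c 0 \<in> C" 0 0 UNIV] \<kappa> z0 by auto
      have "B.standard_pair S C"
        by (rule B.standard_pair_12I[where \<alpha> = \<alpha> and \<kappa> = \<kappa> and \<mu> = \<mu>, OF fac \<alpha>(1) \<kappa>(1) \<mu>(1)]) (use \<alpha> \<mu> in auto)
      then show ?thesis using four(1) unfolding standard_form_def by blast
    qed
  qed
qed

section \<open>Codes of size two\<close>

text \<open>
  Let \<open>C = {\<one>, c}\<close>. The translates of \<open>S\<close> by \<open>\<one>\<close> and \<open>c\<close> are complementary, so \<open>S\<close> is stable under
  \<open>c \<otimes> c\<close>, which is a power of \<open>e1\<close>. If it is trivial, \<open>c\<close> has order \<open>2\<close> and \<open>S\<close> is a transversal of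
  \<open>{\<one>, c}\<close>: family 10. Otherwise \<open>S\<close> is a union of cosets of the subgroup generated by \<open>e1\<close>: family 8.
\<close>

lemma standard_form_code_2:
  assumes fac: "factorization G S C" and one: "\<one> \<in> S" "\<one> \<in> C" and card: "card C = 2"
  shows "standard_form S C"
proof -
  have sub: "S \<subseteq> carrier G" "C \<subseteq> carrier G" using fac by (auto simp: factorization_def)
  obtain c where C: "C = {\<one>, c}" "c \<noteq> \<one>" using card one(2) by (auto simp: card_2_iff)
  have c: "c \<in> carrier G" using sub C by simp
  define w where "w = c [^] p"
  have cop: "coprime (card C) p" using card p_odd by simp
  have fW: "factorization G S {\<one>, w}" using power_projection(1)[OF fac cop] by (simp add: C w_def)
  have w: "w \<in> V" "w \<noteq> \<one>"
    using power_projection(2)[OF fac cop] c C pow_p_in_V by (auto simp: inj_on_def w_def)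
  obtain m :: int where m: "c = e1 [^] m \<otimes> w"
    using c unfolding w_def by (rule e1_pow_p_split)
  have inv2: "s \<otimes> e1 [^] (2 * m) \<in> S" if s: "s \<in> S" for s
  proof -
    have sc: "s \<in> carrier G" using s sub by auto
    have "c \<otimes> c = e1 [^] m \<otimes> w \<otimes> (e1 [^] m \<otimes> w)" by (simp only: m)
    also have "\<dots> = e1 [^] m \<otimes> e1 [^] m \<otimes> (w \<otimes> w)"
      using w V_closed by (simp add: m_ac)
    also have "\<dots> = e1 [^] (2 * m)" using w V_square by (simp add: int_pow_mult[symmetric])
    finally have cc: "e1 [^] (2 * m) = c \<otimes> c" by simp
    have "s \<otimes> (c \<otimes> c) \<in> carrier G" using sc c by simp
    with fac obtain s' c' where s': "s' \<in> S" "c' \<in> C" "s \<otimes> (c \<otimes> c) = s' \<otimes> c'"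
      by (rule factorizationE)
    have "c' \<noteq> c"
    proof
      assume "c' = c"
      then have "s \<otimes> c \<otimes> c = s' \<otimes> c" using s'(3) sc c by (simp add: m_assoc)
      then have "s \<otimes> c = s' \<otimes> \<one>" using s'(1) sc c sub by auto
      then show False using factorization_unique[OF fac s _ s'(1), of c \<one>] C by simp
    qed
    then have "c' = \<one>" using s' C by simp
    then have "s \<otimes> (c \<otimes> c) = s'" using s' sub by auto
    then show ?thesis using s'(1) cc by simp
  qed
  obtain e3 e4 where b: "generate G {w, e3, e4} = V" using w by (rule basis_extend)
  interpret B: zp_times_z2_cubed_basis G p e1 V w e3 e4 by unfold_locales (rule b)
  have c_comb: "c = B.comb m 1 0 0" unfolding m by (simp add: B.comb_def)
  have S1: "\<exists>a. B.comb i a j k \<in> S" for i j k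
  proof -
    have "B.comb i 0 j k \<in> carrier G" by simp
    with fW obtain s v where s: "s \<in> S" "v \<in> {\<one>, w}" "B.comb i 0 j k = s \<otimes> v"
      by (rule factorizationE)
    obtain b where v: "v = B.comb 0 b 0 0" using s(2) B.pair_eq by auto
    have "v \<in> V" using v B.comb_in_V by simp
    then have "s = B.comb i 0 j k \<otimes> v" using s sub V_cancel by auto
    then show ?thesis using s(1) v by (auto simp: B.comb_mult)
  qed
  have C1: "i \<in> {0..<2} \<Longrightarrow> i = 0 \<or> i = 1" for i :: int by auto
  show ?thesis
  proof (cases "[m = 0] (mod int p)")
    case True
    have c1: "c = B.comb 0 1 0 0" unfolding c_comb by (rule B.comb_cong[OF True]) simp_all
    have C2: "B.comb 0 i 0 0 \<in> C" if "i \<in> {0..<2}" for i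
      using C1[OF that] C(1) c1 B.comb_0 by auto
    obtain \<alpha> where \<alpha>: "\<alpha> 0 0 0 = 0"
        "\<forall>i\<in>UNIV. \<forall>j\<in>UNIV. \<forall>k\<in>UNIV. B.comb i (\<alpha> i j k) j k \<in> S"
      using choice_based3[of "\<lambda>i j k a. B.comb i a j k \<in> S" 0 0 0 0 UNIV UNIV UNIV] S1 one B.comb_0
      by auto
    have "B.standard_pair S C"
      by (rule B.standard_pair_10I[where \<alpha> = \<alpha>, OF fac \<alpha>(1)]) (use \<alpha> C2 in auto)
    then show ?thesis using b unfolding standard_form_def by blast
  next
    case False
    have "coprime (2 * m) (int p)"
    proof -
      have "\<not> int p dvd m" using False by (simp add: cong_0_iff)
      moreover have "\<not> int p dvd 2"
      proof
        assume "int p dvd 2"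
        then have "int p \<le> 2" by (rule zdvd_imp_le) simp
        then have "p = 2" using p_gt_1 by simp
        then show False using p_odd by simp
      qed
      ultimately have "\<not> int p dvd 2 * m" using p_prime by (simp add: prime_dvd_mult_iff)
      then have "coprime (int p) (2 * m)" using p_prime by (intro prime_imp_coprime) simp_all
      then show ?thesis by (simp only: coprime_commute)
    qed
    then obtain r where r: "[2 * m * r = 1] (mod int p)" using cong_solve_coprime_int by blast
    have shift: "s \<otimes> e1 [^] (2 * m * int n) \<in> S" if s: "s \<in> S" for s n
    proof (induction n)
      case (Suc n)
      have "s \<in> carrier G" using s sub by auto
      then have "s \<otimes> e1 [^] (2 * m * int (Suc n)) = s \<otimes> e1 [^] (2 * m * int n) \<otimes> e1 [^] (2 * m)"
        by (simp add: m_assoc distrib_left int_pow_mult[symmetric] add.commute)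
      then show ?case using inv2[OF Suc] by simp
    qed (use s sub in auto)
    have S2: "B.comb k a i j \<in> S" if "B.comb k' a i j \<in> S" for k k' a i j
    proof -
      \<comment> \<open>As \<open>r\<close> inverts \<open>2 * m\<close> modulo \<open>p\<close>, this many shifts by \<open>e1 [^] (2 * m)\<close> lead from coordinate \<open>k'\<close> to \<open>k\<close>.\<close>
      define n where "n = nat ((r * (k - k')) mod int p)"
      have n: "int n = (r * (k - k')) mod int p" using p_gt_1 by (simp add: n_def)
      have "[2 * m * int n = 2 * m * r * (k - k')] (mod int p)"
        unfolding n cong_def mod_mult_right_eq by (simp only: mult.assoc)
      also have "[2 * m * r * (k - k') = 1 * (k - k')] (mod int p)" using r by (rule cong_scalar_right)
      finally have "[k' + 2 * m * int n = k' + 1 * (k - k')] (mod int p)" by (rule cong_add[OF cong_refl])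
      then have "[k' + 2 * m * int n = k] (mod int p)" by simp
      then have "B.comb (k' + 2 * m * int n) a i j = B.comb k a i j" by (rule B.comb_cong) simp_all
      moreover have "B.comb k' a i j \<otimes> e1 [^] (2 * m * int n) = B.comb (k' + 2 * m * int n) a i j"
        using B.comb_mult[of k' a i j "2 * m * int n" 0 0 0] by (simp add: B.comb_def)
      ultimately show ?thesis using shift[OF that, of n] by simp
    qed
    have S3: "\<exists>a. \<forall>k. B.comb k a i j \<in> S" for i j
    proof -
      obtain a where "B.comb 0 a i j \<in> S" using S1[of 0 i j] by (rule exE)
      then have "\<forall>k. B.comb k a i j \<in> S" using S2 by simp
      then show ?thesis by (rule exI)
    qed
    have "B.comb 0 0 0 0 \<in> S" using one B.comb_0 by simp
    then have S4: "\<forall>k. B.comb k 0 0 0 \<in> S" using S2 by simp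
    obtain \<alpha> where \<alpha>: "\<alpha> 0 0 = 0" "\<forall>i\<in>UNIV. \<forall>j\<in>UNIV. \<forall>k. B.comb k (\<alpha> i j) i j \<in> S"
      using choice_based2[of "\<lambda>i j a. \<forall>k. B.comb k a i j \<in> S" 0 0 0 UNIV UNIV] S3 S4 by auto
    define \<kappa> where "\<kappa> i = (if i = 0 then 0 else m)" for i :: int
    have "\<kappa> 0 = 0" by (simp add: \<kappa>_def)
    have C2: "B.comb (\<kappa> i) i 0 0 \<in> C" if "i \<in> {0..<2}" for i
      using C1[OF that] C(1) c_comb B.comb_0 by (auto simp: \<kappa>_def)
    have "B.standard_pair S C"
      by (rule B.standard_pair_8I[where \<alpha> = \<alpha> and \<kappa> = \<kappa>, OF fac \<alpha>(1) \<open>\<kappa> 0 = 0\<close>]) (use \<alpha> C2 in auto)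
    then show ?thesis using b unfolding standard_form_def by blast
  qed
qed

end

section \<open>Factors of size four\<close>

context zp_times_z2_cubed_basis
begin

lemma comb_parity:
  assumes "even (b - b')" shows "comb i b c d = comb i b' c d"
  by (rule comb_cong) (use assms in \<open>simp_all add: cong_iff_dvd_diff\<close>)

lemma comb_mult_e2: "comb a b c d \<otimes> e2 = comb a (b + 1) c d"
  using comb_mult[of a b c d 0 1 0 0] by (simp add: comb_def)

lemma comb_e2_invariant:
  assumes X: "\<forall>x\<in>X. x \<otimes> e2 \<in> X" and b: "comb i b c d \<in> X"
  shows "comb i b' c d \<in> X"
proof (cases "even (b - b')")
  case True
  then show ?thesis using b comb_parity[OF True] by simp
next
  case False
  have "comb i b c d \<otimes> e2 = comb i (b + 1) c d" by (rule comb_mult_e2)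
  also have "\<dots> = comb i b' c d"
    by (rule comb_parity) (use False in simp)
  finally show ?thesis using bspec[OF X b] by simp
qed

end

context zp_times_z2_cubed
begin

text \<open>
  Let the projection of \<open>B\<close> be \<open>{\<one>, u\<^sub>1, u\<^sub>2, u\<^sub>3}\<close>. It is a subgroup if \<open>u\<^sub>3 = u\<^sub>1 \<otimes> u\<^sub>2\<close>, so the
  \<open>u\<^sub>i\<close> are independent here. Let \<open>w = u\<^sub>1 \<otimes> u\<^sub>2 \<otimes> u\<^sub>3\<close>. If
  \<open>a \<otimes> w = a' \<otimes> u\<^sub>1\<close>, then \<open>a' \<otimes> u\<^sub>2 = a \<otimes> u\<^sub>3\<close>, against uniqueness; likewise for \<open>u\<^sub>2\<close> and \<open>u\<^sub>3\<close>. So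
  \<open>a \<otimes> w \<in> A\<close>. Each coset of \<open>V\<close> therefore meets \<open>A\<close> in a pair \<open>{a, a \<otimes> w}\<close>; the function \<open>f\<close> selects
  one member of each pair, and the factor \<open>{\<one>, w}\<close> moves over to \<open>B\<close>.
\<close>

lemma independent_projection_split:
  assumes fac: "factorization G A B" and card_B: "card B = 4" and one: "\<one> \<in> A" "\<one> \<in> B"
    and indep: "\<not> subgroup ((\<lambda>b. b [^] p) ` B) G"
  obtains w and f :: "int \<Rightarrow> 'a" where "w \<in> V" "w \<noteq> \<one>" "\<forall>a\<in>A. a \<otimes> w \<in> A"
    and "f 0 = \<one>" "\<forall>i\<in>{0..<int p}. f i \<in> V \<and> e1 [^] i \<otimes> f i \<in> A"
    and "A \<subseteq> (\<lambda>i. e1 [^] i \<otimes> f i) ` {0..<int p} \<union> (\<lambda>i. e1 [^] i \<otimes> f i \<otimes> w) ` {0..<int p}"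
    and "factorization G ((\<lambda>i. e1 [^] i \<otimes> f i) ` {0..<int p}) (B \<union> (\<lambda>b. b \<otimes> w) ` B)"
    and "card ((\<lambda>i. e1 [^] i \<otimes> f i) ` {0..<int p}) = p" "card (B \<union> (\<lambda>b. b \<otimes> w) ` B) = 8"
proof -
  have sub: "A \<subseteq> carrier G" "B \<subseteq> carrier G" using fac by (auto simp: factorization_def)
  let ?W = "(\<lambda>b. b [^] p) ` B"
  have cop: "coprime (card B) p" using card_B p_odd coprime_power_left_iff[of 2 2 p] by simp
  have fW: "factorization G A ?W" using power_projection(1)[OF fac cop] .
  have WV: "?W \<subseteq> V" using sub pow_p_in_V by auto
  have oneW: "\<one> \<in> ?W" using one by force
  have "card ?W = 4" using power_projection(2)[OF fac cop] card_B by (simp add: card_image)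
  then have "card (?W - {\<one>}) = 3" using oneW by simp
  then obtain u1 u2 u3 where u: "?W - {\<one>} = {u1, u2, u3}" "u1 \<noteq> u2" "u2 \<noteq> u3" "u1 \<noteq> u3"
    unfolding card_3_iff by auto
  have W: "?W = {\<one>, u1, u2, u3}" using u(1) oneW by auto
  have un: "u1 \<noteq> \<one>" "u2 \<noteq> \<one>" "u3 \<noteq> \<one>" using u(1) by auto
  have uV: "u1 \<in> V" "u2 \<in> V" "u3 \<in> V" using W WV by auto
  then have uc: "u1 \<in> carrier G" "u2 \<in> carrier G" "u3 \<in> carrier G" by (simp_all add: V_closed)
  have u3: "u3 \<noteq> u1 \<otimes> u2"
  proof
    assume "u3 = u1 \<otimes> u2"
    then have "subgroup ?W G" unfolding W using subgroup_four(1)[of u1 u2] uV un u by simp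
    then show False using indep by simp
  qed
  define w where "w = u1 \<otimes> u2 \<otimes> u3"
  have wV: "w \<in> V" using uV by (simp add: w_def V_mult)
  have wc: "w \<in> carrier G" using wV by (rule V_closed)
  have w1: "w \<noteq> \<one>"
  proof
    assume "w = \<one>"
    then have "u1 \<otimes> u2 = inv u3" using uc by (intro inv_equality[symmetric]) (simp_all add: w_def)
    then show False using u3 V_inv[OF uV(3)] by simp
  qed
  have *: "a' \<noteq> a \<otimes> (x \<otimes> y)" if "a \<in> A" "a' \<in> A" "x \<in> ?W" "y \<in> ?W" "x \<noteq> y" for a a' x y
  proof
    assume "a' = a \<otimes> (x \<otimes> y)"
    moreover have "x \<in> V" "y \<in> V" "a \<in> carrier G" using that WV sub by auto
    ultimately have "a' \<otimes> y = a \<otimes> x" by (simp add: V_closed V_square m_assoc)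
    then show False using factorization_unique[OF fW that(2,4,1,3)] that(5) by simp
  qed
  have Aw: "a \<otimes> w \<in> A" if a: "a \<in> A" for a
  proof -
    have ac: "a \<in> carrier G" using a sub by auto
    then have "a \<otimes> w \<in> carrier G" using wc by simp
    with fW obtain a' v where v: "a' \<in> A" "v \<in> ?W" "a \<otimes> w = a' \<otimes> v" by (rule factorizationE)
    have "v \<in> V" "a' \<in> carrier G" using v WV sub by auto
    then have a': "a' = a \<otimes> w \<otimes> v" unfolding v(3) by (simp add: V_cancel)
    have wu: "w \<otimes> u1 = u2 \<otimes> u3" "w \<otimes> u2 = u1 \<otimes> u3" "w \<otimes> u3 = u1 \<otimes> u2"
    proof -
      have "w \<otimes> u1 = u2 \<otimes> u3 \<otimes> u1 \<otimes> u1" using uc by (simp add: w_def m_ac)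
      then show "w \<otimes> u1 = u2 \<otimes> u3" using uc uV by (simp add: V_cancel)
      have "w \<otimes> u2 = u1 \<otimes> u3 \<otimes> u2 \<otimes> u2" using uc by (simp add: w_def m_ac)
      then show "w \<otimes> u2 = u1 \<otimes> u3" using uc uV by (simp add: V_cancel)
      show "w \<otimes> u3 = u1 \<otimes> u2" using uc uV by (simp add: w_def V_cancel)
    qed
    have a'_eq: "a' = a \<otimes> (w \<otimes> v)"
      using a' ac wc V_closed[OF \<open>v \<in> V\<close>] by (simp add: m_assoc)
    have uW: "u1 \<in> ?W" "u2 \<in> ?W" "u3 \<in> ?W" unfolding W by simp_all
    have "v \<noteq> u1" using *[OF a v(1) uW(2,3) u(3)] a'_eq wu(1) by metis
    moreover have "v \<noteq> u2" using *[OF a v(1) uW(1,3) u(4)] a'_eq wu(2) by metis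
    moreover have "v \<noteq> u3" using *[OF a v(1) uW(1,2) u(2)] a'_eq wu(3) by metis
    ultimately have "v = \<one>" using v(2) unfolding W by blast
    then show ?thesis using a' v(1) ac wc by simp
  qed
  have "\<forall>i\<in>{0..<int p}. \<exists>v. v \<in> V \<and> e1 [^] i \<otimes> v \<in> A"
  proof
    fix i :: int
    obtain v where "v \<in> V" "e1 [^] i \<otimes> v \<in> A"
      using fW WV by (rule factorization_V_transversal)
    then show "\<exists>v. v \<in> V \<and> e1 [^] i \<otimes> v \<in> A" by blast
  qed
  then obtain f where f: "f 0 = \<one>" "\<forall>i\<in>{0..<int p}. f i \<in> V \<and> e1 [^] i \<otimes> f i \<in> A"
    using choice_based[of "\<lambda>i v. v \<in> V \<and> e1 [^] i \<otimes> v \<in> A" 0 \<one> "{0..<int p}"] one V_one by auto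
  let ?I = "{0..<int p}"
  let ?A = "(\<lambda>i. e1 [^] i \<otimes> f i) ` ?I" and ?Aw = "(\<lambda>i. e1 [^] i \<otimes> f i \<otimes> w) ` ?I"
  let ?B = "B \<union> (\<lambda>b. b \<otimes> w) ` B"
  have uniq: "i = j \<and> v = v'"
    if "e1 [^] i \<otimes> v = e1 [^] j \<otimes> v'" "i \<in> ?I" "j \<in> ?I" "v \<in> V" "v' \<in> V" for i j v v'
    using inj_onD[of "\<lambda>(i, v). e1 [^] i \<otimes> v" "?I \<times> V" "(i, v)" "(j, v')"] decomposition that
    by (simp add: bij_betw_def)
  have fc: "f i \<in> V" "f i \<in> carrier G" "f i \<otimes> w \<in> V" if "i \<in> ?I" for i
    using f(2) that wV by (simp_all add: V_closed V_mult)
  have cA: "card ?A = p"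
  proof -
    have "inj_on (\<lambda>i. e1 [^] i \<otimes> f i) ?I" using uniq fc by (intro inj_onI) blast
    then show ?thesis by (simp add: card_image)
  qed
  have Aw_eq: "e1 [^] i \<otimes> f i \<otimes> w = e1 [^] i \<otimes> (f i \<otimes> w)" if "i \<in> ?I" for i
    using fc[OF that] wc by (simp add: m_assoc)
  have cAw: "card ?Aw = p"
  proof -
    have "inj_on (\<lambda>i. e1 [^] i \<otimes> f i \<otimes> w) ?I"
    proof (rule inj_onI)
      fix i j assume "i \<in> ?I" "j \<in> ?I" "e1 [^] i \<otimes> f i \<otimes> w = e1 [^] j \<otimes> f j \<otimes> w"
      then show "i = j" using uniq[of i "f i \<otimes> w" j "f j \<otimes> w"] fc by (simp add: Aw_eq)
    qed
    then show ?thesis by (simp add: card_image)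
  qed
  have "?A \<inter> ?Aw = {}"
  proof -
    have "e1 [^] i \<otimes> f i \<noteq> e1 [^] j \<otimes> f j \<otimes> w" if "i \<in> ?I" "j \<in> ?I" for i j
    proof
      assume "e1 [^] i \<otimes> f i = e1 [^] j \<otimes> f j \<otimes> w"
      then have e: "e1 [^] i \<otimes> f i = e1 [^] j \<otimes> (f j \<otimes> w)" using that by (simp only: Aw_eq)
      have "i = j \<and> f i = f j \<otimes> w"
        by (rule uniq[OF e that fc(1)[OF that(1)] fc(3)[OF that(2)]])
      then have "f j \<otimes> w = f j \<otimes> \<one>" using fc(2)[OF that(2)] by auto
      then show False using fc(2)[OF that(2)] wc w1 by simp
    qed
    then show ?thesis by blast
  qed
  then have cU: "card (?A \<union> ?Aw) = 2 * p" using cA cAw by (subst card_Un_disjoint) simp_all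
  have card_A: "card A = 2 * p" using factorization_card[OF fac] card_B by (simp add: order_G)
  have "finite A" using sub(1) finite_G by (rule finite_subset)
  then have A_eq: "?A \<union> ?Aw = A" using f(2) Aw cU card_A by (intro card_subset_eq) auto
  have finB: "finite B" using sub(2) finite_G by (rule finite_subset)
  have "card ?B \<le> 4 + 4"
    using card_Un_le[of B "(\<lambda>b. b \<otimes> w) ` B"] card_image_le[OF finB, of "\<lambda>b. b \<otimes> w"] card_B by linarith
  then have cB: "card ?B \<le> 8" by simp
  have fac': "factorization G ?A ?B"
  proof (rule factorizationI)
    show "card ?A * card ?B \<le> order G"
      unfolding cA order_G mult.commute[of p] using cB by (rule mult_le_mono1)
    show "?A \<subseteq> carrier G" using f(2) sub by auto
    show "?B \<subseteq> carrier G" using sub wc by auto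
    fix g assume "g \<in> carrier G"
    with fac obtain a b where ab: "a \<in> A" "b \<in> B" "g = a \<otimes> b" by (rule factorizationE)
    have bc: "b \<in> carrier G" using ab sub by auto
    from ab(1) A_eq consider "a \<in> ?A" | "a \<in> ?Aw" by blast
    then show "\<exists>a\<in>?A. \<exists>b\<in>?B. g = a \<otimes> b"
    proof cases
      case 1
      then show ?thesis using ab by blast
    next
      case 2
      then obtain i where i: "i \<in> ?I" "a = e1 [^] i \<otimes> f i \<otimes> w" by blast
      then have "g = e1 [^] i \<otimes> f i \<otimes> (b \<otimes> w)" using ab(3) fc[OF i(1)] wc bc by (simp add: m_ac)
      then show ?thesis using i(1) ab(2) by blast
    qed
  qed (use finB in auto)
  have "card ?B = 8" using factorization_card[OF fac'] p_gt_1 unfolding cA order_G by simp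
  then show ?thesis using that[OF wV w1 _ f(1) f(2) _ fac' cA] Aw A_eq by simp
qed

lemma stabilizes_Un_translate:
  assumes "B \<subseteq> carrier G" "w \<in> V"
  shows "w \<in> V_stabilizer (B \<union> (\<lambda>b. b \<otimes> w) ` B)"
  using assms V_cancel by (auto simp: V_stabilizer_def)

lemma mem_Un_translate:
  assumes "B \<subseteq> carrier G" "w \<in> V" "x \<in> B \<union> (\<lambda>b. b \<otimes> w) ` B"
  shows "x \<in> B \<or> x \<otimes> w \<in> B"
  using assms V_cancel by auto

text \<open>
  After \<open>w\<close> has been moved to the code, the projection of \<open>S\<close> stabilizes the enlarged code, which is
  therefore \<open>V\<close>. So \<open>C\<close> is a transversal of \<open>{\<one>, w}\<close> in \<open>V\<close>: family 2.
\<close>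

lemma standard_form_code_4_independent:
  assumes fac: "factorization G S C" and gen: "generate G S = carrier G"
    and one: "\<one> \<in> S" "\<one> \<in> C" and card: "card C = 4"
    and indep: "\<not> subgroup ((\<lambda>b. b [^] p) ` C) G"
  shows "standard_form S C"
proof -
  have sub: "S \<subseteq> carrier G" "C \<subseteq> carrier G" using fac by (auto simp: factorization_def)
  obtain w and f :: "int \<Rightarrow> 'a" where w: "w \<in> V" "w \<noteq> \<one>" "\<forall>a\<in>S. a \<otimes> w \<in> S"
    and f: "f 0 = \<one>" "\<forall>i\<in>{0..<int p}. f i \<in> V \<and> e1 [^] i \<otimes> f i \<in> S"
    and S_sub: "S \<subseteq> (\<lambda>i. e1 [^] i \<otimes> f i) ` {0..<int p} \<union> (\<lambda>i. e1 [^] i \<otimes> f i \<otimes> w) ` {0..<int p}"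
    and fac': "factorization G ((\<lambda>i. e1 [^] i \<otimes> f i) ` {0..<int p}) (C \<union> (\<lambda>b. b \<otimes> w) ` C)"
    and card': "card ((\<lambda>i. e1 [^] i \<otimes> f i) ` {0..<int p}) = p" "card (C \<union> (\<lambda>b. b \<otimes> w) ` C) = 8"
    using fac card one indep by (rule independent_projection_split)
  let ?A = "(\<lambda>i. e1 [^] i \<otimes> f i) ` {0..<int p}" and ?B = "C \<union> (\<lambda>b. b \<otimes> w) ` C"
  let ?K = "V_stabilizer ?B"
  have Bsub: "?B \<subseteq> carrier G" using fac' by (simp add: factorization_def)
  have K: "subgroup ?K G" using V_stabilizer_subgroup[OF Bsub] .
  have wK: "w \<in> ?K" using stabilizes_Un_translate[OF sub(2) w(1)] .
  have "\<one> \<in> ?A" using f(1) p_gt_1 by (auto intro!: image_eqI[of _ _ 0])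
  then have fK: "f i \<in> ?K" if "i \<in> {0..<int p}" for i
    using pow_p_in_V_stabilizer[OF fac' card'(1), of "e1 [^] i \<otimes> f i"] that bspec[OF f(2) that]
    by (simp add: pow_p_e1_V)
  have "?K = V"
    using gen K V_stabilizer_subset_V
  proof (rule generating_pow_p)
    fix s assume "s \<in> S"
    then obtain i where i: "i \<in> {0..<int p}" "s = e1 [^] i \<otimes> f i \<or> s = e1 [^] i \<otimes> f i \<otimes> w"
      using S_sub by blast
    have "f i \<otimes> w \<in> V" "f i \<in> V" using bspec[OF f(2) i(1)] w(1) by (simp_all add: V_mult)
    then have "s [^] p = f i \<or> s [^] p = f i \<otimes> w"
      using i(2) pow_p_e1_V[of "f i"] pow_p_e1_V[of "f i \<otimes> w"] w(1) by (auto simp: m_assoc V_closed)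
    then show "s [^] p \<in> ?K" using fK[OF i(1)] wK subgroup.m_closed[OF K] by auto
  qed (rule sub(1))
  then have "V \<subseteq> ?B" using V_stabilizer_subset[of ?B] one by simp
  then have VB: "V = ?B" using card'(2) V_card by (intro card_subset_eq card_ge_0_finite) simp_all
  obtain e3 e4 where b: "generate G {w, e3, e4} = V" using w(1,2) by (rule basis_extend)
  interpret B: zp_times_z2_cubed_basis G p e1 V w e3 e4 by unfold_locales (rule b)
  note Sw = B.comb_e2_invariant[OF w(3)]
  have S1: "\<exists>c d. \<forall>b. B.comb i b c d \<in> S" if i: "i \<in> {0..<int p}" for i
  proof -
    obtain b c d where "f i = B.comb 0 b c d" using bspec[OF f(2) i] by (blast elim: B.V_comb)
    then have "B.comb i b c d \<in> S" using bspec[OF f(2) i] by (simp add: B.e1_mult_comb)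
    then have "\<forall>b. B.comb i b c d \<in> S" using Sw by simp
    then show ?thesis by blast
  qed
  have "B.comb 0 0 0 0 \<in> S" using one B.comb_0 by simp
  then have S0: "\<forall>b. B.comb 0 b 0 0 \<in> S" using Sw by simp
  have C1: "\<exists>k. B.comb 0 k i j \<in> C" for i j
  proof -
    have "B.comb 0 0 i j \<in> ?B" using VB B.comb_in_V by simp
    then have "B.comb 0 0 i j \<in> C \<or> B.comb 0 0 i j \<otimes> w \<in> C"
      using mem_Un_translate[OF sub(2) w(1)] by simp
    moreover have "B.comb 0 0 i j \<otimes> w = B.comb 0 1 i j" by (simp add: B.comb_mult_e2)
    ultimately show ?thesis by auto
  qed
  obtain \<alpha> where \<alpha>: "\<alpha> 0 = 0" "\<forall>i\<in>{0..<int p}. \<exists>d. \<forall>b. B.comb i b (\<alpha> i) d \<in> S"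
    using choice_based[of "\<lambda>i c. \<exists>d. \<forall>b. B.comb i b c d \<in> S" 0 0 "{0..<int p}"] S1 S0 by blast
  obtain \<beta> where \<beta>: "\<beta> 0 = 0" "\<forall>i\<in>{0..<int p}. \<forall>b. B.comb i b (\<alpha> i) (\<beta> i) \<in> S"
    using choice_based[of "\<lambda>i d. \<forall>b. B.comb i b (\<alpha> i) d \<in> S" 0 0 "{0..<int p}"] \<alpha> S0 by auto
  obtain \<kappa> where \<kappa>: "\<kappa> 0 0 = 0" "\<forall>i\<in>UNIV. \<forall>j\<in>UNIV. B.comb 0 (\<kappa> i j) i j \<in> C"
    using choice_based2[of "\<lambda>i j k. B.comb 0 k i j \<in> C" 0 0 0 UNIV UNIV] C1 one B.comb_0 by auto
  have "B.standard_pair S C"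
    by (rule B.standard_pair_2I[where \<alpha> = \<alpha> and \<beta> = \<beta> and \<kappa> = \<kappa>, OF fac \<alpha>(1) \<beta>(1) \<kappa>(1)])
      (use \<beta> \<kappa> in auto)
  then show ?thesis using b unfolding standard_form_def by blast
qed

text \<open>
  A generating set projects onto generators of \<open>V\<close>, so a connection set of size \<open>4\<close> does not project onto
  a subgroup. After \<open>w\<close> has been moved to \<open>S\<close>, the stabilizer \<open>K\<close> of the enlarged set contains \<open>w\<close> and
  the projection of \<open>C\<close>. It is not \<open>V\<close>, since otherwise \<open>S \<subseteq> V\<close>. Its orders \<open>2\<close> and \<open>4\<close> give families 6
  and 5.
\<close>

lemma standard_form_connection_4:
  assumes fac: "factorization G S C" and gen: "generate G S = carrier G"
    and one: "\<one> \<in> S" "\<one> \<in> C" and card: "card S = 4"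
  shows "standard_form S C"
proof -
  have sub: "S \<subseteq> carrier G" "C \<subseteq> carrier G" using fac by (auto simp: factorization_def)
  have indep: "\<not> subgroup ((\<lambda>b. b [^] p) ` S) G"
  proof
    assume H: "subgroup ((\<lambda>b. b [^] p) ` S) G"
    have "(\<lambda>b. b [^] p) ` S = V"
      using gen H by (rule generating_pow_p) (use sub pow_p_in_V in auto)
    then have "8 \<le> card S"
      using V_card card_image_le[of S "\<lambda>b. b [^] p"] card card_ge_0_finite[of S] by simp
    then show False using card by simp
  qed
  obtain w and f :: "int \<Rightarrow> 'a" where w: "w \<in> V" "w \<noteq> \<one>" "\<forall>a\<in>C. a \<otimes> w \<in> C"
    and f: "f 0 = \<one>" "\<forall>i\<in>{0..<int p}. f i \<in> V \<and> e1 [^] i \<otimes> f i \<in> C"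
    and "C \<subseteq> (\<lambda>i. e1 [^] i \<otimes> f i) ` {0..<int p} \<union> (\<lambda>i. e1 [^] i \<otimes> f i \<otimes> w) ` {0..<int p}"
    and fac': "factorization G ((\<lambda>i. e1 [^] i \<otimes> f i) ` {0..<int p}) (S \<union> (\<lambda>b. b \<otimes> w) ` S)"
    and card': "card ((\<lambda>i. e1 [^] i \<otimes> f i) ` {0..<int p}) = p" "card (S \<union> (\<lambda>b. b \<otimes> w) ` S) = 8"
    using factorization_commute[OF fac] card one(2,1) indep by (rule independent_projection_split)
  let ?A = "(\<lambda>i. e1 [^] i \<otimes> f i) ` {0..<int p}" and ?B = "S \<union> (\<lambda>b. b \<otimes> w) ` S"
  let ?K = "V_stabilizer ?B"
  have Bsub: "?B \<subseteq> carrier G" using fac' by (simp add: factorization_def)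
  have K: "subgroup ?K G" using V_stabilizer_subgroup[OF Bsub] .
  have KB: "?K \<subseteq> ?B" using V_stabilizer_subset[of ?B] one by simp
  have wK: "w \<in> ?K" using stabilizes_Un_translate[OF sub(1) w(1)] .
  have "\<one> \<in> ?A" using f(1) p_gt_1 by (auto intro!: image_eqI[of _ _ 0])
  then have fK: "f i \<in> ?K" if "i \<in> {0..<int p}" for i
    using pow_p_in_V_stabilizer[OF fac' card'(1), of "e1 [^] i \<otimes> f i"] that bspec[OF f(2) that]
    by (simp add: pow_p_e1_V)
  have KV: "?K \<noteq> V"
  proof
    assume "?K = V"
    then have "V = ?B" using KB card'(2) V_card by (intro card_subset_eq card_ge_0_finite) simp_all
    then show False using not_generating_in_V[OF gen] by blast
  qed
  have lift: "\<exists>a::int. \<forall>k\<in>?K. e1 [^] a \<otimes> (v \<otimes> k) \<in> ?B" if v: "v \<in> V" for v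
  proof -
    obtain a :: int where a: "e1 [^] a \<otimes> v \<in> ?B" using lift_V[OF fac' card'(2) v] .
    have "e1 [^] a \<otimes> (v \<otimes> k) \<in> ?B" if k: "k \<in> ?K" for k
    proof -
      have "k \<in> carrier G" "v \<in> carrier G" using k v V_stabilizer_subset_V V_closed by auto
      then show ?thesis using V_stabilizerD[OF k a] by (simp add: m_assoc)
    qed
    then show ?thesis by blast
  qed
  from K V_stabilizer_subset_V KV wK w(2) show ?thesis
  proof (cases rule: proper_subgroup_basis)
    case (two y z)
    interpret B: zp_times_z2_cubed_basis G p e1 V w y z by unfold_locales (rule two(1))
    have Sw: "\<exists>k. B.comb a k i j \<in> S" if "B.comb a b i j \<in> ?B" for a b i j
      using mem_Un_translate[OF sub(1) w(1) that] by (auto simp: B.comb_mult_e2)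
    have S1: "\<exists>a. B.comb a a i j \<in> S" for i j
    proof -
      obtain a :: int where a: "\<forall>k\<in>?K. e1 [^] a \<otimes> (B.comb 0 0 i j \<otimes> k) \<in> ?B"
        using lift[OF B.comb_in_V[of 0 i j]] by (rule exE)
      from bspec[OF a subgroup.one_closed[OF K]] have "B.comb a 0 i j \<in> ?B"
        by (simp add: B.e1_mult_comb)
      then obtain k where k: "B.comb a k i j \<in> S" using Sw by blast
      \<comment> \<open>Family 6 uses one integer for both coordinates: it is \<open>a\<close> modulo \<open>p\<close> and \<open>k\<close> modulo \<open>2\<close>.\<close>
      define a' where "a' = (if even (a - k) then a else a + int p)"
      have "B.comb a' a' i j = B.comb a k i j"
        by (rule B.comb_cong) (use p_odd in \<open>auto simp: a'_def cong_iff_dvd_diff\<close>)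
      then have "B.comb a' a' i j \<in> S" using k by simp
      then show ?thesis by (rule exI)
    qed
    have C1: "B.comb i j 0 0 \<in> C" if i: "i \<in> {0..<int p}" for i j
    proof -
      have "f i \<in> {\<one>, w}" using fK[OF i] unfolding two(2) .
      then obtain b where b: "f i = B.comb 0 b 0 0" unfolding B.pair_eq by blast
      have "B.comb i b 0 0 \<in> C" using bspec[OF f(2) i] b by (simp add: B.e1_mult_comb)
      then show ?thesis by (rule B.comb_e2_invariant[OF w(3)])
    qed
    obtain \<alpha> where \<alpha>: "\<alpha> 0 0 = 0" "\<forall>i\<in>UNIV. \<forall>j\<in>UNIV. B.comb (\<alpha> i j) (\<alpha> i j) i j \<in> S"
      using choice_based2[of "\<lambda>i j a. B.comb a a i j \<in> S" 0 0 0 UNIV UNIV] S1 one B.comb_0 by auto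
    have "B.standard_pair S C"
      by (rule B.standard_pair_6I[where \<alpha> = \<alpha>, OF fac \<alpha>(1)]) (use \<alpha> C1 in auto)
    then show ?thesis using two(1) unfolding standard_form_def by blast
  next
    case (four y z)
    interpret B: zp_times_z2_cubed_basis G p e1 V w y z by unfold_locales (rule four(1))
    have K_eq: "?K = {B.comb 0 b c 0 | b c. True}" using four(2) B.four_eq by simp
    have Sw: "\<exists>k. B.comb a k i j \<in> S" if "B.comb a b i j \<in> ?B" for a b i j
      using mem_Un_translate[OF sub(1) w(1) that] by (auto simp: B.comb_mult_e2)
    have S1: "\<exists>a. \<forall>j. \<exists>b. B.comb a b j i \<in> S" for i
    proof -
      obtain a :: int where a: "\<forall>k\<in>?K. e1 [^] a \<otimes> (B.comb 0 0 0 i \<otimes> k) \<in> ?B"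
        using lift[OF B.comb_in_V[of 0 0 i]] by (rule exE)
      have "\<exists>b. B.comb a b j i \<in> S" for j
      proof -
        have "B.comb 0 0 j 0 \<in> ?K" unfolding K_eq by blast
        from bspec[OF a this] have "B.comb a 0 j i \<in> ?B" by (simp add: B.comb_mult B.e1_mult_comb)
        then show ?thesis by (rule Sw)
      qed
      then show ?thesis by blast
    qed
    have S0: "\<forall>j. \<exists>b. B.comb 0 b j 0 \<in> S"
    proof
      fix j
      have "B.comb 0 0 j 0 \<in> ?K" unfolding K_eq by blast
      then have "B.comb 0 0 j 0 \<in> ?B" using KB by blast
      then show "\<exists>b. B.comb 0 b j 0 \<in> S" by (rule Sw)
    qed
    have C1: "\<exists>c. \<forall>j. B.comb i j c 0 \<in> C" if i: "i \<in> {0..<int p}" for i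
    proof -
      obtain b c where b: "f i = B.comb 0 b c 0" using fK[OF i] unfolding K_eq by blast
      have "B.comb i b c 0 \<in> C" using bspec[OF f(2) i] b by (simp add: B.e1_mult_comb)
      then have "B.comb i j c 0 \<in> C" for j by (rule B.comb_e2_invariant[OF w(3)])
      then show ?thesis by blast
    qed
    have "\<forall>j. B.comb 0 j 0 0 \<in> C"
    proof
      fix j
      have "B.comb 0 0 0 0 \<in> C" using one B.comb_0 by simp
      then show "B.comb 0 j 0 0 \<in> C" by (rule B.comb_e2_invariant[OF w(3)])
    qed
    then obtain \<kappa> where \<kappa>: "\<kappa> 0 = 0" "\<forall>i\<in>{0..<int p}. \<forall>j. B.comb i j (\<kappa> i) 0 \<in> C"
      using choice_based[of "\<lambda>i c. \<forall>j. B.comb i j c 0 \<in> C" 0 0 "{0..<int p}"] C1 by auto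
    obtain \<alpha>' where \<alpha>': "\<alpha>' 0 = 0" "\<forall>i\<in>UNIV. \<forall>j. \<exists>b. B.comb (\<alpha>' i) b j i \<in> S"
      using choice_based[of "\<lambda>i a. \<forall>j. \<exists>b. B.comb a b j i \<in> S" 0 0 UNIV] S1 S0 by auto
    obtain \<alpha> where \<alpha>: "\<alpha> 0 0 = 0" "\<forall>i\<in>UNIV. \<forall>j\<in>UNIV. B.comb (\<alpha>' i) (\<alpha> i j) j i \<in> S"
      using choice_based2[of "\<lambda>i j b. B.comb (\<alpha>' i) b j i \<in> S" 0 0 0 UNIV UNIV] \<alpha>' one B.comb_0
      by auto
    have "B.standard_pair S C"
      by (rule B.standard_pair_5I[where \<alpha>' = \<alpha>' and \<alpha> = \<alpha> and \<kappa> = \<kappa>, OF fac \<alpha>'(1) \<alpha>(1) \<kappa>(1)])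
        (use \<alpha> \<kappa> in auto)
    then show ?thesis using four(1) unfolding standard_form_def by blast
  qed
qed

text \<open>
  Let \<open>W\<close> be the projection of \<open>C\<close> and \<open>d \<in> V\<close> outside \<open>W\<close>. Sort \<open>S\<close> into \<open>S0\<close> and \<open>S1\<close> according to
  whether the projection lies in \<open>W\<close>. Since \<open>C\<close> keeps the cosets of \<open>W\<close> apart, each of \<open>S0\<close> and \<open>S1\<close>
  is complementary to \<open>C \<union> C d\<close>, so both have \<open>p\<close> elements. Therefore the stabilizer \<open>K\<close> of \<open>C\<close> contains
  the projections of \<open>S0\<close> and the products of two projections of \<open>S1\<close>. So \<open>K\<close> and a single element \<open>t\<close>
  generate \<open>V\<close>, hence \<open>|K| = 4\<close>, and \<open>K \<subseteq> C\<close> gives \<open>C = K = W\<close>: family 4.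
\<close>

lemma standard_form_code_4_subgroup:
  assumes fac: "factorization G S C" and gen: "generate G S = carrier G"
    and one: "\<one> \<in> S" "\<one> \<in> C" and card: "card C = 4"
    and H: "subgroup ((\<lambda>b. b [^] p) ` C) G"
  shows "standard_form S C"
proof -
  have sub: "S \<subseteq> carrier G" "C \<subseteq> carrier G" using fac by (auto simp: factorization_def)
  have finS: "finite S" and finC: "finite C" using sub finite_G finite_subset by auto
  define W where "W = (\<lambda>b. b [^] p) ` C"
  have W: "subgroup W G" using H by (simp add: W_def)
  have cop: "coprime (card C) p" using card p_odd coprime_power_left_iff[of 2 2 p] by simp
  have WV: "W \<subseteq> V" using sub pow_p_in_V by (auto simp: W_def)
  have card_W: "card W = 4"
    using power_projection(2)[OF fac cop] card by (simp add: W_def card_image)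
  have CW: "c [^] p \<in> W" if "c \<in> C" for c using that by (simp add: W_def)
  have W_mult: "x \<otimes> y \<in> W" if "x \<in> W" "y \<in> W" for x y using W that by (rule subgroup.m_closed)
  have W_one: "\<one> \<in> W" using W by (rule subgroup.one_closed)
  have W_iff: "x \<otimes> y \<in> W \<longleftrightarrow> x \<in> W" if "y \<in> W" "x \<in> carrier G" for x y
  proof
    assume "x \<otimes> y \<in> W"
    then have "x \<otimes> y \<otimes> y \<in> W" using that(1) by (rule W_mult)
    then show "x \<in> W" using V_cancel[of y x] that WV by auto
  qed (use that W_mult in simp)
  have "card W < 8" "finite W" using card_W finC by (simp_all add: W_def)
  then obtain d where d: "d \<in> V" "d \<notin> W" using V_outside by blast
  have dc: "d \<in> carrier G" using d V_closed by simp
  have VW: "V = W \<union> (\<lambda>h. h \<otimes> d) ` W"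
    using card_double_subgroup(2,3)[OF W WV d] V_finite V_card card_W
    by (intro card_subset_eq[symmetric]) simp_all
  have coset: "v \<otimes> d \<in> W" if v: "v \<in> V" "v \<notin> W" for v
  proof -
    obtain h where h: "h \<in> W" "v = h \<otimes> d" using v VW by blast
    then have "v \<otimes> d = h" using V_cancel[OF d(1), of h] WV V_closed by auto
    then show ?thesis using h by simp
  qed
  define S0 S1 where "S0 = {s \<in> S. s [^] p \<in> W}" and "S1 = {s \<in> S. s [^] p \<notin> W}"
  let ?C = "C \<union> (\<lambda>c. c \<otimes> d) ` C"
  have "card ?C \<le> 4 + 4"
    using card_Un_le[of C "(\<lambda>c. c \<otimes> d) ` C"] card_image_le[OF finC, of "\<lambda>c. c \<otimes> d"] card by linarith
  then have card_C: "card ?C \<le> 8" by simp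
  have split: "\<exists>s\<in>S. \<exists>c\<in>C. g = s \<otimes> c \<and> (s [^] p \<in> W \<longleftrightarrow> g [^] p \<in> W)"
    if g: "g \<in> carrier G" for g
  proof -
    obtain s c where sc: "s \<in> S" "c \<in> C" "g = s \<otimes> c" using fac g by (rule factorizationE)
    have "s \<in> carrier G" "c \<in> carrier G" using sc sub by auto
    then have "g [^] p = s [^] p \<otimes> c [^] p" "s [^] p \<in> carrier G" using sc(3) by (simp_all add: pow_p_mult)
    then have "s [^] p \<in> W \<longleftrightarrow> g [^] p \<in> W" using W_iff[OF CW[OF sc(2)]] by simp
    then show ?thesis using sc by blast
  qed
  have split_d: "\<exists>s\<in>S. \<exists>c\<in>C. g = s \<otimes> (c \<otimes> d) \<and> (s [^] p \<in> W \<longleftrightarrow> g [^] p \<notin> W)"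
    if g: "g \<in> carrier G" for g
  proof -
    obtain s c where sc: "s \<in> S" "c \<in> C" "g \<otimes> d = s \<otimes> c" "s [^] p \<in> W \<longleftrightarrow> (g \<otimes> d) [^] p \<in> W"
      using split[of "g \<otimes> d"] g dc by auto
    have c: "s \<in> carrier G" "c \<in> carrier G" using sc sub by auto
    have "g = g \<otimes> d \<otimes> d" using g d(1) by (simp add: V_cancel)
    also have "\<dots> = s \<otimes> (c \<otimes> d)" unfolding sc(3) using c dc by (simp add: m_assoc)
    finally have "g = s \<otimes> (c \<otimes> d)" .
    moreover have "(g \<otimes> d) [^] p \<in> W \<longleftrightarrow> g [^] p \<notin> W"
    proof -
      have gd: "(g \<otimes> d) [^] p = g [^] p \<otimes> d" using g dc d(1) by (simp add: pow_p_mult pow_p_V)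
      have gV: "g [^] p \<in> V" using g by (rule pow_p_in_V)
      show ?thesis
      proof
        assume "(g \<otimes> d) [^] p \<in> W"
        then have 1: "d \<otimes> g [^] p \<in> W" using gd g dc by (simp add: m_comm)
        show "g [^] p \<notin> W" using W_iff[OF _ dc] 1 d(2) by blast
      qed (use coset[OF gV] gd in simp)
    qed
    ultimately show ?thesis using sc by blast
  qed
  have le: "8 * p \<le> card T * 8" if T: "T \<subseteq> S"
    and surj: "\<And>g. g \<in> carrier G \<Longrightarrow> \<exists>s\<in>T. \<exists>c\<in>?C. g = s \<otimes> c" for T
  proof -
    have "carrier G \<subseteq> (\<lambda>(s, c). s \<otimes> c) ` (T \<times> ?C)" using surj by blast
    moreover have "finite (T \<times> ?C)" using T finS finC finite_subset by auto
    ultimately have "card (carrier G) \<le> card (T \<times> ?C)" by (intro surj_card_le) auto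
    also have "\<dots> = card T * card ?C" by (rule card_cartesian_product)
    also have "\<dots> \<le> card T * 8" using card_C by simp
    finally show ?thesis using order_G by (simp add: order_def)
  qed
  have surj0: "\<exists>s\<in>S0. \<exists>c\<in>?C. g = s \<otimes> c" if "g \<in> carrier G" for g
  proof (cases "g [^] p \<in> W")
    case True
    then show ?thesis using split[OF that] unfolding S0_def by blast
  next
    case False
    then show ?thesis using split_d[OF that] unfolding S0_def by blast
  qed
  have surj1: "\<exists>s\<in>S1. \<exists>c\<in>?C. g = s \<otimes> c" if "g \<in> carrier G" for g
  proof (cases "g [^] p \<in> W")
    case True
    then show ?thesis using split_d[OF that] unfolding S1_def by blast
  next
    case False
    then show ?thesis using split[OF that] unfolding S1_def by blast
  qed
  have card_S: "card S = 2 * p" using factorization_card[OF fac] card by (simp add: order_G)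
  have S01: "S0 \<subseteq> S" "S1 \<subseteq> S" "S = S0 \<union> S1" "S0 \<inter> S1 = {}" by (auto simp: S0_def S1_def)
  then have "card S = card S0 + card S1" using finS by (metis card_Un_disjoint finite_Un)
  then have cards: "card S0 = p" "card S1 = p"
    using le[OF S01(1) surj0] le[OF S01(2) surj1] card_S by simp_all
  have facT: "factorization G T ?C" if "T \<subseteq> S" "card T = p"
    "\<And>g. g \<in> carrier G \<Longrightarrow> \<exists>s\<in>T. \<exists>c\<in>?C. g = s \<otimes> c" for T
    using that card_C finS finC finite_subset sub dc
    by (intro factorizationI) (auto simp: order_G)
  note fac0 = facT[OF S01(1) cards(1) surj0] and fac1 = facT[OF S01(2) cards(2) surj1]
  let ?K = "V_stabilizer C"
  have to_K: "v \<in> ?K" if v: "v \<in> V_stabilizer ?C" "v \<in> W" for v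
  proof -
    have "c \<otimes> v \<in> C" if c: "c \<in> C" for c
    proof -
      have cc: "c \<in> carrier G" using c sub by auto
      have vV: "v \<in> V" using v(2) WV by auto
      have "c \<otimes> v \<in> ?C" using V_stabilizerD[OF v(1)] c by simp
      moreover have "c \<otimes> v \<noteq> c' \<otimes> d" if c': "c' \<in> C" for c'
      proof
        assume "c \<otimes> v = c' \<otimes> d"
        then have "(c \<otimes> v) [^] p = (c' \<otimes> d) [^] p" by simp
        then have "c [^] p \<otimes> v = c' [^] p \<otimes> d"
          using cc vV c' sub d(1) V_closed by (auto simp: pow_p_mult pow_p_V subset_iff)
        moreover have "c [^] p \<otimes> v \<in> W" using CW[OF c] v(2) by (rule W_mult)
        ultimately have "d \<otimes> c' [^] p \<in> W" using c' sub dc by (auto simp: m_comm subset_iff)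
        then show False using W_iff[OF CW[OF c'] dc] d(2) by simp
      qed
      ultimately show ?thesis by blast
    qed
    then show ?thesis using v(2) WV by (auto simp: V_stabilizer_def)
  qed
  have K: "subgroup ?K G" using sub(2) by (rule V_stabilizer_subgroup)
  have K0: "s [^] p \<in> ?K" if s: "s \<in> S0" for s
  proof (rule to_K)
    have "\<one> \<in> S0" using one W_one by (simp add: S0_def)
    then show "s [^] p \<in> V_stabilizer ?C" using pow_p_in_V_stabilizer[OF fac0 cards(1) _ s] by simp
  qed (use s in \<open>simp add: S0_def\<close>)
  have "S1 \<noteq> {}" using cards p_gt_1 by auto
  then obtain s1 where s1: "s1 \<in> S1" by blast
  define t where "t = s1 [^] p"
  have tV: "t \<in> V" and tW: "t \<notin> W" using s1 sub pow_p_in_V by (auto simp: S1_def t_def)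
  have K1: "s [^] p \<otimes> t \<in> ?K" if s: "s \<in> S1" for s
  proof (rule to_K)
    show "s [^] p \<otimes> t \<in> V_stabilizer ?C"
      unfolding t_def using fac1 cards(2) s s1 by (rule pow_p_mult_in_V_stabilizer)
    have sV: "s [^] p \<in> V" "s [^] p \<notin> W" using s sub pow_p_in_V by (auto simp: S1_def)
    \<comment> \<open>Two elements outside \<open>W\<close> have their product in \<open>W\<close>, because \<open>W\<close> has index \<open>2\<close> in \<open>V\<close>.\<close>
    have "s [^] p \<otimes> d \<otimes> (t \<otimes> d) \<in> W" using coset[OF sV] coset[OF tV tW] by (rule W_mult)
    moreover have "s [^] p \<otimes> d \<otimes> (t \<otimes> d) = s [^] p \<otimes> t \<otimes> d \<otimes> d"
      using sV tV dc by (simp add: V_closed m_ac)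
    ultimately show "s [^] p \<otimes> t \<in> W" using sV tV d(1) by (simp add: V_cancel V_closed)
  qed
  have KC: "?K \<subseteq> C" using V_stabilizer_subset[OF one(2)] .
  have tK: "t \<notin> ?K"
  proof
    assume "t \<in> ?K"
    then have "t \<in> C" using KC by blast
    then show False using CW[of t] pow_p_V[OF tV] tW by simp
  qed
  note KK = card_double_subgroup[OF K V_stabilizer_subset_V tV tK]
  have "?K \<union> (\<lambda>k. k \<otimes> t) ` ?K = V"
    using gen KK(1,2)
  proof (rule generating_pow_p)
    fix s assume s: "s \<in> S"
    show "s [^] p \<in> ?K \<union> (\<lambda>k. k \<otimes> t) ` ?K"
    proof (cases "s \<in> S0")
      case True
      then show ?thesis using K0 by simp
    next
      case False
      then have "s \<in> S1" using s S01 by blast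
      moreover have "s [^] p \<otimes> t \<otimes> t = s [^] p" using tV s sub by (auto simp: V_cancel)
      ultimately show ?thesis using K1[of s] by force
    qed
  qed (rule sub(1))
  then have "card ?K = 4" using KK(3) V_card by simp
  then have KC_eq: "?K = C" using KC finC card by (intro card_subset_eq) simp_all
  then have CV: "C \<subseteq> V" using V_stabilizer_subset_V by blast
  obtain x where x: "x \<in> C" "x \<noteq> \<one>"
    using card card_mono[of "{\<one>}" C] by force
  have "subgroup C G" "C \<noteq> V" using K KC_eq card V_card by auto
  from this(1) CV this(2) x show ?thesis
  proof (cases rule: proper_subgroup_basis)
    case (two y z)
    then show ?thesis using card x by simp
  next
    case (four y z)
    interpret B: zp_times_z2_cubed_basis G p e1 V x y z by unfold_locales (rule four(1))
    have C_eq: "C = {B.comb 0 b c 0 | b c. True}" using four(2) B.four_eq by simp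
    have S1: "\<exists>a b. B.comb i a b j \<in> S" for i j
    proof -
      have "B.comb i 0 0 j \<in> carrier G" by simp
      with fac obtain s c where s: "s \<in> S" "c \<in> C" "B.comb i 0 0 j = s \<otimes> c" by (rule factorizationE)
      then obtain a b where c: "c = B.comb 0 a b 0" unfolding C_eq by blast
      have "c \<in> V" "s \<in> carrier G" using s sub CV by blast+
      then have "s = B.comb i 0 0 j \<otimes> c" unfolding s(3) by (simp add: V_cancel)
      then show ?thesis using s(1) c by (auto simp: B.comb_mult)
    qed
    have z: "B.comb 0 0 0 0 \<in> S" using one B.comb_0 by simp
    obtain \<alpha> where \<alpha>: "\<alpha> 0 0 = 0" "\<forall>i\<in>UNIV. \<forall>j\<in>UNIV. \<exists>b. B.comb i (\<alpha> i j) b j \<in> S"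
      using choice_based2[of "\<lambda>i j a. \<exists>b. B.comb i a b j \<in> S" 0 0 0 UNIV UNIV] S1 z by blast
    obtain \<beta> where \<beta>: "\<beta> 0 0 = 0" "\<forall>i\<in>UNIV. \<forall>j\<in>UNIV. B.comb i (\<alpha> i j) (\<beta> i j) j \<in> S"
      using choice_based2[of "\<lambda>i j b. B.comb i (\<alpha> i j) b j \<in> S" 0 0 0 UNIV UNIV] \<alpha> z by auto
    have "B.standard_pair S C"
      by (rule B.standard_pair_4I[where \<alpha> = \<alpha> and \<beta> = \<beta>, OF fac \<alpha>(1) \<beta>(1)])
        (use \<beta> C_eq in auto)
    then show ?thesis using four(1) unfolding standard_form_def by blast
  qed
qed

section \<open>The classification\<close>

lemma card_cofactor:
  assumes "a * b = 8 * p" "p dvd a"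
  obtains "b = 1" "a = 8 * p" | "b = 2" | "b = 4" | "b = 8" "a = p"
proof -
  obtain k where k: "a = p * k" using assms(2) by (rule dvdE)
  then have kb: "k * b = 8" using assms(1) p_gt_1 by (simp add: mult.assoc mult.commute[of 8])
  then have "b dvd 8" by (metis dvd_triv_right)
  then have "b \<le> 8" by (rule dvd_imp_le) simp
  then have "b = 0 \<or> b = 1 \<or> b = 2 \<or> b = 3 \<or> b = 4 \<or> b = 5 \<or> b = 6 \<or> b = 7 \<or> b = 8"
    by arith
  with kb have "b = 1 \<and> k = 8 \<or> b = 2 \<or> b = 4 \<or> b = 8 \<and> k = 1"
    by (elim disjE; simp; presburger)
  then show ?thesis using that k by auto
qed

text \<open>
  The prime \<open>p\<close> divides the size of exactly one factor, and the other has \<open>1\<close>, \<open>2\<close>, \<open>4\<close> or \<open>8\<close> elements.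
  The size \<open>1\<close> for \<open>C\<close> contradicts properness of \<open>S\<close>; the sizes \<open>1\<close> and \<open>2\<close> for \<open>S\<close> contradict generation.
\<close>

theorem factorization_imp_standard_form:
  assumes fac: "factorization G S C" and gen: "generate G S = carrier G" and "S \<noteq> carrier G"
    and one: "\<one> \<in> S" "\<one> \<in> C"
  shows "standard_form S C"
proof -
  have sub: "S \<subseteq> carrier G" "C \<subseteq> carrier G" using fac by (auto simp: factorization_def)
  have finS: "finite S" using sub(1) finite_G by (rule finite_subset)
  have prod: "card S * card C = 8 * p" using factorization_card[OF fac] order_G by simp
  then have "p dvd card S * card C" by simp
  then consider "p dvd card S" | "p dvd card C" using p_prime prime_dvd_multD by blast
  then show ?thesis
  proof cases
    case 1
    from prod 1 show ?thesis
    proof (cases rule: card_cofactor)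
      case 1
      then have "S = carrier G" using sub(1) finite_G order_G by (intro card_subset_eq) (simp_all add: order_def)
      then show ?thesis using assms(3) by simp
    next
      case 2
      then show ?thesis using fac one by (intro standard_form_code_2)
    next
      case 3
      then show ?thesis
        using standard_form_code_4_independent[OF fac gen one] standard_form_code_4_subgroup[OF fac gen one]
        by blast
    next
      case 4
      then show ?thesis using fac gen one by (intro standard_form_code_8)
    qed
  next
    case 2
    have few: "\<not> card S \<le> 2"
    proof
      assume "card S \<le> 2"
      then have "card (S - {\<one>}) \<le> 1" using one(1) finS by simp
      then obtain x where x: "S - {\<one>} \<subseteq> {x}" "x \<in> carrier G"
        using sub(1) finS by (cases "S - {\<one>} = {}") (auto simp: card_le_Suc0_iff_eq)
      have xV: "x [^] p \<in> V" using x(2) by (rule pow_p_in_V)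
      then have sV: "{\<one>, x [^] p} \<subseteq> V" using V_one by simp
      have sq: "subgroup {\<one>, x [^] p} G"
        using sV by (rule V_subgroupI) (use xV V_square V_closed in auto)
      have "{\<one>, x [^] p} = V"
        using gen sq sV
      proof (rule generating_pow_p)
        fix s assume "s \<in> S"
        then have "s = \<one> \<or> s = x" using x(1) by blast
        then show "s [^] p \<in> {\<one>, x [^] p}" by auto
      qed (rule sub(1))
      then have "card {\<one>, x [^] p} = 8" using V_card by simp
      then show False by (simp add: card_insert_if split: if_splits)
    qed
    have "card C * card S = 8 * p" using prod by (simp add: mult.commute)
    from this 2 show ?thesis
    proof (cases rule: card_cofactor)
      case 3
      then show ?thesis using fac gen one by (intro standard_form_connection_4)
    next
      case 4
      then show ?thesis using fac gen one by (intro standard_form_connection_8)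
    qed (use few in simp_all)
  qed
qed

lemma standard_form_imp_factorization:
  assumes "standard_form S C" shows "factorization G S C"
proof -
  obtain e2 e3 e4 where b: "generate G {e2, e3, e4} = V"
    and s: "zp_times_z2_cubed_basis.standard_pair G p e1 e2 e3 e4 S C"
    using assms unfolding standard_form_def by blast
  interpret B: zp_times_z2_cubed_basis G p e1 V e2 e3 e4 by unfold_locales (rule b)
  show ?thesis using s by (rule B.standard_pair_factorization)
qed

end

lemma zp_times_z2_cubed_integer_mod_groups:
  assumes "prime p" "odd p"
  defines "Z \<equiv> integer_mod_group p \<times>\<times> integer_mod_group 2 \<times>\<times> integer_mod_group 2 \<times>\<times> integer_mod_group 2"
    and "Z2 \<equiv> carrier (integer_mod_group 2)"
  shows "zp_times_z2_cubed Z p (1, 0, 0, 0) ({0} \<times> Z2 \<times> Z2 \<times> Z2)"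
proof -
  have p1: "p > 1" using assms(1) by (rule prime_gt_1_nat)
  have "group Z" unfolding Z_def by (intro DirProd_group group_integer_mod_group)
  then have "comm_group Z"
    by (rule group.group_comm_groupI) (auto simp: Z_def add.commute)
  then interpret Z: comm_group Z .
  have carr: "carrier Z = {0..<int p} \<times> {0..<2} \<times> {0..<2} \<times> {0..<2}"
    using p1 by (simp add: Z_def carrier_integer_mod_group)
  have Z2: "Z2 = {0, 1}" by (auto simp: Z2_def carrier_integer_mod_group)
  have e1: "(1, 0, 0, 0) \<in> carrier Z" using p1 by (simp add: carr)
  have pow: "(1, 0, 0, 0) [^]\<^bsub>Z\<^esub> n = (int n mod int p, 0, 0, 0)" for n :: nat
  proof (induction n)
    case 0
    then show ?case by (simp add: Z_def)
  next
    case (Suc n)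
    then show ?case by (simp add: Z_def mod_simps add.commute)
  qed
  have ipow: "(1, 0, 0, 0) [^]\<^bsub>Z\<^esub> i = (i, 0, 0, 0)" if "i \<in> {0..<int p}" for i
    using pow[of "nat i"] that by (simp flip: int_pow_int)
  let ?V = "{0} \<times> Z2 \<times> Z2 \<times> Z2"
  have V: "?V \<subseteq> carrier Z" using p1 by (auto simp: carr Z2)
  show ?thesis
  proof
    show "prime p" "odd p" by fact+
    show "(1, 0, 0, 0) \<in> carrier Z" by (rule e1)
    show "(1, 0, 0, 0) [^]\<^bsub>Z\<^esub> p = \<one>\<^bsub>Z\<^esub>" unfolding pow by (simp add: Z_def)
    show sq: "v \<otimes>\<^bsub>Z\<^esub> v = \<one>\<^bsub>Z\<^esub>" if "v \<in> ?V" for v using that by (auto simp: Z_def Z2)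
    show "?V \<subseteq> carrier Z" by (rule V)
    show "x \<otimes>\<^bsub>Z\<^esub> y \<in> ?V" if "x \<in> ?V" "y \<in> ?V" for x y using that by (auto simp: Z_def Z2)
    show "\<one>\<^bsub>Z\<^esub> \<in> ?V" by (simp add: Z_def Z2)
    show "inv\<^bsub>Z\<^esub> x \<in> ?V" if "x \<in> ?V" for x
    proof -
      have "x \<in> carrier Z" using that V by blast
      then have "inv\<^bsub>Z\<^esub> x = x" using Z.inv_equality[OF sq[OF that]] by simp
      then show ?thesis using that by simp
    qed
    show "card ?V = 8" by (simp add: Z2 card_cartesian_product)
    show "bij_betw (\<lambda>(i, v). (1, 0, 0, 0) [^]\<^bsub>Z\<^esub> i \<otimes>\<^bsub>Z\<^esub> v) ({0..<int p} \<times> ?V) (carrier Z)"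
    proof -
      have eq: "(1, 0, 0, 0) [^]\<^bsub>Z\<^esub> i \<otimes>\<^bsub>Z\<^esub> v = (i, snd v)" if "i \<in> {0..<int p}" "v \<in> ?V" for i v
        using that ipow[OF that(1)] by (auto simp: Z_def Z2)
      have Z2': "Z2 = {0..<2}" by (simp add: Z2_def carrier_integer_mod_group)
      have "bij_betw (\<lambda>(i, v). (i, snd v)) ({0..<int p} \<times> ?V) (carrier Z)"
        by (rule bij_betw_byWitness[where f' = "\<lambda>(i, r). (i, (0, r))"]) (auto simp: carr Z2')
      then show ?thesis
        by (rule bij_betw_cong[THEN iffD1, rotated]) (use eq in auto)
    qed
  qed
qed

theorem theorem5p8:
  fixes p :: nat
    and G :: "(int \<times> int \<times> int \<times> int) monoid" (structure)
    and S S\<^sub>0 C :: "(int \<times> int \<times> int \<times> int) set"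
    and e\<^sub>1 :: "int \<times> int \<times> int \<times> int"
  assumes "prime p" and "odd p"
    and "G = integer_mod_group p \<times>\<times> integer_mod_group 2 \<times>\<times> integer_mod_group 2 \<times>\<times> integer_mod_group 2"
    and "S \<subset> carrier G - {\<one>}"
    and "generate G S = carrier G"
    and "S\<^sub>0 = insert \<one> S"
    and "C \<subseteq> carrier G" and "\<one> \<in> C"
    and "e\<^sub>1 = (1, 0, 0, 0)"
  shows "perfect_code (cayley_digraph G S) C \<longleftrightarrow>
    (\<exists>e\<^sub>2 e\<^sub>3 e\<^sub>4.
       generate G {e\<^sub>2, e\<^sub>3, e\<^sub>4} =
         {0} \<times> carrier (integer_mod_group 2) \<times> carrier (integer_mod_group 2) \<times> carrier (integer_mod_group 2) \<and>
       ((\<exists>(\<alpha> :: int \<Rightarrow> int) (\<beta> :: int \<Rightarrow> int) (\<gamma> :: int \<Rightarrow> int).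
           \<alpha> 0 = 0 \<and> \<beta> 0 = 0 \<and> \<gamma> 0 = 0 \<and>
           S\<^sub>0 = {e\<^sub>1 [^] i \<otimes> e\<^sub>2 [^] \<alpha> i \<otimes> e\<^sub>3 [^] \<beta> i \<otimes> e\<^sub>4 [^] \<gamma> i | i. i \<in> {0..<int p}} \<and>
           C = {e\<^sub>2 [^] i \<otimes> e\<^sub>3 [^] j \<otimes> e\<^sub>4 [^] k | i j k. i \<in> {0..<2::int} \<and> j \<in> {0..<2::int} \<and> k \<in> {0..<2::int}}) \<or>
         (\<exists>(\<alpha> :: int \<Rightarrow> int) (\<beta> :: int \<Rightarrow> int) (\<kappa> :: int \<Rightarrow> int \<Rightarrow> int).
           \<alpha> 0 = 0 \<and> \<beta> 0 = 0 \<and> \<kappa> 0 0 = 0 \<and>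
           S\<^sub>0 = {e\<^sub>1 [^] i \<otimes> e\<^sub>2 [^] j \<otimes> e\<^sub>3 [^] \<alpha> i \<otimes> e\<^sub>4 [^] \<beta> i | i j. i \<in> {0..<int p} \<and> j \<in> {0..<2::int}} \<and>
           C = {e\<^sub>2 [^] \<kappa> i j \<otimes> e\<^sub>3 [^] i \<otimes> e\<^sub>4 [^] j | i j. i \<in> {0..<2::int} \<and> j \<in> {0..<2::int}}) \<or>
         (\<exists>(\<alpha> :: int \<Rightarrow> int \<Rightarrow> int) (\<alpha>' :: int \<Rightarrow> int) (\<kappa> :: int \<Rightarrow> int).
           \<alpha> 0 0 = 0 \<and> \<alpha>' 0 = 0 \<and> \<kappa> 0 = 0 \<and>
           S\<^sub>0 = {e\<^sub>1 [^] i \<otimes> e\<^sub>2 [^] \<alpha> i j \<otimes> e\<^sub>3 [^] j \<otimes> e\<^sub>4 [^] \<alpha>' i | i j. i \<in> {0..<int p} \<and> j \<in> {0..<2::int}} \<and>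
           C = {e\<^sub>2 [^] j \<otimes> e\<^sub>3 [^] \<kappa> i \<otimes> e\<^sub>4 [^] i | i j. i \<in> {0..<2::int} \<and> j \<in> {0..<2::int}}) \<or>
         (\<exists>(\<alpha> :: int \<Rightarrow> int \<Rightarrow> int) (\<beta> :: int \<Rightarrow> int \<Rightarrow> int).
           \<alpha> 0 0 = 0 \<and> \<beta> 0 0 = 0 \<and>
           S\<^sub>0 = {e\<^sub>1 [^] i \<otimes> e\<^sub>2 [^] \<alpha> i j \<otimes> e\<^sub>3 [^] \<beta> i j \<otimes> e\<^sub>4 [^] j | i j. i \<in> {0..<int p} \<and> j \<in> {0..<2::int}} \<and>
           C = {e\<^sub>2 [^] i \<otimes> e\<^sub>3 [^] j | i j. i \<in> {0..<2::int} \<and> j \<in> {0..<2::int}}) \<or>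
         (\<exists>(\<alpha>' :: int \<Rightarrow> int) (\<alpha> :: int \<Rightarrow> int \<Rightarrow> int) (\<kappa> :: int \<Rightarrow> int).
           \<alpha>' 0 = 0 \<and> \<alpha> 0 0 = 0 \<and> \<kappa> 0 = 0 \<and>
           S\<^sub>0 = {e\<^sub>1 [^] \<alpha>' i \<otimes> e\<^sub>2 [^] \<alpha> i j \<otimes> e\<^sub>3 [^] j \<otimes> e\<^sub>4 [^] i | i j. i \<in> {0..<2::int} \<and> j \<in> {0..<2::int}} \<and>
           C = {e\<^sub>1 [^] i \<otimes> e\<^sub>2 [^] j \<otimes> e\<^sub>3 [^] \<kappa> i | i j. i \<in> {0..<int p} \<and> j \<in> {0..<2::int}}) \<or>
         (\<exists>(\<alpha> :: int \<Rightarrow> int \<Rightarrow> int).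
           \<alpha> 0 0 = 0 \<and>
           S\<^sub>0 = {e\<^sub>1 [^] \<alpha> i j \<otimes> e\<^sub>2 [^] \<alpha> i j \<otimes> e\<^sub>3 [^] i \<otimes> e\<^sub>4 [^] j | i j. i \<in> {0..<2::int} \<and> j \<in> {0..<2::int}} \<and>
           C = {e\<^sub>1 [^] i \<otimes> e\<^sub>2 [^] j | i j. i \<in> {0..<int p} \<and> j \<in> {0..<2::int}}) \<or>
         (\<exists>(\<alpha> :: int \<Rightarrow> int \<Rightarrow> int) (\<kappa> :: int \<Rightarrow> int).
           \<alpha> 0 0 = 0 \<and> \<kappa> 0 = 0 \<and>
           S\<^sub>0 = {e\<^sub>1 [^] i \<otimes> e\<^sub>2 [^] k \<otimes> e\<^sub>3 [^] \<alpha> i j \<otimes> e\<^sub>4 [^] j | i j k. i \<in> {0..<int p} \<and> j \<in> {0..<2::int} \<and> k \<in> {0..<2::int}} \<and>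
           C = {e\<^sub>2 [^] \<kappa> i \<otimes> e\<^sub>3 [^] i | i. i \<in> {0..<2::int}}) \<or>
         (\<exists>(\<alpha> :: int \<Rightarrow> int \<Rightarrow> int) (\<kappa> :: int \<Rightarrow> int).
           \<alpha> 0 0 = 0 \<and> \<kappa> 0 = 0 \<and>
           S\<^sub>0 = {e\<^sub>1 [^] k \<otimes> e\<^sub>2 [^] \<alpha> i j \<otimes> e\<^sub>3 [^] i \<otimes> e\<^sub>4 [^] j | i j k. i \<in> {0..<2::int} \<and> j \<in> {0..<2::int} \<and> k \<in> {0..<int p}} \<and>
           C = {e\<^sub>1 [^] \<kappa> i \<otimes> e\<^sub>2 [^] i | i. i \<in> {0..<2::int}}) \<or>
         (\<exists>(\<alpha> :: int \<Rightarrow> int) (\<kappa> :: int \<Rightarrow> int) (\<mu> :: int \<Rightarrow> int).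
           \<alpha> 0 = 0 \<and> \<kappa> 0 = 0 \<and> \<mu> 0 = 0 \<and>
           S\<^sub>0 = {e\<^sub>1 [^] i \<otimes> e\<^sub>2 [^] j \<otimes> e\<^sub>3 [^] k \<otimes> e\<^sub>4 [^] \<alpha> i | i j k. i \<in> {0..<int p} \<and> j \<in> {0..<2::int} \<and> k \<in> {0..<2::int}} \<and>
           C = {e\<^sub>2 [^] \<kappa> i \<otimes> e\<^sub>3 [^] \<mu> i \<otimes> e\<^sub>4 [^] i | i. i \<in> {0..<2::int}}) \<or>
         (\<exists>(\<alpha> :: int \<Rightarrow> int \<Rightarrow> int \<Rightarrow> int).
           \<alpha> 0 0 0 = 0 \<and>
           S\<^sub>0 = {e\<^sub>1 [^] i \<otimes> e\<^sub>2 [^] \<alpha> i j k \<otimes> e\<^sub>3 [^] j \<otimes> e\<^sub>4 [^] k | i j k. i \<in> {0..<int p} \<and> j \<in> {0..<2::int} \<and> k \<in> {0..<2::int}} \<and>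
           C = {e\<^sub>2 [^] i | i. i \<in> {0..<2::int}}) \<or>
         (\<exists>(\<alpha> :: int \<Rightarrow> int \<Rightarrow> int) (\<kappa> :: int \<Rightarrow> int).
           \<alpha> 0 0 = 0 \<and> \<kappa> 0 = 0 \<and>
           S\<^sub>0 = {e\<^sub>1 [^] \<alpha> i j \<otimes> e\<^sub>2 [^] k \<otimes> e\<^sub>3 [^] i \<otimes> e\<^sub>4 [^] j | i j k. i \<in> {0..<2::int} \<and> j \<in> {0..<2::int} \<and> k \<in> {0..<2::int}} \<and>
           C = {e\<^sub>1 [^] i \<otimes> e\<^sub>2 [^] \<kappa> i | i. i \<in> {0..<int p}}) \<or>
         (\<exists>(\<alpha> :: int \<Rightarrow> int) (\<kappa> :: int \<Rightarrow> int) (\<mu> :: int \<Rightarrow> int).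
           \<alpha> 0 = 0 \<and> \<kappa> 0 = 0 \<and> \<mu> 0 = 0 \<and>
           S\<^sub>0 = {e\<^sub>1 [^] \<alpha> i \<otimes> e\<^sub>2 [^] j \<otimes> e\<^sub>3 [^] k \<otimes> e\<^sub>4 [^] i | i j k. i \<in> {0..<2::int} \<and> j \<in> {0..<2::int} \<and> k \<in> {0..<2::int}} \<and>
           C = {e\<^sub>1 [^] i \<otimes> e\<^sub>2 [^] \<kappa> i \<otimes> e\<^sub>3 [^] \<mu> i | i. i \<in> {0..<int p}}) \<or>
         (\<exists>(\<alpha> :: int \<Rightarrow> int \<Rightarrow> int \<Rightarrow> int).
           \<alpha> 0 0 0 = 0 \<and>
           S\<^sub>0 = {e\<^sub>1 [^] \<alpha> i j k \<otimes> e\<^sub>2 [^] i \<otimes> e\<^sub>3 [^] j \<otimes> e\<^sub>4 [^] k | i j k. i \<in> {0..<2::int} \<and> j \<in> {0..<2::int} \<and> k \<in> {0..<2::int}} \<and>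
           C = {e\<^sub>1 [^] i | i. i \<in> {0..<int p}})))"
proof -
  let ?V = "{0} \<times> carrier (integer_mod_group 2) \<times> carrier (integer_mod_group 2) \<times>
    carrier (integer_mod_group 2) :: (int \<times> int \<times> int \<times> int) set"
  interpret zp_times_z2_cubed G p e\<^sub>1 ?V
    unfolding assms(3,9) by (rule zp_times_z2_cubed_integer_mod_groups[OF assms(1,2)])
  have S: "S \<subseteq> carrier G" "\<one> \<notin> S" "S \<noteq> carrier G - {\<one>}" using assms(4) by auto
  have S0: "S\<^sub>0 \<subseteq> carrier G" "\<one> \<in> S\<^sub>0" "S\<^sub>0 \<noteq> carrier G" using S assms(6) by auto
  have "carrier G \<subseteq> generate G S\<^sub>0"
    using mono_generate[of S S\<^sub>0] assms(5,6) by auto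
  then have gen: "generate G S\<^sub>0 = carrier G"
    using generate_incl[OF S0(1)] by (rule equalityI[rotated])
  have "perfect_code (cayley_digraph G S) C \<longleftrightarrow> factorization G S\<^sub>0 C"
    unfolding assms(6) by (rule perfect_code_cayley_digraph_iff[OF S(1) assms(7)])
  also have "\<dots> \<longleftrightarrow> standard_form S\<^sub>0 C"
    using factorization_imp_standard_form[OF _ gen S0(3,2) assms(8)] standard_form_imp_factorization
    by blast
  finally have iff: "perfect_code (cayley_digraph G S) C \<longleftrightarrow> standard_form S\<^sub>0 C" .
  show ?thesis
    unfolding iff standard_form_def
    apply (intro ex_cong1 conj_cong refl)
    subgoal premises b for e2 e3 e4
    proof -
      interpret B: zp_times_z2_cubed_basis G p e\<^sub>1 ?V e2 e3 e4 by unfold_locales (rule b)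
      show ?thesis
        by (simp only: B.standard_pair_def B.comb_def int_pow_0 l_one r_one m_closed int_pow_closed e1_closed
            B.basis_closed)
    qed
    done
qed

end
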